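(* Let $g_1$ and $g_2$ be two flat metrics on a compact connected oriented two-dimensional manifold $M$ with non-empty boundary $\Gamma=\partial M$. Assume that these metrics induce the same arc length on $\Gamma$. Let $\psi:M\to M$ be a homeomorphism such that (1) the restriction of $\psi$ to $\Gamma$ is the identity map, and (2) for $\stackrel{\circ}{M}=M\setminus\Gamma$, the restriction $\psi|_{\stackrel{\circ}{M}}:(\stackrel{\circ}{M},g_1)\to(\stackrel{\circ}{M},g_2)$ is a conformal map. Then $\psi:(M,g_1)\to(M,g_2)$ is an isometry.
   Context: Smooth means $C^\infty$; manifolds and Riemannian metrics are smooth (up to the boundary). A flat metric on a two-dimensional manifold is a Riemannian metric whose Gaussian curvature is identically zero. A smooth map $\varphi:(M_1,g_1)\to(M_2,g_2)$ between two-dimensional Riemannian manifolds is conformal if $\varphi^*g_2=\rho g_1$ for some function $0<\rho\in C^\infty(M_1)$. An isometry is a diffeomorphism $\psi$ with $\psi^*g_2=g_1$. *)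

theory Defs
  imports "HOL-Analysis.Analysis"
begin

section \<open>Smooth functions\<close>

text \<open>\<open>C_k_on k f W\<close> is meant for open \<open>W\<close>: all iterated directional derivatives of order
  at most \<open>k\<close> exist and are continuous.\<close>

primrec C_k_on ::
  "nat \<Rightarrow> ('a::euclidean_space \<Rightarrow> 'b::real_normed_vector) \<Rightarrow> 'a set \<Rightarrow> bool" where
  "C_k_on 0 f W \<longleftrightarrow> continuous_on W f"
| "C_k_on (Suc k) f W \<longleftrightarrow>
     (\<forall>x\<in>W. f differentiable (at x)) \<and>
     (\<forall>v. C_k_on k (\<lambda>x. frechet_derivative f (at x) v) W)"

text \<open>On a set that need not be open (a relatively open subset of a half-plane, an interval),
  smooth means: near each point of the set, the restriction of a function that is
  \<open>C\<^sup>\<infinity>\<close> on an open neighbourhood. This is smoothness up to the boundary.\<close>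

definition smooth_on ::
  "('a::euclidean_space) set \<Rightarrow> ('a \<Rightarrow> 'b::real_normed_vector) \<Rightarrow> bool" where
  "smooth_on A f \<longleftrightarrow>
     (\<forall>p\<in>A. \<exists>W F. open W \<and> p \<in> W \<and> (\<forall>k. C_k_on k F W) \<and> (\<forall>x\<in>W \<inter> A. F x = f x))"


section \<open>Surfaces with boundary\<close>

text \<open>A chart is a pair (domain, coordinate map); the values of the coordinate map outside the
  domain are irrelevant.\<close>

type_synonym 'a chart = "'a set \<times> ('a \<Rightarrow> real^2)"

definition half_plane :: "(real^2) set" where
  "half_plane = {x. 0 \<le> x $ 2}"

definition is_chart :: "'a::topological_space set \<Rightarrow> 'a chart \<Rightarrow> bool" where
  "is_chart M c \<longleftrightarrow>
     openin (top_of_set M) (fst c) \<and>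
     openin (top_of_set half_plane) (snd c ` fst c) \<and>
     (\<exists>h. homeomorphism (fst c) (snd c ` fst c) (snd c) h)"

definition inv_chart :: "'a chart \<Rightarrow> real^2 \<Rightarrow> 'a" where
  "inv_chart c = inv_into (fst c) (snd c)"

text \<open>Coordinate expression \<open>local_rep c d f\<close> of a map \<open>f\<close>, defined on \<open>S\<close>, in charts \<open>c\<close> of the
  source and \<open>d\<close> of the target; \<open>local_dom S c d f\<close> is the part of the coordinate plane where it
  makes sense, and \<open>local_jac S c d f x\<close> its Jacobian matrix at \<open>x\<close>. The derivative is taken
  within the domain, so that it is also meaningful (and unique) at boundary points.\<close>

definition local_dom :: "'a set \<Rightarrow> 'a chart \<Rightarrow> 'b chart \<Rightarrow> ('a \<Rightarrow> 'b) \<Rightarrow> (real^2) set" where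
  "local_dom S c d f = snd c ` {p \<in> S \<inter> fst c. f p \<in> fst d}"

definition local_rep :: "'a chart \<Rightarrow> 'b chart \<Rightarrow> ('a \<Rightarrow> 'b) \<Rightarrow> real^2 \<Rightarrow> real^2" where
  "local_rep c d f = snd d \<circ> f \<circ> inv_chart c"

definition local_jac ::
  "'a set \<Rightarrow> 'a chart \<Rightarrow> 'b chart \<Rightarrow> ('a \<Rightarrow> 'b) \<Rightarrow> real^2 \<Rightarrow> real^2^2" where
  "local_jac S c d f x =
     matrix (frechet_derivative (local_rep c d f) (at x within local_dom S c d f))"

text \<open>The local representative of \<open>id\<close> is the transition map between two charts.
  The Hausdorff property and second countability of \<open>M\<close> come from the type classes.\<close>

definition smooth_surface ::
  "'a::{t2_space,second_countable_topology} set \<Rightarrow> 'a chart set \<Rightarrow> bool" where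
  "smooth_surface M \<A> \<longleftrightarrow>
     (\<forall>c\<in>\<A>. is_chart M c) \<and>
     (\<Union>c\<in>\<A>. fst c) = M \<and>
     (\<forall>c\<in>\<A>. \<forall>d\<in>\<A>. smooth_on (local_dom M c d id) (local_rep c d id))"

text \<open>An orientation is given by an atlas with orientation-preserving transition maps.\<close>

definition oriented_surface ::
  "'a::{t2_space,second_countable_topology} set \<Rightarrow> 'a chart set \<Rightarrow> bool" where
  "oriented_surface M \<A> \<longleftrightarrow>
     smooth_surface M \<A> \<and>
     (\<forall>c\<in>\<A>. \<forall>d\<in>\<A>. \<forall>x\<in>local_dom M c d id. 0 < det (local_jac M c d id x))"

definition boundary_of :: "'a set \<Rightarrow> 'a chart set \<Rightarrow> 'a set" where
  "boundary_of M \<A> = {p \<in> M. \<exists>c\<in>\<A>. p \<in> fst c \<and> snd c p $ 2 = 0}"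


section \<open>Smooth maps\<close>

text \<open>\<open>S\<close> and \<open>T\<close> are (open subsets of) surfaces with atlases \<open>\<A>\<close> and \<open>\<B>\<close>; an open subset
  carries the structure restricted from the surface.\<close>

definition smooth_fun :: "'a set \<Rightarrow> 'a chart set \<Rightarrow> ('a \<Rightarrow> real) \<Rightarrow> bool" where
  "smooth_fun S \<A> \<rho> \<longleftrightarrow> (\<forall>c\<in>\<A>. smooth_on (snd c ` (S \<inter> fst c)) (\<rho> \<circ> inv_chart c))"

definition smooth_map ::
  "'a::topological_space set \<Rightarrow> 'a chart set \<Rightarrow> 'b::topological_space set \<Rightarrow> 'b chart set
     \<Rightarrow> ('a \<Rightarrow> 'b) \<Rightarrow> bool" where
  "smooth_map S \<A> T \<B> f \<longleftrightarrow>
     continuous_on S f \<and> f ` S \<subseteq> T \<and>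
     (\<forall>c\<in>\<A>. \<forall>d\<in>\<B>. smooth_on (local_dom S c d f) (local_rep c d f))"

definition diffeo ::
  "'a::topological_space set \<Rightarrow> 'a chart set \<Rightarrow> 'b::topological_space set \<Rightarrow> 'b chart set
     \<Rightarrow> ('a \<Rightarrow> 'b) \<Rightarrow> bool" where
  "diffeo S \<A> T \<B> f \<longleftrightarrow>
     smooth_map S \<A> T \<B> f \<and>
     (\<exists>h. smooth_map T \<B> S \<A> h \<and> (\<forall>p\<in>S. h (f p) = p) \<and> (\<forall>q\<in>T. f (h q) = q))"


section \<open>Riemannian metrics\<close>

text \<open>A metric is given by its coordinate expressions: \<open>g c x\<close> is the matrix of components
  \<open>g\<^sub>i\<^sub>j\<close> in the chart \<open>c\<close> at the point with coordinates \<open>x\<close>.\<close>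

type_synonym 'a metric = "'a chart \<Rightarrow> real^2 \<Rightarrow> real^2^2"

text \<open>Component matrix of \<open>f\<^sup>* h\<close> in the chart \<open>c\<close>, computed through the target chart \<open>d\<close>.\<close>

definition pullback ::
  "'a set \<Rightarrow> 'a chart \<Rightarrow> 'b chart \<Rightarrow> ('a \<Rightarrow> 'b) \<Rightarrow> 'b metric \<Rightarrow> real^2 \<Rightarrow> real^2^2" where
  "pullback S c d f h x =
     transpose (local_jac S c d f x) ** h d (local_rep c d f x) ** local_jac S c d f x"

text \<open>The last condition, with \<open>f = id\<close>, is the transformation law of a covariant 2-tensor
  under change of coordinates.\<close>

definition riemannian_metric :: "'a set \<Rightarrow> 'a chart set \<Rightarrow> 'a metric \<Rightarrow> bool" where
  "riemannian_metric M \<A> g \<longleftrightarrow>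
     (\<forall>c\<in>\<A>. smooth_on (snd c ` fst c) (g c)) \<and>
     (\<forall>c\<in>\<A>. \<forall>x\<in>snd c ` fst c.
        transpose (g c x) = g c x \<and> (\<forall>v. v \<noteq> 0 \<longrightarrow> 0 < v \<bullet> (g c x *v v))) \<and>
     (\<forall>c\<in>\<A>. \<forall>d\<in>\<A>. \<forall>x\<in>local_dom M c d id. g c x = pullback M c d id g x)"

definition pderiv_within ::
  "(real^2) set \<Rightarrow> 2 \<Rightarrow> (real^2 \<Rightarrow> real) \<Rightarrow> real^2 \<Rightarrow> real" where
  "pderiv_within D i f x = frechet_derivative f (at x within D) (axis i 1)"

text \<open>\<open>christoffel D h l i j\<close> is \<open>\<Gamma>\<^sup>l\<^sub>i\<^sub>j\<close> of the metric with component matrix \<open>h\<close> on \<open>D\<close>.\<close>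

definition christoffel ::
  "(real^2) set \<Rightarrow> (real^2 \<Rightarrow> real^2^2) \<Rightarrow> 2 \<Rightarrow> 2 \<Rightarrow> 2 \<Rightarrow> real^2 \<Rightarrow> real" where
  "christoffel D h l i j x =
     1/2 * (\<Sum>m\<in>UNIV. matrix_inv (h x) $ l $ m *
       (pderiv_within D i (\<lambda>y. h y $ j $ m) x
        + pderiv_within D j (\<lambda>y. h y $ i $ m) x
        - pderiv_within D m (\<lambda>y. h y $ i $ j) x))"

text \<open>\<open>curvature_tensor D h l i j k\<close> is the \<open>l\<close>-th component of
  \<open>R(\<partial>\<^sub>i,\<partial>\<^sub>j)\<partial>\<^sub>k = \<nabla>\<^sub>i\<nabla>\<^sub>j\<partial>\<^sub>k - \<nabla>\<^sub>j\<nabla>\<^sub>i\<partial>\<^sub>k\<close>.\<close>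

definition curvature_tensor ::
  "(real^2) set \<Rightarrow> (real^2 \<Rightarrow> real^2^2) \<Rightarrow> 2 \<Rightarrow> 2 \<Rightarrow> 2 \<Rightarrow> 2 \<Rightarrow> real^2 \<Rightarrow> real" where
  "curvature_tensor D h l i j k x =
     pderiv_within D i (christoffel D h l j k) x - pderiv_within D j (christoffel D h l i k) x
     + (\<Sum>m\<in>UNIV. christoffel D h m j k x * christoffel D h l i m x
                - christoffel D h m i k x * christoffel D h l j m x)"

text \<open>\<open>K = \<langle>R(\<partial>\<^sub>1,\<partial>\<^sub>2)\<partial>\<^sub>2, \<partial>\<^sub>1\<rangle> / det g\<close>.\<close>

definition gauss_curvature :: "'a chart \<Rightarrow> 'a metric \<Rightarrow> real^2 \<Rightarrow> real" where
  "gauss_curvature c g x =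
     (\<Sum>l\<in>UNIV. curvature_tensor (snd c ` fst c) (g c) l 1 2 2 x * g c x $ l $ 1) / det (g c x)"

definition flat_metric :: "'a set \<Rightarrow> 'a chart set \<Rightarrow> 'a metric \<Rightarrow> bool" where
  "flat_metric M \<A> g \<longleftrightarrow>
     riemannian_metric M \<A> g \<and>
     (\<forall>c\<in>\<A>. \<forall>x\<in>snd c ` fst c. gauss_curvature c g x = 0)"

definition conformal_map ::
  "'a::topological_space set \<Rightarrow> 'a chart set \<Rightarrow> 'a metric \<Rightarrow>
   'b::topological_space set \<Rightarrow> 'b chart set \<Rightarrow> 'b metric \<Rightarrow> ('a \<Rightarrow> 'b) \<Rightarrow> bool" where
  "conformal_map S \<A> g T \<B> h f \<longleftrightarrow>
     smooth_map S \<A> T \<B> f \<and>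
     (\<exists>\<rho>. smooth_fun S \<A> \<rho> \<and> (\<forall>p\<in>S. 0 < \<rho> p) \<and>
        (\<forall>c\<in>\<A>. \<forall>d\<in>\<B>. \<forall>x\<in>local_dom S c d f.
           pullback S c d f h x = \<rho> (inv_chart c x) *\<^sub>R g c x))"

definition riemannian_isometry ::
  "'a::topological_space set \<Rightarrow> 'a chart set \<Rightarrow> 'a metric \<Rightarrow>
   'b::topological_space set \<Rightarrow> 'b chart set \<Rightarrow> 'b metric \<Rightarrow> ('a \<Rightarrow> 'b) \<Rightarrow> bool" where
  "riemannian_isometry S \<A> g T \<B> h f \<longleftrightarrow>
     diffeo S \<A> T \<B> f \<and>
     (\<forall>c\<in>\<A>. \<forall>d\<in>\<B>. \<forall>x\<in>local_dom S c d f. pullback S c d f h x = g c x)"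


section \<open>Arc length\<close>

definition smooth_curve ::
  "'a::topological_space chart set \<Rightarrow> real \<Rightarrow> real \<Rightarrow> (real \<Rightarrow> 'a) \<Rightarrow> bool" where
  "smooth_curve \<A> a b \<gamma> \<longleftrightarrow>
     a < b \<and> continuous_on {a..b} \<gamma> \<and>
     (\<forall>c\<in>\<A>. smooth_on {t\<in>{a..b}. \<gamma> t \<in> fst c} (snd c \<circ> \<gamma>))"

text \<open>The speed is computed in an arbitrary chart at \<open>\<gamma> t\<close>; by the transformation law of the
  metric it does not depend on the choice.\<close>

definition curve_speed ::
  "'a chart set \<Rightarrow> 'a metric \<Rightarrow> real \<Rightarrow> real \<Rightarrow> (real \<Rightarrow> 'a) \<Rightarrow> real \<Rightarrow> real" where
  "curve_speed \<A> g a b \<gamma> t =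
     (let c = (SOME c. c \<in> \<A> \<and> \<gamma> t \<in> fst c);
          v = vector_derivative (snd c \<circ> \<gamma>) (at t within {s\<in>{a..b}. \<gamma> s \<in> fst c})
      in sqrt (v \<bullet> (g c (snd c (\<gamma> t)) *v v)))"

definition curve_length ::
  "'a chart set \<Rightarrow> 'a metric \<Rightarrow> real \<Rightarrow> real \<Rightarrow> (real \<Rightarrow> 'a) \<Rightarrow> real" where
  "curve_length \<A> g a b \<gamma> = integral {a..b} (curve_speed \<A> g a b \<gamma>)"

definition same_arc_length ::
  "'a::topological_space set \<Rightarrow> 'a chart set \<Rightarrow> 'a metric \<Rightarrow> 'a metric \<Rightarrow> bool" where
  "same_arc_length C \<A> g h \<longleftrightarrow>
     (\<forall>a b \<gamma>. smooth_curve \<A> a b \<gamma> \<and> \<gamma> ` {a..b} \<subseteq> C \<longrightarrow>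
        curve_length \<A> g a b \<gamma> = curve_length \<A> h a b \<gamma>)"

end

theory Submission
  imports Defs "HOL-Complex_Analysis.Complex_Analysis"
begin

text \<open>A flat metric has, near every point, a coordinate \<open>\<phi>\<close> with values in \<open>\<complex>\<close> that is an isometry onto its image
  and is smooth up to the boundary: rotate an orthonormal coframe by a primitive of its connection form
  (closed, because the curvature vanishes) and integrate it. In such coordinates \<open>\<psi>\<close> is a holomorphic or
  antiholomorphic function \<open>G\<close>, and the square root of the conformal factor is \<open>\<sigma> = |G'|\<close>.

  No boundary regularity theory is needed to see that the upper limit of \<open>\<sigma>\<close> at the boundary is at most 1.
  On the boundary \<open>G\<close> preserves arc length, so its difference quotients are at most \<open>1 + \<epsilon>\<close> for nearby boundary
  points. The maximum principle for \<open>z \<mapsto> (G z - G w) / (z - w)\<close>, applied first with \<open>w\<close> on the boundary and then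
  with \<open>w\<close> inside, carries this bound to the interior; the rest of the boundary of a small half disc is
  absorbed by a factor \<open>exp (- k Q)\<close>. The maximum principle on \<open>M\<close> now gives \<open>\<sigma> \<le> 1\<close>, and the same for the inverse of
  \<open>\<psi>\<close> gives \<open>\<sigma> = 1\<close>. Then \<open>G\<close> is a rigid motion, whence \<open>\<psi>\<close> is an isometry and smooth up to the boundary.\<close>

section \<open>Calculus of smooth functions\<close>

text \<open>The obstacle is that \<psi> is merely continuous up to the boundary: neither
  \<open>G'\<close> nor \<sigma> is known to have boundary values, so nothing can be read off from a
  derivative there. Difference quotients need only the boundary values of \<open>G\<close>, but with
  \<open>w\<close> on the boundary the quotient is singular at a boundary point. The pole is
  therefore first moved slightly out of the domain, to the image of a point beyond the edge of the
  half plane, and tends to \<open>w\<close> only after the maximum principle has been applied. There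
  is room for this because the flat coordinates are constructed on full balls that stick out of the
  half plane; the same room later provides the extension that smoothness up to the boundary asks
  for. The argument bounds \<sigma> only from above, so it must apply to the inverse of \<psi> as
  well, which is not assumed to be conformal or even differentiable. What is carried through the
  proof is therefore \<open>conf_data\<close>, a condition on holomorphic representatives that
  passes to the inverse.\<close>

lemma C_k_on_cong:
  assumes "open W" "\<And>x. x \<in> W \<Longrightarrow> f x = g x" "C_k_on k f W"
  shows "C_k_on k g W"
  using assms(2,3)
proof (induction k arbitrary: f g)
  case 0
  then show ?case using continuous_on_cong by (metis C_k_on.simps(1))
next
  case (Suc k)
  have d: "f differentiable (at x)" if "x \<in> W" for x using Suc.prems that by auto
  have "g differentiable (at x)" if "x \<in> W" for x
    using has_derivative_transform_within_open[OF _ assms(1) that] Suc.prems(1) d[OF that]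
    unfolding differentiable_def by metis
  moreover have "frechet_derivative f (at x) v = frechet_derivative g (at x) v" if "x \<in> W" for x v
    using frechet_derivative_transform_within_open[OF d[OF that] assms(1) that] Suc.prems(1) by metis
  moreover have "C_k_on k (\<lambda>x. frechet_derivative g (at x) v) W" for v
    by (rule Suc.IH[of "\<lambda>x. frechet_derivative f (at x) v"]) (use Suc.prems calculation in auto)
  ultimately show ?case by auto
qed

lemma C_k_on_Suc_D: "C_k_on (Suc k) f W \<Longrightarrow> C_k_on k f W"
proof (induction k arbitrary: f)
  case 0
  then show ?case
    by (auto simp: continuous_on_eq_continuous_within
        intro: differentiable_imp_continuous_within differentiable_at_withinI)
next
  case (Suc k)
  then show ?case by (metis C_k_on.simps(2))
qed

lemma C_k_on_mono: "C_k_on l f W \<Longrightarrow> k \<le> l \<Longrightarrow> C_k_on k f W"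
  by (induction l) (auto simp: le_Suc_eq dest: C_k_on_Suc_D simp del: C_k_on.simps)

lemma C_k_on_subset: "C_k_on k f W \<Longrightarrow> V \<subseteq> W \<Longrightarrow> C_k_on k f V"
  by (induction k arbitrary: f) (auto intro: continuous_on_subset)

text \<open>\<open>C_k_on\<close> speaks of the chosen \<open>frechet_derivative\<close>; by
  uniqueness of derivatives on an open set, any explicit formula \<open>f'\<close> may take its
  place.\<close>

lemma C_k_on_SucI:
  assumes "open W" "\<And>x. x \<in> W \<Longrightarrow> (f has_derivative f' x) (at x)"
    "\<And>v. C_k_on k (\<lambda>x. f' x v) W"
  shows "C_k_on (Suc k) f W"
proof -
  have "C_k_on k (\<lambda>x. frechet_derivative f (at x) v) W" for v
  proof (rule C_k_on_cong[OF assms(1)])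
    show "f' x v = frechet_derivative f (at x) v" if "x \<in> W" for x
      using frechet_derivative_at[OF assms(2)[OF that]] by simp
  qed (rule assms(3))
  then show ?thesis using assms(2) by (auto simp: differentiable_def)
qed

lemma C_k_on_Suc_has_derivative:
  "C_k_on (Suc k) f W \<Longrightarrow> x \<in> W \<Longrightarrow> (f has_derivative frechet_derivative f (at x)) (at x)"
  by (simp add: frechet_derivative_works[symmetric])

lemma C_k_on_locally:
  assumes "open W" "\<And>x. x \<in> W \<Longrightarrow> \<exists>V. open V \<and> x \<in> V \<and> C_k_on k f V"
  shows "C_k_on k f W"
  using assms(2)
proof (induction k arbitrary: f)
  case 0
  then show ?case
    by (simp add: continuous_on_eq_continuous_within)
      (metis assms(1) at_within_open)
next
  case (Suc k)
  then show ?case by (fastforce intro: Suc.IH)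
qed

lemma C_k_on_const [simp]: "C_k_on k (\<lambda>x. c) W"
  by (induction k arbitrary: c) auto

lemma C_k_on_bounded_linear:
  assumes "bounded_linear L" "open W" shows "C_k_on k L W"
proof (cases k)
  case 0
  then show ?thesis using assms linear_continuous_on by auto
next
  case (Suc l)
  then show ?thesis
    by (auto intro!: C_k_on_SucI[OF assms(2), where f' = "\<lambda>x. L"] bounded_linear_imp_has_derivative assms(1)
        simp del: C_k_on.simps)
qed

lemma C_k_on_add:
  assumes "open W" "C_k_on k f W" "C_k_on k g W" shows "C_k_on k (\<lambda>x. f x + g x) W"
  using assms(2,3)
proof (induction k arbitrary: f g)
  case 0
  then show ?case by (auto intro: continuous_on_add)
next
  case (Suc k)
  show ?case
  proof (rule C_k_on_SucI[OF assms(1)])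
    show "((\<lambda>x. f x + g x) has_derivative (\<lambda>v. frechet_derivative f (at x) v + frechet_derivative g (at x) v)) (at x)"
      if "x \<in> W" for x
      using Suc.prems that by (intro has_derivative_add C_k_on_Suc_has_derivative)
    show "C_k_on k (\<lambda>x. frechet_derivative f (at x) v + frechet_derivative g (at x) v) W" for v
      using Suc by simp
  qed
qed

lemma C_k_on_sum:
  assumes "open W" "\<And>i. i \<in> I \<Longrightarrow> C_k_on k (f i) W" shows "C_k_on k (\<lambda>x. \<Sum>i\<in>I. f i x) W"
  using assms(2) by (induction I rule: infinite_finite_induct) (auto intro: C_k_on_add[OF assms(1)])

lemma C_k_on_bilinear:
  assumes "bounded_bilinear b" "open W" "C_k_on k f W" "C_k_on k g W"
  shows "C_k_on k (\<lambda>x. b (f x) (g x)) W"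
  using assms(3,4)
proof (induction k arbitrary: f g)
  case 0
  then show ?case using bounded_bilinear.continuous_on[OF assms(1)] by auto
next
  case (Suc k)
  show ?case
  proof (rule C_k_on_SucI[OF assms(2)])
    show "((\<lambda>x. b (f x) (g x)) has_derivative
        (\<lambda>v. b (f x) (frechet_derivative g (at x) v) + b (frechet_derivative f (at x) v) (g x))) (at x)"
      if "x \<in> W" for x
      using Suc.prems that by (intro bounded_bilinear.FDERIV[OF assms(1)] C_k_on_Suc_has_derivative)
    show "C_k_on k (\<lambda>x. b (f x) (frechet_derivative g (at x) v) + b (frechet_derivative f (at x) v) (g x)) W" for v
      using Suc.prems by (intro C_k_on_add Suc.IH assms(2) C_k_on_Suc_D[of k f] C_k_on_Suc_D[of k g]) auto
  qed
qed

lemmas C_k_on_mult = C_k_on_bilinear[OF bounded_bilinear_mult]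
lemmas C_k_on_scaleR = C_k_on_bilinear[OF bounded_bilinear_scaleR]

lemma C_k_on_linear_comp:
  assumes "bounded_linear L" "open W" "C_k_on k f W"
  shows "C_k_on k (\<lambda>x. L (f x)) W"
  using assms(3)
proof (induction k arbitrary: f)
  case 0
  then show ?case by (simp add: bounded_linear.continuous_on[OF assms(1)])
next
  case (Suc k)
  show ?case
  proof (rule C_k_on_SucI[OF assms(2)])
    show "((\<lambda>x. L (f x)) has_derivative (\<lambda>v. L (frechet_derivative f (at x) v))) (at x)"
      if "x \<in> W" for x
      using Suc.prems that by (intro bounded_linear.has_derivative[OF assms(1)] C_k_on_Suc_has_derivative)
    show "C_k_on k (\<lambda>x. L (frechet_derivative f (at x) v)) W" for v
      by (rule Suc.IH) (use Suc.prems in auto)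
  qed
qed

lemma C_k_on_minus: "open W \<Longrightarrow> C_k_on k f W \<Longrightarrow> C_k_on k (\<lambda>x. - f x) W"
  by (fact C_k_on_linear_comp[of uminus W k f, OF bounded_linear_minus[OF bounded_linear_ident]])

lemma C_k_on_diff:
  "open W \<Longrightarrow> C_k_on k f W \<Longrightarrow> C_k_on k g W \<Longrightarrow> C_k_on k (\<lambda>x. f x - g x) W"
  using C_k_on_add[of W k f "\<lambda>x. - g x"] C_k_on_minus[of W k g] by simp

text \<open>The chain rule feeds a direction depending on \<open>x\<close> into the derivative of
  \<open>g\<close>, whereas \<open>C_k_on\<close> knows only derivatives in fixed directions.
  Expanding in \<open>Basis\<close> separates the two: coefficients coming from \<open>f\<close>,
  and partial derivatives of \<open>g\<close> composed with \<open>f\<close>, to which the induction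
  hypothesis applies.\<close>

lemma C_k_on_compose:
  fixes f :: "'a::euclidean_space \<Rightarrow> 'b::euclidean_space" and g :: "'b \<Rightarrow> 'c::real_normed_vector"
  assumes "open W" "open V" "f ` W \<subseteq> V" "C_k_on k f W" "C_k_on k g V"
  shows "C_k_on k (\<lambda>x. g (f x)) W"
  using assms(4,5)
proof (induction k arbitrary: g)
  case 0
  then show ?case using continuous_on_compose2 assms(3) by (metis C_k_on.simps(1))
next
  case (Suc k)
  show ?case
  proof (rule C_k_on_SucI[OF assms(1)])
    show "((\<lambda>x. g (f x)) has_derivative
        (\<lambda>v. \<Sum>b\<in>Basis. (frechet_derivative f (at x) v \<bullet> b) *\<^sub>R frechet_derivative g (at (f x)) b)) (at x)"
      if "x \<in> W" for x
    proof -
      have f: "(f has_derivative frechet_derivative f (at x)) (at x)"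
        using Suc.prems that by (intro C_k_on_Suc_has_derivative)
      have g: "(g has_derivative frechet_derivative g (at (f x))) (at (f x))"
        using Suc.prems that assms(3) by (intro C_k_on_Suc_has_derivative) auto
      have lin: "linear (frechet_derivative g (at (f x)))"
        using g by (simp add: has_derivative_linear)
      have "((\<lambda>x. g (f x)) has_derivative (\<lambda>v. frechet_derivative g (at (f x)) (frechet_derivative f (at x) v))) (at x)"
        using diff_chain_at[OF f g] by (simp add: o_def)
      also have "(\<lambda>v. frechet_derivative g (at (f x)) (frechet_derivative f (at x) v)) =
        (\<lambda>v. \<Sum>b\<in>Basis. (frechet_derivative f (at x) v \<bullet> b) *\<^sub>R frechet_derivative g (at (f x)) b)"
      proof
        fix v
        show "frechet_derivative g (at (f x)) (frechet_derivative f (at x) v) =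
          (\<Sum>b\<in>Basis. (frechet_derivative f (at x) v \<bullet> b) *\<^sub>R frechet_derivative g (at (f x)) b)"
          using linear_sum[OF lin, of "\<lambda>b. (frechet_derivative f (at x) v \<bullet> b) *\<^sub>R b" Basis]
          by (simp add: linear_cmul[OF lin] euclidean_representation)
      qed
      finally show ?thesis .
    qed
    show "C_k_on k (\<lambda>x. \<Sum>b\<in>Basis. (frechet_derivative f (at x) v \<bullet> b) *\<^sub>R frechet_derivative g (at (f x)) b) W" for v
    proof (intro C_k_on_sum[OF assms(1)] C_k_on_scaleR[OF assms(1)])
      fix b :: 'b assume "b \<in> Basis"
      show "C_k_on k (\<lambda>x. frechet_derivative f (at x) v \<bullet> b) W"
        using Suc.prems by (intro C_k_on_linear_comp[OF bounded_linear_inner_left assms(1)]) auto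
      show "C_k_on k (\<lambda>x. frechet_derivative g (at (f x)) b) W"
      proof -
        have "C_k_on k f W" using Suc.prems(1) by (rule C_k_on_Suc_D)
        moreover have "C_k_on k (\<lambda>y. frechet_derivative g (at y) b) V" using Suc.prems(2) by simp
        ultimately show ?thesis using Suc.IH[of "\<lambda>y. frechet_derivative g (at y) b"] by blast
      qed
    qed
  qed
qed

text \<open>The derivative of the reciprocal is a polynomial in the reciprocal itself, so the order
  of smoothness climbs by induction; composition does the rest. Square root and exponential are
  treated in the same way.\<close>

lemma C_k_on_inverse: 
  fixes f :: "'a::euclidean_space \<Rightarrow> real"
  assumes "open W" "C_k_on k f W" "\<And>x. x \<in> W \<Longrightarrow> f x \<noteq> 0"
  shows "C_k_on k (\<lambda>x. inverse (f x)) W"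
proof -
  have op: "open (- {0::real})" by auto
  have "C_k_on k (inverse :: real \<Rightarrow> real) (- {0})"
  proof (induction k)
    case 0
    show ?case by (auto intro!: continuous_intros)
  next
    case (Suc k)
    show ?case
    proof (rule C_k_on_SucI[OF op])
      show "(inverse has_derivative (\<lambda>v. - (inverse x * v * inverse x))) (at x)" if "x \<in> - {0::real}" for x
        using that by (intro has_derivative_inverse') auto
      show "C_k_on k (\<lambda>x. - (inverse x * v * inverse x)) (- {0::real})" for v
        using Suc op by (intro C_k_on_minus C_k_on_mult C_k_on_const)
    qed
  qed
  from C_k_on_compose[OF assms(1) op _ assms(2), of inverse, OF _ this] show ?thesis using assms(3) by fastforce
qed

lemma C_k_on_sqrt: 
  fixes f :: "'a::euclidean_space \<Rightarrow> real"
  assumes "open W" "C_k_on k f W" "\<And>x. x \<in> W \<Longrightarrow> 0 < f x"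
  shows "C_k_on k (\<lambda>x. sqrt (f x)) W"
proof -
  have "C_k_on k sqrt {0<..}"
  proof (induction k)
    case 0
    show ?case by (auto intro!: continuous_intros)
  next
    case (Suc k)
    show ?case
    proof (rule C_k_on_SucI)
      show "(sqrt has_derivative (\<lambda>v. v * (inverse (sqrt x) / 2))) (at x)" if "x \<in> {0<..}" for x
      proof -
        have "(*) (inverse (sqrt x) / 2) = (\<lambda>v. v * (inverse (sqrt x) / 2))" by (auto simp: mult.commute)
        then show ?thesis using DERIV_real_sqrt[of x] that by (simp add: has_field_derivative_def)
      qed
      show "C_k_on k (\<lambda>x. v * (inverse (sqrt x) / 2)) {0<..}" for v
        unfolding divide_inverse
        using Suc by (intro C_k_on_mult C_k_on_const C_k_on_inverse) auto
    qed auto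
  qed
  from C_k_on_compose[OF assms(1) open_greaterThan _ assms(2), of 0 sqrt, OF _ this] show ?thesis using assms(3) by fastforce
qed

lemma C_k_on_exp: 
  fixes f :: "'a::euclidean_space \<Rightarrow> complex"
  assumes "open W" "C_k_on k f W"
  shows "C_k_on k (\<lambda>x. exp (f x)) W"
proof -
  have "C_k_on k (exp :: complex \<Rightarrow> complex) UNIV"
  proof (induction k)
    case 0
    show ?case by (auto intro!: continuous_intros)
  next
    case (Suc k)
    show ?case
    proof (rule C_k_on_SucI)
      show "(exp has_derivative (\<lambda>v. exp x * v)) (at x)" for x :: complex
        using DERIV_exp[of x] by (simp add: has_field_derivative_def)
      show "C_k_on k (\<lambda>x. exp x * v) UNIV" for v :: complex
        using Suc by (intro C_k_on_mult C_k_on_const) auto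
    qed auto
  qed
  from C_k_on_compose[OF assms(1) open_UNIV _ assms(2), of exp, OF _ this] show ?thesis by auto
qed

lemma C_k_on_of_real:
  "open W \<Longrightarrow> C_k_on k f W \<Longrightarrow> C_k_on k (\<lambda>x. complex_of_real (f x)) W"
  by (fact C_k_on_linear_comp[of complex_of_real W k f, OF bounded_linear_of_real])

abbreviation C_inf_on :: "('a::euclidean_space \<Rightarrow> 'b::real_normed_vector) \<Rightarrow> 'a set \<Rightarrow> bool" where
  "C_inf_on f W \<equiv> \<forall>k. C_k_on k f W"

lemma C_inf_on_has_derivative:
  "C_inf_on f W \<Longrightarrow> x \<in> W \<Longrightarrow> (f has_derivative frechet_derivative f (at x)) (at x)"
  using C_k_on_Suc_has_derivative by blast

lemma C_inf_on_frechet: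
  "C_inf_on f W \<Longrightarrow> C_inf_on (\<lambda>x. frechet_derivative f (at x) v) W"
  using C_k_on.simps(2) by blast

lemma C_inf_on_continuous: "C_inf_on f W \<Longrightarrow> continuous_on W f"
  using C_k_on.simps(1) by blast

section \<open>Integrals over segments with a parameter, and symmetry of second derivatives\<close>

lemma radial_segment:
  assumes "convex B" "x0 \<in> B" "x \<in> B" "0 \<le> t" "t \<le> (1::real)"
  shows "x0 + t *\<^sub>R (x - x0) \<in> B"
  using convexD_alt[OF assms] by (simp add: algebra_simps)

text \<open>Differentiation under the integral sign. The chain rule contributes one more factor
  \<open>t\<close>; the weight \<open>t ^ m\<close> is carried along so that the derivative is again
  an integral of the same shape.\<close>

lemma radial_integral_has_derivative:
  fixes f :: "'a::euclidean_space \<Rightarrow> 'b::euclidean_space"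
  assumes B: "open B" "convex B" "x0 \<in> B" and f: "C_k_on (Suc 0) f B" and "x \<in> B"
  shows "((\<lambda>x. integral {0..1} (\<lambda>t. t ^ m *\<^sub>R f (x0 + t *\<^sub>R (x - x0)))) has_derivative
    (\<lambda>v. integral {0..1} (\<lambda>t. t ^ Suc m *\<^sub>R frechet_derivative f (at (x0 + t *\<^sub>R (x - x0))) v))) (at x)"
proof -
  define D where "D x t v = t ^ Suc m *\<^sub>R frechet_derivative f (at (x0 + t *\<^sub>R (x - x0))) v" for x t v
  have der: "((\<lambda>x. t ^ m *\<^sub>R f (x0 + t *\<^sub>R (x - x0))) has_derivative D x t) (at x)"
    if "x \<in> B" "t \<in> {0..1}" for x t
  proof -
    have "x0 + t *\<^sub>R (x - x0) \<in> B" using radial_segment[OF B(2,3) that(1)] that by auto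
    then have f: "(f has_derivative frechet_derivative f (at (x0 + t *\<^sub>R (x - x0)))) (at (x0 + t *\<^sub>R (x - x0)))"
      using f by (rule C_k_on_Suc_has_derivative[rotated])
    have lin: "linear (frechet_derivative f (at (x0 + t *\<^sub>R (x - x0))))"
      using f by (simp add: has_derivative_linear)
    have g: "((\<lambda>x. x0 + t *\<^sub>R (x - x0)) has_derivative (\<lambda>v. t *\<^sub>R v)) (at x)"
      by (auto intro!: derivative_eq_intros)
    have "((\<lambda>x. t ^ m *\<^sub>R f (x0 + t *\<^sub>R (x - x0))) has_derivative
        (\<lambda>v. t ^ m *\<^sub>R frechet_derivative f (at (x0 + t *\<^sub>R (x - x0))) (t *\<^sub>R v))) (at x)"
      using has_derivative_scaleR_right[OF diff_chain_at[OF g f], of "t ^ m"] by (simp add: o_def)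
    then show ?thesis unfolding D_def by (simp add: linear_cmul[OF lin] mult.commute)
  qed
  have bl: "bounded_linear (D x t)" if "x \<in> B" "t \<in> {0..1}" for x t
    using der[OF that] by (rule has_derivative_bounded_linear)
  have contD: "continuous_on (B \<times> {0..1}) (\<lambda>(x, t). D x t v)" for v
  proof -
    have "continuous_on (B \<times> {0..1}) (\<lambda>z. frechet_derivative f (at (x0 + snd z *\<^sub>R (fst z - x0))) v)"
    proof (rule continuous_on_compose2[of B "\<lambda>y. frechet_derivative f (at y) v"])
      show "continuous_on B (\<lambda>y. frechet_derivative f (at y) v)" using f by simp
    qed (use radial_segment[OF B(2,3)] in \<open>auto intro!: continuous_intros\<close>)
    then show ?thesis unfolding D_def split_beta by (intro continuous_intros)
  qed
  have contf: "continuous_on B f"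
    using C_k_on_mono[OF f, of 0] by simp
  have cont: "continuous_on {0..1} (\<lambda>t. t ^ m *\<^sub>R f (x0 + t *\<^sub>R (x - x0)))" if "x \<in> B" for x
  proof (rule continuous_on_scaleR)
    show "continuous_on {0..1} (\<lambda>t. f (x0 + t *\<^sub>R (x - x0)))"
      by (rule continuous_on_compose2[OF contf])
        (use radial_segment[OF B(2,3) that] in \<open>auto intro!: continuous_intros\<close>)
  qed (auto intro!: continuous_intros)
  \<comment> \<open>\<open>leibniz_rule\<close> asks for joint continuity of the derivative as an
    operator; in finite dimension this is continuity in each basis direction, which is
    \<open>contD\<close>.\<close>
  have cb: "continuous_on (B \<times> {0..1}) (\<lambda>(x, t). Blinfun (D x t))"
  proof (rule continuous_on_blinfun_componentwise)
    fix i :: 'a assume "i \<in> Basis"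
    show "continuous_on (B \<times> {0..1}) (\<lambda>z. blinfun_apply (case z of (x, t) \<Rightarrow> Blinfun (D x t)) i)"
      using contD[of i]
      by (rule continuous_on_cong[THEN iffD1, rotated 2]) (auto simp: bounded_linear_Blinfun_apply bl)
  qed
  have "((\<lambda>x. integral (cbox 0 1) (\<lambda>t. t ^ m *\<^sub>R f (x0 + t *\<^sub>R (x - x0)))) has_derivative
     blinfun_apply (integral (cbox 0 1) (\<lambda>t. Blinfun (D x t)))) (at x within B)"
  proof (rule leibniz_rule)
    show "((\<lambda>x. t ^ m *\<^sub>R f (x0 + t *\<^sub>R (x - x0))) has_derivative blinfun_apply (Blinfun (D x t))) (at x within B)"
      if "x \<in> B" "t \<in> cbox 0 1" for x t
      using der[of x t] bl[of x t] that
      by (auto simp: bounded_linear_Blinfun_apply intro: has_derivative_at_withinI)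
    show "(\<lambda>t. t ^ m *\<^sub>R f (x0 + t *\<^sub>R (x - x0))) integrable_on cbox 0 1" if "x \<in> B" for x
      using cont[OF that] by (intro integrable_continuous) auto
  qed (use cb \<open>x \<in> B\<close> B in auto)
  moreover have "blinfun_apply (integral (cbox 0 1) (\<lambda>t. Blinfun (D x t))) = (\<lambda>v. integral (cbox 0 1) (\<lambda>t. D x t v))"
  proof
    fix v
    have "continuous_on (cbox 0 1) (\<lambda>t. Blinfun (D x t))"
      using continuous_on_compose2[OF cb, of "cbox 0 1" "\<lambda>t. (x, t)"] \<open>x \<in> B\<close>
      by (simp add: continuous_on_Pair image_subset_iff)
    then have "blinfun_apply (integral (cbox 0 1) (\<lambda>t. Blinfun (D x t))) v =
        integral (cbox 0 1) (\<lambda>t. blinfun_apply (Blinfun (D x t)) v)"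
      by (intro blinfun_apply_integral integrable_continuous)
    also have "\<dots> = integral (cbox 0 1) (\<lambda>t. D x t v)"
      by (rule integral_cong) (auto simp: bounded_linear_Blinfun_apply bl \<open>x \<in> B\<close>)
    finally show "blinfun_apply (integral (cbox 0 1) (\<lambda>t. Blinfun (D x t))) v = integral (cbox 0 1) (\<lambda>t. D x t v)" .
  qed
  ultimately show ?thesis unfolding D_def by (simp only: at_within_open[OF \<open>x \<in> B\<close> B(1)] cbox_interval)
qed

lemma C_k_on_radial_integral:
  fixes f :: "'a::euclidean_space \<Rightarrow> 'b::euclidean_space"
  assumes B: "open B" "convex B" "x0 \<in> B" and "C_k_on k f B"
  shows "C_k_on k (\<lambda>x. integral {0..1} (\<lambda>t. t ^ m *\<^sub>R f (x0 + t *\<^sub>R (x - x0)))) B"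
  using assms(4)
proof (induction k arbitrary: f m)
  case 0
  have "continuous_on (B \<times> {0..1}) (\<lambda>z. f (x0 + snd z *\<^sub>R (fst z - x0)))"
  proof (rule continuous_on_compose2[of B f])
    show "continuous_on B f" using 0 by simp
  qed (use radial_segment[OF B(2,3)] in \<open>auto intro!: continuous_intros\<close>)
  then have "continuous_on (B \<times> {0..1}) (\<lambda>(x, t). t ^ m *\<^sub>R f (x0 + t *\<^sub>R (x - x0)))"
    unfolding split_beta by (intro continuous_intros)
  then show ?case
    using integral_continuous_on_param[of B 0 "1::real" "\<lambda>x t. t ^ m *\<^sub>R f (x0 + t *\<^sub>R (x - x0))"] by simp
next
  case (Suc k)
  have "C_k_on (Suc 0) f B" using Suc.prems by (rule C_k_on_mono) simp
  from radial_integral_has_derivative[OF B this] show ?case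
  proof (rule C_k_on_SucI[OF B(1)])
    fix v
    have "C_k_on k (\<lambda>y. frechet_derivative f (at y) v) B" using Suc.prems by simp
    from Suc.IH[OF this, of "Suc m"]
    show "C_k_on k (\<lambda>x. integral {0..1} (\<lambda>t. t ^ Suc m *\<^sub>R frechet_derivative f (at (x0 + t *\<^sub>R (x - x0))) v)) B" .
  qed
qed

text \<open>The second difference over a parallelogram is evaluated by the mean value theorem twice,
  along \<open>u\<close> and then along \<open>v\<close>. The difference itself is symmetric in
  \<open>u\<close> and \<open>v\<close>, and this symmetry is what gets exploited next.\<close>

lemma mixed_difference:
  fixes f :: "'a::euclidean_space \<Rightarrow> real"
  assumes "\<And>s t. 0 \<le> s \<Longrightarrow> s \<le> h \<Longrightarrow> 0 \<le> t \<Longrightarrow> t \<le> h \<Longrightarrow> x + s *\<^sub>R u + t *\<^sub>R v \<in> B"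
    and B: "open B" "C_inf_on f B" and "0 < h"
  obtains s t where "0 < s" "s < h" "0 < t" "t < h"
    "f (x + h *\<^sub>R u + h *\<^sub>R v) - f (x + h *\<^sub>R u) - f (x + h *\<^sub>R v) + f x =
      h * h * frechet_derivative (\<lambda>y. frechet_derivative f (at y) u) (at (x + s *\<^sub>R u + t *\<^sub>R v)) v"
proof -
  define fu where "fu y = frechet_derivative f (at y) u" for y
  have line: "((\<lambda>s. g (p + s *\<^sub>R w)) has_real_derivative frechet_derivative g (at (p + s *\<^sub>R w)) w) (at s)"
    if "C_inf_on g B" "p + s *\<^sub>R w \<in> B" for g :: "'a \<Rightarrow> real" and p w s
  proof -
    have g: "(g has_derivative frechet_derivative g (at (p + s *\<^sub>R w))) (at (p + s *\<^sub>R w))"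
      using that by (rule C_inf_on_has_derivative)
    have "((\<lambda>s. p + s *\<^sub>R w) has_derivative (\<lambda>r. r *\<^sub>R w)) (at s)"
      by (auto intro!: derivative_eq_intros)
    from diff_chain_at[OF this g]
    have "((\<lambda>s. g (p + s *\<^sub>R w)) has_derivative (\<lambda>r. frechet_derivative g (at (p + s *\<^sub>R w)) (r *\<^sub>R w))) (at s)"
      by (simp add: o_def)
    then show ?thesis
      by (simp add: has_field_derivative_def linear_cmul[OF has_derivative_linear[OF g]] mult_commute_abs)
  qed
  define q where "q s = f (x + h *\<^sub>R v + s *\<^sub>R u) - f (x + s *\<^sub>R u)" for s
  have "\<exists>s. 0 < s \<and> s < h \<and> q h - q 0 = (h - 0) * (fu (x + h *\<^sub>R v + s *\<^sub>R u) - fu (x + s *\<^sub>R u))"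
  proof (rule MVT2[OF \<open>0 < h\<close>])
    show "(q has_real_derivative fu (x + h *\<^sub>R v + s *\<^sub>R u) - fu (x + s *\<^sub>R u)) (at s)"
      if "0 \<le> s" "s \<le> h" for s
      unfolding q_def fu_def
      using assms(1)[of s h] assms(1)[of s 0] that \<open>0 < h\<close>
      by (intro DERIV_diff line B) (auto simp: algebra_simps)
  qed
  then obtain s where s: "0 < s" "s < h" "q h - q 0 = h * (fu (x + h *\<^sub>R v + s *\<^sub>R u) - fu (x + s *\<^sub>R u))"
    by auto
  have "\<exists>t. 0 < t \<and> t < h \<and> fu (x + s *\<^sub>R u + h *\<^sub>R v) - fu (x + s *\<^sub>R u + 0 *\<^sub>R v) =
      (h - 0) * frechet_derivative fu (at (x + s *\<^sub>R u + t *\<^sub>R v)) v"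
  proof (rule MVT2[OF \<open>0 < h\<close>])
    show "((\<lambda>t. fu (x + s *\<^sub>R u + t *\<^sub>R v)) has_real_derivative frechet_derivative fu (at (x + s *\<^sub>R u + t *\<^sub>R v)) v) (at t)"
      if "0 \<le> t" "t \<le> h" for t
    proof (rule line)
      show "C_inf_on fu B" unfolding fu_def using C_inf_on_frechet[OF B(2)] .
    qed (use assms(1)[of s t] that s in auto)
  qed
  then obtain t where t: "0 < t" "t < h" "fu (x + s *\<^sub>R u + h *\<^sub>R v) - fu (x + s *\<^sub>R u) =
      h * frechet_derivative fu (at (x + s *\<^sub>R u + t *\<^sub>R v)) v" by auto
  have "q h - q 0 = h * h * frechet_derivative fu (at (x + s *\<^sub>R u + t *\<^sub>R v)) v"
    using s(3) t(3) by (simp add: algebra_simps)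
  then show ?thesis using that[OF s(1,2) t(1,2)] unfolding q_def fu_def by (simp add: algebra_simps)
qed

text \<open>By \<open>mixed_difference\<close> both mixed derivatives take, at suitable points near
  \<open>x\<close>, the same value: the second difference divided by \<open>h * h\<close>. If they
  differed at \<open>x\<close>, continuity would keep them apart near \<open>x\<close>.\<close>

lemma second_derivative_symmetric:
  fixes f :: "'a::euclidean_space \<Rightarrow> real"
  assumes B: "open B" "C_inf_on f B" and "x \<in> B"
  shows "frechet_derivative (\<lambda>y. frechet_derivative f (at y) u) (at x) v =
    frechet_derivative (\<lambda>y. frechet_derivative f (at y) v) (at x) u" (is "?a = ?b")
proof (rule ccontr)
  assume ne: "?a \<noteq> ?b"
  define a where "a y = frechet_derivative (\<lambda>y. frechet_derivative f (at y) u) (at y) v" for y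
  define b where "b y = frechet_derivative (\<lambda>y. frechet_derivative f (at y) v) (at y) u" for y
  have ab: "isCont a x" "isCont b x"
    unfolding a_def b_def using C_inf_on_continuous[OF C_inf_on_frechet[OF C_inf_on_frechet[OF B(2)]]] B \<open>x \<in> B\<close>
    by (auto simp: continuous_on_eq_continuous_at)
  have e: "0 < \<bar>a x - b x\<bar> / 2" using ne by (auto simp: a_def b_def)
  obtain d1 where d1: "d1 > 0" "\<And>y. dist y x < d1 \<Longrightarrow> dist (a y) (a x) < \<bar>a x - b x\<bar> / 2"
    using ab(1) e unfolding continuous_at_eps_delta by blast
  obtain d2 where d2: "d2 > 0" "\<And>y. dist y x < d2 \<Longrightarrow> dist (b y) (b x) < \<bar>a x - b x\<bar> / 2"
    using ab(2) e unfolding continuous_at_eps_delta by blast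
  obtain d3 where d3: "d3 > 0" "ball x d3 \<subseteq> B" using B(1) \<open>x \<in> B\<close> open_contains_ball by blast
  define d where "d = min d1 (min d2 d3)"
  \<comment> \<open>Small enough to keep the whole parallelogram within \<open>d\<close> of
    \<open>x\<close>; the summand 1 avoids a zero denominator.\<close>
  define h where "h = d / (2 * (norm u + norm v + 1))"
  have d: "d > 0" using d1 d2 d3 by (simp add: d_def)
  then have h: "h > 0" unfolding h_def by (simp add: add_nonneg_pos)
  have close: "dist (x + s *\<^sub>R u + t *\<^sub>R v) x < d" if "0 \<le> s" "s \<le> h" "0 \<le> t" "t \<le> h" for s t
  proof -
    have "dist (x + s *\<^sub>R u + t *\<^sub>R v) x \<le> s * norm u + t * norm v"
      using norm_triangle_ineq[of "s *\<^sub>R u" "t *\<^sub>R v"] that by (simp add: dist_norm algebra_simps)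
    also have "\<dots> \<le> h * norm u + h * norm v"
      using that by (intro add_mono mult_right_mono) auto
    also have "\<dots> < h * (2 * (norm u + norm v + 1))"
      using h by (simp add: algebra_simps add_nonneg_pos)
    also have "\<dots> = d" unfolding h_def
      by (simp add: add_nonneg_eq_0_iff)
    finally show ?thesis .
  qed
  have inB: "x + s *\<^sub>R u + t *\<^sub>R v \<in> B" if "0 \<le> s" "s \<le> h" "0 \<le> t" "t \<le> h" for s t
    using close[OF that] subsetD[OF d3(2), of "x + s *\<^sub>R u + t *\<^sub>R v"]
    unfolding d_def mem_ball by (metis dist_commute min_less_iff_conj)
  obtain s t where 1: "0 < s" "s < h" "0 < t" "t < h"
    "f (x + h *\<^sub>R u + h *\<^sub>R v) - f (x + h *\<^sub>R u) - f (x + h *\<^sub>R v) + f x = h * h * a (x + s *\<^sub>R u + t *\<^sub>R v)"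
    using mixed_difference[OF inB B h] unfolding a_def by blast
  have inB': "x + s *\<^sub>R v + t *\<^sub>R u \<in> B" if "0 \<le> s" "s \<le> h" "0 \<le> t" "t \<le> h" for s t
    using inB[of t s] that by (simp add: algebra_simps)
  obtain s' t' where 2: "0 < s'" "s' < h" "0 < t'" "t' < h"
    "f (x + h *\<^sub>R v + h *\<^sub>R u) - f (x + h *\<^sub>R v) - f (x + h *\<^sub>R u) + f x = h * h * b (x + s' *\<^sub>R v + t' *\<^sub>R u)"
    using mixed_difference[OF inB' B h] unfolding b_def by blast
  have "h * h * a (x + s *\<^sub>R u + t *\<^sub>R v) = h * h * b (x + t' *\<^sub>R u + s' *\<^sub>R v)"
    using 1(5) 2(5) by (simp add: algebra_simps)
  then have "a (x + s *\<^sub>R u + t *\<^sub>R v) = b (x + t' *\<^sub>R u + s' *\<^sub>R v)" using h by simp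
  moreover have "dist (a (x + s *\<^sub>R u + t *\<^sub>R v)) (a x) < \<bar>a x - b x\<bar> / 2"
    using close[of s t] 1 by (intro d1) (auto simp: d_def)
  moreover have "dist (b (x + t' *\<^sub>R u + s' *\<^sub>R v)) (b x) < \<bar>a x - b x\<bar> / 2"
    using close[of t' s'] 2 by (intro d2) (auto simp: d_def)
  ultimately show False by (simp add: dist_real_def abs_if split: if_splits)
qed

section \<open>The plane as the complex numbers, and smooth local inverses\<close>

no_notation fps_nth (infixl "$" 75)

definition cplx :: "real^2 \<Rightarrow> complex" where "cplx x = Complex (x $ 1) (x $ 2)"
definition vec2 :: "complex \<Rightarrow> real^2" where "vec2 z = vector [Re z, Im z]"

lemma cplx_vec2 [simp]: "cplx (vec2 z) = z"
  by (auto simp: vec2_def cplx_def complex_eq_iff)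

lemma bounded_linear_vec2: "bounded_linear vec2"
  by (rule linear_conv_bounded_linear[THEN iffD1], rule linearI) (auto simp: vec2_def vec_eq_iff forall_2)

lemma continuous_on_vec2 [continuous_intros]: "continuous_on T g \<Longrightarrow> continuous_on T (\<lambda>x. vec2 (g x))"
  by (rule bounded_linear.continuous_on[OF bounded_linear_vec2])

lemma vec_2_expand: "(v :: real^2) = v $ 1 *\<^sub>R axis 1 1 + v $ 2 *\<^sub>R axis 2 1"
  by (auto simp: vec_eq_iff forall_2 axis_def)

text \<open>Cramer's rule over the reals: \<open>Im (cnj a * b)\<close> is the determinant of the
  plane vectors \<open>a\<close> and \<open>b\<close>.\<close>

lemma cramer_complex:
  assumes "w = u1 *\<^sub>R a + u2 *\<^sub>R b"
  shows "u1 * Im (cnj a * b) = Im (cnj w * b)" "u2 * Im (cnj a * b) = Im (cnj a * w)"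
  using assms by (auto simp: algebra_simps)

text \<open>The inverse function theorem, applied to \<open>vec2 \<circ> \<phi>\<close> as a
  self-map of the plane, gives a differentiable inverse. Smoothness is bootstrapped: by Cramer's
  rule the derivative of the inverse \<open>h\<close> is a rational expression in the partial
  derivatives of \<phi> taken at \<open>h z\<close>, so \<open>C_k_on k\<close> for \<open>h\<close>
  yields \<open>C_k_on (Suc k)\<close>.\<close>

lemma smooth_inverse_function:
  fixes \<phi> :: "real^2 \<Rightarrow> complex"
  assumes "open U" "C_inf_on \<phi> U" "x0 \<in> U" "inj (frechet_derivative \<phi> (at x0))"
  obtains U' V g where "open U'" "U' \<subseteq> U" "x0 \<in> U'" "open V" "homeomorphism U' V \<phi> g"
    "C_inf_on g V" "\<And>x. x \<in> U' \<Longrightarrow> inj (frechet_derivative \<phi> (at x))"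
proof -
  let ?D = "\<lambda>x. frechet_derivative \<phi> (at x)"
  define f where "f x = vec2 (\<phi> x)" for x
  define f' where "f' x = Blinfun (\<lambda>v. vec2 (?D x v))" for x
  have d: "(\<phi> has_derivative ?D x) (at x)" if "x \<in> U" for x
    using assms(2) that by (rule C_inf_on_has_derivative)
  have bl: "bounded_linear (\<lambda>v. vec2 (?D x v))" if "x \<in> U" for x
    using has_derivative_bounded_linear[OF d[OF that]] bounded_linear_compose[OF bounded_linear_vec2] by blast
  have f': "blinfun_apply (f' x) = (\<lambda>v. vec2 (?D x v))" if "x \<in> U" for x
    unfolding f'_def using bl[OF that] by (simp add: bounded_linear_Blinfun_apply)
  have derf: "(f has_derivative blinfun_apply (f' x)) (at x)" if "x \<in> U" for x
    unfolding f'[OF that] f_def by (rule bounded_linear.has_derivative[OF bounded_linear_vec2 d[OF that]])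
  have contf: "continuous_on U f'"
  proof (rule continuous_on_blinfun_componentwise)
    fix i :: "real^2"
    have "continuous_on U (\<lambda>x. vec2 (?D x i))"
      using C_inf_on_continuous[OF C_inf_on_frechet[OF assms(2)]] by (rule continuous_on_vec2)
    then show "continuous_on U (\<lambda>x. blinfun_apply (f' x) i)"
      by (rule continuous_on_cong[THEN iffD1, rotated 2]) (auto simp: f')
  qed
  have inj0: "inj (blinfun_apply (f' x0))"
    using assms(4) unfolding f'[OF assms(3)] by (metis (no_types, lifting) cplx_vec2 injD injI)
  have lin0: "linear (blinfun_apply (f' x0))" by (simp add: blinfun.bounded_linear_right bounded_linear.linear)
  obtain G where G: "linear G" "G \<circ> blinfun_apply (f' x0) = id"
    using linear_injective_left_inverse[OF lin0 inj0] by auto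
  define invf where "invf = Blinfun G"
  have "blinfun_apply invf = G"
    unfolding invf_def using G(1) by (simp add: bounded_linear_Blinfun_apply linear_conv_bounded_linear)
  then have "invf o\<^sub>L f' x0 = id_blinfun"
    using G(2) by (intro blinfun_eqI) (simp add: fun_eq_iff)
  from inverse_function_theorem[OF assms(1) derf contf assms(3) this]
  obtain U' V g g' where 1: "open U'" "U' \<subseteq> U" "x0 \<in> U'" "open V" "homeomorphism U' V f g"
    "\<And>y. y \<in> V \<Longrightarrow> (g has_derivative (g' y)) (at y)"
    "\<And>y. y \<in> V \<Longrightarrow> g' y = inv (blinfun_apply (f' (g y)))"
    "\<And>y. y \<in> V \<Longrightarrow> bij (blinfun_apply (f' (g y)))" by metis
  have gV: "g y \<in> U'" "f (g y) = y" if "y \<in> V" for y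
    using 1(5) that by (auto simp: homeomorphism_def)
  have fU: "f x \<in> V" "g (f x) = x" if "x \<in> U'" for x
    using 1(5) that by (auto simp: homeomorphism_def)
  define V' where "V' = vec2 -` V"
  define h where "h z = g (vec2 z)" for z
  have V': "open V'" unfolding V'_def
    using continuous_on_vec2[OF continuous_on_id, of UNIV] 1(4) by (simp add: continuous_on_open_vimage)
  have phi: "\<phi> x = cplx (f x)" for x by (simp add: f_def)
  have hom: "homeomorphism U' V' \<phi> h"
  proof (rule homeomorphismI)
    show "continuous_on U' \<phi>" using C_inf_on_continuous[OF assms(2)] 1(2) continuous_on_subset by blast
    show "continuous_on V' h" unfolding h_def V'_def
      by (rule continuous_on_compose2[OF homeomorphism_cont2[OF 1(5)]]) (auto intro!: continuous_intros)
    show "\<phi> ` U' \<subseteq> V'" "h ` V' \<subseteq> U'" using fU gV by (auto simp: V'_def h_def f_def)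
    show "h (\<phi> x) = x" if "x \<in> U'" for x using fU[OF that] by (simp add: h_def f_def)
    show "\<phi> (h z) = z" if "z \<in> V'" for z using gV(2)[of "vec2 z"] that by (simp add: h_def V'_def phi)
  qed
  have inj: "inj (?D x)" if "x \<in> U'" for x
  proof -
    have "inj (\<lambda>v. vec2 (?D x v))"
      using bij_is_inj[OF 1(8)[OF fU(1)[OF that]]] f'[of x] subsetD[OF 1(2) that] by (simp add: fU(2)[OF that])
    then show ?thesis by (metis (no_types, lifting) injD injI)
  qed
  define a where "a x = ?D x (axis 1 1)" for x
  define b where "b x = ?D x (axis 2 1)" for x
  have Dv: "?D x v = v $ 1 *\<^sub>R a x + v $ 2 *\<^sub>R b x" if "x \<in> U" for x v
  proof -
    have lin: "linear (?D x)" using d[OF that] by (rule has_derivative_linear)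
    show ?thesis using arg_cong[OF vec_2_expand[of v], of "?D x"] unfolding a_def b_def linear_add[OF lin] linear_cmul[OF lin] .
  qed
  \<comment> \<open>If the determinant vanished, every value of the derivative would be
    real-parallel to \<open>a x\<close>; as the derivative is onto, this forces
    \<open>a x = 0\<close>, against injectivity.\<close>
  have detnz: "Im (cnj (a x) * b x) \<noteq> 0" if "x \<in> U'" for x
  proof
    assume 0: "Im (cnj (a x) * b x) = 0"
    have x: "x \<in> U" using that 1(2) by auto
    have "surj (\<lambda>v. vec2 (?D x v))"
      using bij_is_surj[OF 1(8)[OF fU(1)[OF that]]] f'[OF x] by (simp add: fU(2)[OF that])
    then have "\<exists>v. vec2 w = vec2 (?D x v)" for w by (rule surjD)
    then have *: "\<exists>v. ?D x v = w" for w by (metis cplx_vec2)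
    have "Im (cnj (a x) * w) = 0" for w
    proof -
      obtain v where "?D x v = w" using * by blast
      then show ?thesis using cramer_complex(2)[of w "v $ 1" "a x" "v $ 2" "b x"] 0 Dv[OF x] by simp
    qed
    from this[of 1] this[of \<i>] have "a x = 0" by (simp add: complex_eq_iff)
    then have "?D x (axis 1 1) = ?D x 0" using linear_0[OF has_derivative_linear[OF d[OF x]]] by (simp add: a_def)
    then show False using inj[OF that] by (auto dest!: injD simp: axis_eq_0_iff)
  qed
  define h1 where "h1 z w = Im (cnj w * b (h z)) * inverse (Im (cnj (a (h z)) * b (h z)))" for z w
  define h2 where "h2 z w = Im (cnj (a (h z)) * w) * inverse (Im (cnj (a (h z)) * b (h z)))" for z w
  have hder: "(h has_derivative (\<lambda>w. h1 z w *\<^sub>R axis 1 1 + h2 z w *\<^sub>R axis 2 1)) (at z)" if "z \<in> V'" for z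
  proof -
    have y: "vec2 z \<in> V" using that by (simp add: V'_def)
    have hz: "h z \<in> U'" "h z \<in> U" using gV(1)[OF y] 1(2) by (auto simp: h_def)
    have "(vec2 has_derivative vec2) (at z)" by (rule bounded_linear_imp_has_derivative[OF bounded_linear_vec2])
    from diff_chain_at[OF this 1(6)[OF y]]
    have "(h has_derivative (\<lambda>w. g' (vec2 z) (vec2 w))) (at z)" by (simp add: o_def h_def[abs_def])
    moreover have "g' (vec2 z) (vec2 w) = h1 z w *\<^sub>R axis 1 1 + h2 z w *\<^sub>R axis 2 1" for w
    proof -
      define u where "u = g' (vec2 z) (vec2 w)"
      have "blinfun_apply (f' (h z)) u = vec2 w"
        unfolding u_def 1(7)[OF y] h_def using 1(8)[OF y] by (simp add: bij_is_surj surj_f_inv_f)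
      then have "?D (h z) u = w" unfolding f'[OF hz(2)] by (metis cplx_vec2)
      then have "w = u $ 1 *\<^sub>R a (h z) + u $ 2 *\<^sub>R b (h z)" using Dv[OF hz(2)] by simp
      from cramer_complex[OF this] detnz[OF hz(1)] have "u $ 1 = h1 z w" "u $ 2 = h2 z w"
        unfolding h1_def h2_def by (auto simp: field_simps)
      then show ?thesis using vec_2_expand[of u] unfolding u_def by simp
    qed
    ultimately show ?thesis by simp
  qed
  have "C_k_on k h V'" for k
  proof (induction k)
    case 0
    show ?case using homeomorphism_cont2[OF hom] by simp
  next
    case (Suc k)
    have ab: "C_k_on k (\<lambda>z. a (h z)) V'" "C_k_on k (\<lambda>z. b (h z)) V'"
    proof -
      have hV: "h ` V' \<subseteq> U" using homeomorphism_image2[OF hom] 1(2) by simp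
      have "C_k_on k a U" "C_k_on k b U" unfolding a_def b_def using C_inf_on_frechet[OF assms(2)] by auto
      then show "C_k_on k (\<lambda>z. a (h z)) V'" "C_k_on k (\<lambda>z. b (h z)) V'"
        using C_k_on_compose[OF V' assms(1) hV Suc, of a] C_k_on_compose[OF V' assms(1) hV Suc, of b] by auto
    qed
    have cn: "C_k_on k (\<lambda>z. cnj (a (h z))) V'"
      by (rule C_k_on_linear_comp[OF bounded_linear_cnj V' ab(1)])
    have "C_k_on k (\<lambda>z. Im (cnj (a (h z)) * b (h z))) V'"
      by (rule C_k_on_linear_comp[OF bounded_linear_Im V' C_k_on_mult[OF V' cn ab(2)]])
    then have i: "C_k_on k (\<lambda>z. inverse (Im (cnj (a (h z)) * b (h z)))) V'"
      by (rule C_k_on_inverse[OF V']) (use detnz homeomorphism_image2[OF hom] in blast)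
    have 1: "C_k_on k (\<lambda>z. h1 z w) V'" for w unfolding h1_def
      by (rule C_k_on_mult[OF V' C_k_on_linear_comp[OF bounded_linear_Im V' C_k_on_mult[OF V' C_k_on_const ab(2)]] i])
    have 2: "C_k_on k (\<lambda>z. h2 z w) V'" for w unfolding h2_def
      by (rule C_k_on_mult[OF V' C_k_on_linear_comp[OF bounded_linear_Im V' C_k_on_mult[OF V' cn C_k_on_const]] i])
    show ?case
    proof (rule C_k_on_SucI[OF V' hder])
      show "C_k_on k (\<lambda>z. h1 z w *\<^sub>R axis 1 1 + h2 z w *\<^sub>R axis 2 1) V'" for w
        by (intro C_k_on_add[OF V'] C_k_on_scaleR[OF V'] 1 2 C_k_on_const)
    qed
  qed
  then show ?thesis using that[OF 1(1-3) V' hom _ inj] by blast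
qed

section \<open>The Poincare lemma and flat coordinates\<close>

text \<open>Unlike \<open>pderiv_within\<close>, this derivative uses a full neighbourhood; it is
  meant for functions already extended across the boundary.\<close>

definition pd :: "2 \<Rightarrow> (real^2 \<Rightarrow> 'b::real_normed_vector) \<Rightarrow> real^2 \<Rightarrow> 'b" where
  "pd i f x = frechet_derivative f (at x) (axis i 1)"

lemma C_inf_on_pd: "C_inf_on f W \<Longrightarrow> C_inf_on (pd i f) W"
  unfolding pd_def[abs_def] by (rule C_inf_on_frechet)

lemma C_inf_on_differentiable: "C_inf_on f W \<Longrightarrow> x \<in> W \<Longrightarrow> f differentiable at x"
  using C_inf_on_has_derivative differentiable_def by blast

lemma pd_has_derivative: "(f has_derivative D) (at x) \<Longrightarrow> pd i f x = D (axis i 1)"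
  unfolding pd_def using frechet_derivative_at by metis

lemma frechet_derivative_pd:
  assumes "f differentiable at (x :: real^2)"
  shows "frechet_derivative f (at x) v = v $ 1 *\<^sub>R pd 1 f x + v $ 2 *\<^sub>R pd 2 f x"
proof -
  have lin: "linear (frechet_derivative f (at x))"
    using assms by (simp add: linear_frechet_derivative)
  show ?thesis
    using arg_cong[OF vec_2_expand[of v], of "frechet_derivative f (at x)"]
    unfolding pd_def linear_add[OF lin] linear_cmul[OF lin] .
qed

lemma pd_cong:
  assumes "f differentiable at x" "open S" "x \<in> S" "\<And>y. y \<in> S \<Longrightarrow> f y = g y"
  shows "pd i f x = pd i g x"
  unfolding pd_def by (subst frechet_derivative_transform_within_open[OF assms]) simp_all

context
  fixes x :: "real^2" and f g :: "real^2 \<Rightarrow> 'b::real_normed_field"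
  assumes f: "f differentiable at x" and g: "g differentiable at x"
begin

lemma pd_add: "pd i (\<lambda>x. f x + g x) x = pd i f x + pd i g x"
  using pd_has_derivative[OF has_derivative_add] f g by (simp add: frechet_derivative_works pd_def)

lemma pd_diff: "pd i (\<lambda>x. f x - g x) x = pd i f x - pd i g x"
  using pd_has_derivative[OF has_derivative_diff] f g by (simp add: frechet_derivative_works pd_def)

lemma pd_mult: "pd i (\<lambda>x. f x * g x) x = f x * pd i g x + pd i f x * g x"
  using pd_has_derivative[OF has_derivative_mult] f g by (simp add: frechet_derivative_works pd_def)

end

lemma pd_const: "pd i (\<lambda>x. c) x = 0"
  using pd_has_derivative[OF has_derivative_const] by blast

lemma pd_inverse:
  fixes f :: "real^2 \<Rightarrow> real"
  assumes "f differentiable at x" "f x \<noteq> 0"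
  shows "pd i (\<lambda>x. inverse (f x)) x = - (pd i f x * inverse (f x * f x))"
proof -
  have "(f has_derivative frechet_derivative f (at x)) (at x)"
    using assms by (simp add: frechet_derivative_works)
  from pd_has_derivative[OF Deriv.has_derivative_inverse[of f, OF assms(2) this]] show ?thesis
    by (simp add: pd_def field_simps)
qed

lemma pd_sqrt:
  fixes f :: "real^2 \<Rightarrow> real"
  assumes "f differentiable at x" "0 < f x"
  shows "pd i (\<lambda>x. sqrt (f x)) x = pd i f x * inverse (2 * sqrt (f x))"
proof -
  have "(f has_derivative frechet_derivative f (at x)) (at x)"
    using assms by (simp add: frechet_derivative_works)
  from pd_has_derivative[OF has_derivative_real_sqrt[of f, OF assms(2) this]] show ?thesis
    by (simp add: pd_def field_simps)
qed

lemma pd_of_real: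
  assumes "f differentiable at x"
  shows "pd i (\<lambda>x. complex_of_real (f x)) x = of_real (pd i f x)"
  using pd_has_derivative[OF bounded_linear.has_derivative[OF bounded_linear_of_real]] assms
  by (simp add: frechet_derivative_works pd_def)

lemma differentiable_of_real:
  "f differentiable at x \<Longrightarrow> (\<lambda>x. complex_of_real (f x)) differentiable at x"
  using bounded_linear.has_derivative[OF bounded_linear_of_real] unfolding differentiable_def by blast

lemma pd_exp:
  fixes f :: "real^2 \<Rightarrow> complex"
  assumes "f differentiable at x"
  shows "pd i (\<lambda>x. exp (f x)) x = exp (f x) * pd i f x"
proof -
  have "(f has_derivative frechet_derivative f (at x)) (at x)"
    using assms by (simp add: frechet_derivative_works)
  from diff_chain_at[OF this DERIV_exp[of "f x", unfolded has_field_derivative_def]]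
  have "((\<lambda>x. exp (f x)) has_derivative (\<lambda>v. exp (f x) * frechet_derivative f (at x) v)) (at x)"
    by (simp add: o_def)
  from pd_has_derivative[OF this] show ?thesis by (simp add: pd_def)
qed

lemma pd_commute:
  fixes f :: "real^2 \<Rightarrow> real"
  assumes "open B" "C_inf_on f B" "x \<in> B"
  shows "pd i (pd j f) x = pd j (pd i f) x"
  using second_derivative_symmetric[OF assms, of "axis j 1" "axis i 1"] by (simp add: pd_def[abs_def])

text \<open>The form need be closed only on \<open>S\<close>, later a half disc, but the primitive is smooth on all of \<open>B\<close>:
  this is what extends the flat coordinates across the boundary.\<close>

lemma poincare_lemma:
  fixes a :: "2 \<Rightarrow> real^2 \<Rightarrow> 'b::{real_normed_field,euclidean_space}"
  assumes B: "open B" "convex B" "x0 \<in> B" and a: "\<And>i. C_inf_on (a i) B"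
    and S: "S \<subseteq> B" "convex S" "x0 \<in> S" and closed: "\<And>x. x \<in> S \<Longrightarrow> pd 1 (a 2) x = pd 2 (a 1) x"
  obtains \<phi> where "C_inf_on \<phi> B" "\<And>i x. x \<in> S \<Longrightarrow> pd i \<phi> x = a i x"
proof
  define I where "I i x = integral {0..1} (\<lambda>t. t ^ 0 *\<^sub>R a i (x0 + t *\<^sub>R (x - x0)))" for i x
  \<comment> \<open>The integral of the form along the segment from \<open>x0\<close> to
    \<open>x\<close>. It is smooth on all of \<open>B\<close>, whether or not the form is closed
    there.\<close>
  define \<phi> where "\<phi> x = (x - x0) $ 1 *\<^sub>R I 1 x + (x - x0) $ 2 *\<^sub>R I 2 x" for x
  have I: "C_inf_on (I i) B" for i
    unfolding I_def[abs_def] using C_k_on_radial_integral[OF B, of _ "a i" 0] a by blast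
  have comp: "C_k_on k (\<lambda>x. (x - x0) $ i) B" for k i
  proof -
    have "C_k_on k (\<lambda>x. x $ i) B" by (rule C_k_on_bounded_linear[OF bounded_linear_vec_nth B(1)])
    from C_k_on_diff[OF B(1) this C_k_on_const, of "x0 $ i"] show ?thesis by simp
  qed
  show "C_inf_on \<phi> B" unfolding \<phi>_def[abs_def]
    using C_k_on_add[OF B(1) C_k_on_scaleR[OF B(1) comp] C_k_on_scaleR[OF B(1) comp]] I by blast
  show "pd j \<phi> x = a j x" if "x \<in> S" for j x
  proof -
    have xB: "x \<in> B" using that S by auto
    define y where "y t = x0 + t *\<^sub>R (x - x0)" for t
    have y: "y t \<in> S" "y t \<in> B" if "t \<in> {0..1}" for t
      using radial_segment[OF S(2,3) \<open>x \<in> S\<close>, of t] that S(1) by (auto simp: y_def)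
    have dI: "(I i has_derivative (\<lambda>v. integral {0..1} (\<lambda>t. t ^ Suc 0 *\<^sub>R frechet_derivative (a i) (at (y t)) v))) (at x)" for i
      unfolding I_def[abs_def] y_def using radial_integral_has_derivative[OF B _ xB, of "a i" 0] a by blast
    have dc: "((\<lambda>x. (x - x0) $ i) has_derivative (\<lambda>v. v $ i)) (at x)" for i
      by (auto intro!: derivative_eq_intros bounded_linear_imp_has_derivative bounded_linear_vec_nth)
    have "(\<phi> has_derivative (\<lambda>v.
       ((x - x0) $ 1 *\<^sub>R integral {0..1} (\<lambda>t. t ^ Suc 0 *\<^sub>R frechet_derivative (a 1) (at (y t)) v) + v $ 1 *\<^sub>R I 1 x) +
       ((x - x0) $ 2 *\<^sub>R integral {0..1} (\<lambda>t. t ^ Suc 0 *\<^sub>R frechet_derivative (a 2) (at (y t)) v) + v $ 2 *\<^sub>R I 2 x))) (at x)"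
      unfolding \<phi>_def[abs_def] by (intro has_derivative_add has_derivative_scaleR dc dI)
    from pd_has_derivative[OF this, of j]
    have "pd j \<phi> x = I j x + ((x - x0) $ 1 *\<^sub>R integral {0..1} (\<lambda>t. t *\<^sub>R pd j (a 1) (y t)) +
       (x - x0) $ 2 *\<^sub>R integral {0..1} (\<lambda>t. t *\<^sub>R pd j (a 2) (y t)))"
      using exhaust_2[of j] by (auto simp: pd_def axis_def)
    also have "\<dots> = I j x + integral {0..1} (\<lambda>t. t *\<^sub>R frechet_derivative (a j) (at (y t)) (x - x0))"
    proof -
      have cont: "continuous_on {0..1} (\<lambda>t. t *\<^sub>R pd j (a i) (y t))" for i
      proof (rule continuous_on_scaleR)
        show "continuous_on {0..1} (\<lambda>t. pd j (a i) (y t))"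
          by (rule continuous_on_compose2[OF C_inf_on_continuous[OF C_inf_on_pd[OF a]]])
            (use y in \<open>auto simp: y_def intro!: continuous_intros\<close>)
      qed (rule continuous_on_id)
      have "(x - x0) $ 1 *\<^sub>R integral {0..1} (\<lambda>t. t *\<^sub>R pd j (a 1) (y t)) +
          (x - x0) $ 2 *\<^sub>R integral {0..1} (\<lambda>t. t *\<^sub>R pd j (a 2) (y t)) =
          integral {0..1} (\<lambda>t. (x - x0) $ 1 *\<^sub>R t *\<^sub>R pd j (a 1) (y t) + (x - x0) $ 2 *\<^sub>R t *\<^sub>R pd j (a 2) (y t))"
        by (subst integral_add)
          (auto intro!: integrable_continuous_interval continuous_on_scaleR[OF continuous_on_const cont] simp del: scaleR_scaleR)
      also have "\<dots> = integral {0..1} (\<lambda>t. t *\<^sub>R frechet_derivative (a j) (at (y t)) (x - x0))"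
      proof (rule integral_cong)
        fix t :: real assume t: "t \<in> {0..1}"
        have eq: "frechet_derivative (a j) (at (y t)) (x - x0) =
            (x - x0) $ 1 *\<^sub>R pd 1 (a j) (y t) + (x - x0) $ 2 *\<^sub>R pd 2 (a j) (y t)"
          by (rule frechet_derivative_pd) (rule C_inf_on_differentiable[OF a y(2)[OF t]])
        \<comment> \<open>The one place where closedness enters: it turns the derivatives in
          direction \<open>j\<close> of both components into derivatives of the component
          \<open>j\<close>. Convexity keeps the segment inside \<open>S\<close>.\<close>
        have "pd j (a 1) (y t) = pd 1 (a j) (y t)" "pd j (a 2) (y t) = pd 2 (a j) (y t)"
          using exhaust_2[of j] closed[OF y(1)[OF t]] by auto
        then show "(x - x0) $ 1 *\<^sub>R t *\<^sub>R pd j (a 1) (y t) + (x - x0) $ 2 *\<^sub>R t *\<^sub>R pd j (a 2) (y t) =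
            t *\<^sub>R frechet_derivative (a j) (at (y t)) (x - x0)"
          by (simp add: eq scaleR_add_right mult.commute)
      qed
      finally show ?thesis by simp
    qed
    also have "\<dots> = integral {0..1} (\<lambda>t. a j (y t) + t *\<^sub>R frechet_derivative (a j) (at (y t)) (x - x0))"
    proof -
      have "continuous_on {0..1} (\<lambda>t. a j (y t))"
        by (rule continuous_on_compose2[OF C_inf_on_continuous[OF a]])
          (use y in \<open>auto simp: y_def intro!: continuous_intros\<close>)
      moreover have "continuous_on {0..1} (\<lambda>t. t *\<^sub>R frechet_derivative (a j) (at (y t)) (x - x0))"
      proof (rule continuous_on_scaleR)
        show "continuous_on {0..1} (\<lambda>t. frechet_derivative (a j) (at (y t)) (x - x0))"
          by (rule continuous_on_compose2[OF C_inf_on_continuous[OF C_inf_on_frechet[OF a]]])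
            (use y in \<open>auto simp: y_def intro!: continuous_intros\<close>)
      qed (rule continuous_on_id)
      ultimately show ?thesis unfolding I_def y_def[symmetric]
        by (subst integral_add) (auto intro!: integrable_continuous_interval)
    qed
    \<comment> \<open>The integrand is the derivative of
      \<open>t *\<^sub>R a j (y t)\<close>.\<close>
    also have "\<dots> = 1 *\<^sub>R a j (y 1) - 0 *\<^sub>R a j (y 0)"
    proof (rule integral_unique, rule fundamental_theorem_of_calculus)
      fix t :: real assume t: "t \<in> {0..1}"
      have dy: "(y has_derivative (\<lambda>r. r *\<^sub>R (x - x0))) (at t)"
        unfolding y_def[abs_def] by (auto intro!: derivative_eq_intros)
      have da: "(a j has_derivative frechet_derivative (a j) (at (y t))) (at (y t))"
        by (rule C_inf_on_has_derivative[OF a y(2)[OF t]])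
      have lin: "linear (frechet_derivative (a j) (at (y t)))" using da by (rule has_derivative_linear)
      from diff_chain_at[OF dy da]
      have d: "((\<lambda>t. a j (y t)) has_derivative (\<lambda>r. frechet_derivative (a j) (at (y t)) (r *\<^sub>R (x - x0)))) (at t)"
        by (simp add: o_def)
      have "((\<lambda>t. t *\<^sub>R a j (y t)) has_derivative
          (\<lambda>r. t *\<^sub>R frechet_derivative (a j) (at (y t)) (r *\<^sub>R (x - x0)) + r *\<^sub>R a j (y t))) (at t)"
        by (rule has_derivative_scaleR[OF has_derivative_ident d])
      then have "((\<lambda>t. t *\<^sub>R a j (y t)) has_vector_derivative
          a j (y t) + t *\<^sub>R frechet_derivative (a j) (at (y t)) (x - x0)) (at t)"
        by (simp add: has_vector_derivative_def linear_cmul[OF lin] scaleR_add_right add.commute mult.commute)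
      then show "((\<lambda>t. t *\<^sub>R a j (y t)) has_vector_derivative
          a j (y t) + t *\<^sub>R frechet_derivative (a j) (at (y t)) (x - x0)) (at t within {0..1})"
        by (rule has_vector_derivative_at_within)
    qed simp
    also have "\<dots> = a j x" by (simp add: y_def)
    finally show ?thesis .
  qed
qed

text \<open>A metric \<open>E dx\<^sub>1\<^sup>2 + 2 F dx\<^sub>1 dx\<^sub>2 + G dx\<^sub>2\<^sup>2\<close>; \<open>ch1_22\<close> stands for
  \<open>\<Gamma>\<^sup>1\<^sub>2\<^sub>2\<close> etc., and \<open>curv1\<close>, \<open>curv2\<close> are the components of \<open>R(\<partial>\<^sub>1,\<partial>\<^sub>2)\<partial>\<^sub>2\<close>.\<close>

locale smooth_metric =
  fixes B :: "(real^2) set" and E F G :: "real^2 \<Rightarrow> real"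
  assumes op: "open B"
    and E: "C_inf_on E B" and F: "C_inf_on F B" and G: "C_inf_on G B"
    and pos: "\<And>x. x \<in> B \<Longrightarrow> 0 < G x" "\<And>x. x \<in> B \<Longrightarrow> 0 < E x * G x - F x * F x"
begin

definition "dt x = E x * G x - F x * F x"
definition "ch1_11 x = (G x * (1/2 * pd 1 E x) - F x * (pd 1 F x - 1/2 * pd 2 E x)) * inverse (dt x)"
definition "ch2_11 x = (E x * (pd 1 F x - 1/2 * pd 2 E x) - F x * (1/2 * pd 1 E x)) * inverse (dt x)"
definition "ch1_12 x = (G x * (1/2 * pd 2 E x) - F x * (1/2 * pd 1 G x)) * inverse (dt x)"
definition "ch2_12 x = (E x * (1/2 * pd 1 G x) - F x * (1/2 * pd 2 E x)) * inverse (dt x)"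
definition "ch1_22 x = (G x * (pd 2 F x - 1/2 * pd 1 G x) - F x * (1/2 * pd 2 G x)) * inverse (dt x)"
definition "ch2_22 x = (E x * (1/2 * pd 2 G x) - F x * (pd 2 F x - 1/2 * pd 1 G x)) * inverse (dt x)"

definition "curv1 x = pd 1 ch1_22 x - pd 2 ch1_12 x + (ch1_22 x * ch1_11 x - ch1_12 x * ch1_12 x)
  + (ch2_22 x * ch1_12 x - ch2_12 x * ch1_22 x)"
definition "curv2 x = pd 1 ch2_22 x - pd 2 ch2_12 x + (ch1_22 x * ch2_11 x - ch1_12 x * ch2_12 x)"

lemma dtpos: "x \<in> B \<Longrightarrow> 0 < dt x" using pos(2) by (simp add: dt_def)

lemma smooth_coeffs: "C_k_on k E B" "C_k_on k F B" "C_k_on k G B"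
  "C_k_on k (pd i E) B" "C_k_on k (pd i F) B" "C_k_on k (pd i G) B"
  using E F G C_inf_on_pd[OF E, of i] C_inf_on_pd[OF F, of i] C_inf_on_pd[OF G, of i] by auto

lemma smooth_dt: "C_k_on k dt B" "C_k_on k (\<lambda>x. inverse (dt x)) B"
proof -
  show *: "C_k_on k dt B" unfolding dt_def[abs_def]
    by (intro C_k_on_diff[OF op] C_k_on_mult[OF op] smooth_coeffs)
  show "C_k_on k (\<lambda>x. inverse (dt x)) B"
    by (rule C_k_on_inverse[OF op *]) (use dtpos in fastforce)
qed

lemma smooth_ch: "C_inf_on ch1_11 B" "C_inf_on ch2_11 B" "C_inf_on ch1_12 B" "C_inf_on ch2_12 B"
  "C_inf_on ch1_22 B" "C_inf_on ch2_22 B"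
  unfolding ch1_11_def[abs_def] ch2_11_def[abs_def] ch1_12_def[abs_def] ch2_12_def[abs_def]
    ch1_22_def[abs_def] ch2_22_def[abs_def]
  by (intro allI C_k_on_diff[OF op] C_k_on_mult[OF op] smooth_coeffs smooth_dt C_k_on_const)+

text \<open>Compatibility of the Levi-Civita connection with the metric. From here on first
  derivatives of \<open>E\<close>, \<open>F\<close>, \<open>G\<close> are eliminated in favour of
  Christoffel symbols, and the identities to be checked become polynomial.\<close>

lemma compat:
  assumes "x \<in> B"
  shows "pd 1 E x = 2 * (E x * ch1_11 x + F x * ch2_11 x)" "pd 2 E x = 2 * (E x * ch1_12 x + F x * ch2_12 x)"
    "pd 1 G x = 2 * (F x * ch1_12 x + G x * ch2_12 x)" "pd 2 G x = 2 * (F x * ch1_22 x + G x * ch2_22 x)"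
    "pd 1 F x = ch1_11 x * F x + ch2_11 x * G x + ch1_12 x * E x + ch2_12 x * F x"
    "pd 2 F x = ch1_12 x * F x + ch2_12 x * G x + ch1_22 x * E x + ch2_22 x * F x"
proof -
  have i: "dt x * inverse (dt x) = 1" using dtpos[OF assms] by simp
  note defs = ch1_11_def ch2_11_def ch1_12_def ch2_12_def ch1_22_def ch2_22_def
  \<comment> \<open>\<open>algebra\<close> solves ring equations, so the reciprocal of the
    determinant becomes a variable tied to it by the single equation \<open>i\<close>. Later
    reciprocals are treated alike.\<close>
  define j where "j = inverse (dt x)"
  have i: "(E x * G x - F x * F x) * j = 1" using i unfolding j_def dt_def .
  show "pd 1 E x = 2 * (E x * ch1_11 x + F x * ch2_11 x)" "pd 2 E x = 2 * (E x * ch1_12 x + F x * ch2_12 x)"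
    "pd 1 G x = 2 * (F x * ch1_12 x + G x * ch2_12 x)" "pd 2 G x = 2 * (F x * ch1_22 x + G x * ch2_22 x)"
    "pd 1 F x = ch1_11 x * F x + ch2_11 x * G x + ch1_12 x * E x + ch2_12 x * F x"
    "pd 2 F x = ch1_12 x * F x + ch2_12 x * G x + ch1_22 x * E x + ch2_22 x * F x"
    unfolding defs j_def[symmetric] using i by algebra+
qed

lemma diffs:
  assumes "x \<in> B"
  shows "E differentiable at x" "F differentiable at x" "G differentiable at x" "dt differentiable at x"
    "ch1_11 differentiable at x" "ch2_11 differentiable at x" "ch1_12 differentiable at x"
    "ch2_12 differentiable at x" "ch1_22 differentiable at x" "ch2_22 differentiable at x"
  using assms E F G smooth_ch smooth_dt(1) by (auto intro: C_inf_on_differentiable)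

text \<open>\<open>R(\<partial>\<^sub>1,\<partial>\<^sub>2)\<partial>\<^sub>2\<close> is always
  orthogonal to \<open>\<partial>\<^sub>2\<close>, because the second derivatives of
  \<open>G\<close>, the squared length of \<open>\<partial>\<^sub>2\<close>, commute. The hypothesis
  \<open>K\<close> makes it orthogonal to \<open>\<partial>\<^sub>1\<close> too. A vector orthogonal
  to both vanishes since the determinant is positive.\<close>

lemma curv1_zero:
  assumes "x \<in> B" and K: "curv1 x * E x + curv2 x * F x = 0"
  shows "curv1 x = 0"
proof -
  have "pd 2 (pd 1 G) x = pd 1 (pd 2 G) x"
    by (rule pd_commute[OF op G \<open>x \<in> B\<close>])
  moreover have "pd 2 (pd 1 G) x = pd 2 (\<lambda>x. 2 * (F x * ch1_12 x + G x * ch2_12 x)) x"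
    by (rule pd_cong[OF C_inf_on_differentiable[OF C_inf_on_pd[OF G] \<open>x \<in> B\<close>] op \<open>x \<in> B\<close>]) (rule compat(3))
  moreover have "pd 1 (pd 2 G) x = pd 1 (\<lambda>x. 2 * (F x * ch1_22 x + G x * ch2_22 x)) x"
    by (rule pd_cong[OF C_inf_on_differentiable[OF C_inf_on_pd[OF G] \<open>x \<in> B\<close>] op \<open>x \<in> B\<close>]) (rule compat(4))
  ultimately have s: "pd 2 F x * ch1_12 x + F x * pd 2 ch1_12 x + pd 2 G x * ch2_12 x + G x * pd 2 ch2_12 x =
    pd 1 F x * ch1_22 x + F x * pd 1 ch1_22 x + pd 1 G x * ch2_22 x + G x * pd 1 ch2_22 x"
    using diffs[OF \<open>x \<in> B\<close>]
    by (simp add: pd_mult pd_add pd_const differentiable_add differentiable_mult)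
  have "curv1 x * F x + curv2 x * G x = 0"
    using s unfolding compat[OF \<open>x \<in> B\<close>] curv1_def curv2_def by algebra
  then have "curv1 x * dt x = 0" using K unfolding dt_def by algebra
  then show ?thesis using dtpos[OF \<open>x \<in> B\<close>] by simp
qed

definition "rt x = sqrt (dt x)"
definition "sG x = sqrt (G x)"
text \<open>The speed at which the unit vector along \<open>\<partial>\<^sub>2\<close> turns towards
  its unit normal under covariant differentiation in direction \<open>i\<close>: the component of
  \<nabla> along \<open>\<partial>\<^sub>1\<close> is
  \<open>\<Gamma>\<^sup>1\<^sub>i\<^sub>2\<close>, the normal part of
  \<open>\<partial>\<^sub>1\<close> has length \<open>rt x / sG x\<close>, and normalising
  \<open>\<partial>\<^sub>2\<close> costs another \<open>sG x\<close>.\<close>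

definition "om i x = rt x * inverse (G x) * (if i = 1 then ch1_12 x else ch1_22 x)" for i :: 2

lemma smooth_rt: "C_k_on k rt B" and smooth_sG: "C_k_on k sG B"
  and smooth_iG: "C_k_on k (\<lambda>x. inverse (G x)) B" and smooth_isG: "C_k_on k (\<lambda>x. inverse (sG x)) B"
proof -
  show "C_k_on k rt B" unfolding rt_def[abs_def] by (rule C_k_on_sqrt[OF op smooth_dt(1) dtpos])
  show *: "C_k_on k sG B" unfolding sG_def[abs_def] by (rule C_k_on_sqrt[OF op smooth_coeffs(3) pos(1)])
  show "C_k_on k (\<lambda>x. inverse (G x)) B" by (rule C_k_on_inverse[OF op smooth_coeffs(3)]) (use pos in fastforce)
  show "C_k_on k (\<lambda>x. inverse (sG x)) B" by (rule C_k_on_inverse[OF op *]) (use pos in \<open>force simp: sG_def\<close>)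
qed

lemma smooth_om: "C_inf_on (om i) B"
proof (cases "i = 1")
  case True
  then show ?thesis unfolding om_def[abs_def]
    using C_k_on_mult[OF op C_k_on_mult[OF op smooth_rt smooth_iG], of _ ch1_12] smooth_ch(3) by simp
next
  case False
  then show ?thesis unfolding om_def[abs_def]
    using C_k_on_mult[OF op C_k_on_mult[OF op smooth_rt smooth_iG], of _ ch1_22] smooth_ch(5) by simp
qed

text \<open>The logarithmic derivative of the determinant is twice the trace of the Christoffel
  symbols.\<close>

lemma pd_dt:
  assumes "x \<in> B"
  shows "pd 1 dt x = 2 * dt x * (ch1_11 x + ch2_12 x)" "pd 2 dt x = 2 * dt x * (ch1_12 x + ch2_22 x)"
  using diffs[OF assms] unfolding dt_def[abs_def]
  by (simp_all add: pd_mult pd_diff differentiable_mult compat[OF assms]) algebra+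

lemma pd_rt:
  assumes "x \<in> B"
  shows "pd 1 rt x = rt x * (ch1_11 x + ch2_12 x)" "pd 2 rt x = rt x * (ch1_12 x + ch2_22 x)"
proof -
  define r where "r = rt x"
  define k where "k = inverse (2 * r)"
  have r: "r * r = dt x" "2 * r * k = 1" using dtpos[OF assms] by (auto simp: r_def rt_def k_def)
  have k: "pd i rt x = pd i dt x * k" for i
    unfolding rt_def[abs_def] k_def r_def using pd_sqrt[OF diffs(4)[OF assms] dtpos[OF assms]] by simp
  show "pd 1 rt x = rt x * (ch1_11 x + ch2_12 x)"
    unfolding k pd_dt[OF assms] r(1)[symmetric] r_def[symmetric] using r(2) by algebra
  show "pd 2 rt x = rt x * (ch1_12 x + ch2_22 x)"
    unfolding k pd_dt[OF assms] r(1)[symmetric] r_def[symmetric] using r(2) by algebra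
qed

lemma diffs2:
  assumes "x \<in> B"
  shows "rt differentiable at x" "sG differentiable at x" "(\<lambda>x. inverse (G x)) differentiable at x"
    "(\<lambda>x. inverse (sG x)) differentiable at x" "om i differentiable at x"
  using assms smooth_rt smooth_sG smooth_iG smooth_isG C_inf_on_differentiable[OF smooth_om]
  by (auto intro: C_inf_on_differentiable)

text \<open>The exterior derivative \<open>pd 1 (om 2) x - pd 2 (om 1) x\<close> works out to
  \<open>rt x * inverse (G x) * curv1 x\<close>, which vanishes by
  \<open>curv1_zero\<close>.\<close>

lemma om_closed:
  assumes "x \<in> B" and K: "curv1 x * E x + curv2 x * F x = 0"
  shows "pd 1 (om 2) x = pd 2 (om 1) x"
proof -
  define j where "j = inverse (G x)"
  have j: "G x * j = 1" using pos(1)[OF assms(1)] by (simp add: j_def)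
  note d = diffs[OF assms(1)] diffs2[OF assms(1)]
  have "pd i (\<lambda>x. inverse (G x)) x = - (pd i G x * (j * j))" for i
    using pd_inverse[OF d(3)] pos(1)[OF assms(1)] by (simp add: j_def)
  then have o: "pd 1 (om 2) x = rt x * j * pd 1 ch1_22 x + (rt x * - (pd 1 G x * (j * j)) + pd 1 rt x * j) * ch1_22 x"
    "pd 2 (om 1) x = rt x * j * pd 2 ch1_12 x + (rt x * - (pd 2 G x * (j * j)) + pd 2 rt x * j) * ch1_12 x"
    using d unfolding om_def[abs_def] by (simp_all add: pd_mult differentiable_mult j_def)
  show ?thesis
    using curv1_zero[OF assms] j unfolding o compat[OF assms(1)] pd_rt[OF assms(1)] curv1_def by algebra
qed

text \<open>The coframe dual to the orthonormal frame obtained from \<open>(\<partial>\<^sub>2, \<partial>\<^sub>1)\<close> by Gram--Schmidt, as one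
  complex-valued form; \<open>om\<close> is its connection form.\<close>

definition "cof i x = (if i = 1 then complex_of_real (rt x * inverse (sG x)) + \<i> * complex_of_real (F x * inverse (sG x))
  else \<i> * complex_of_real (sG x))" for i :: 2

lemma smooth_cof: "C_inf_on (cof i) B"
proof (cases "i = 1")
  case True
  have "C_inf_on (\<lambda>x. complex_of_real (rt x * inverse (sG x)) + \<i> * complex_of_real (F x * inverse (sG x))) B"
    by (intro allI C_k_on_add[OF op] C_k_on_mult[OF op C_k_on_const] C_k_on_of_real[OF op] C_k_on_mult[OF op _ smooth_isG]
       smooth_rt smooth_coeffs)
  then show ?thesis using True by (simp add: cof_def[abs_def])
next
  case False
  have "C_inf_on (\<lambda>x. \<i> * complex_of_real (sG x)) B"
    by (intro allI C_k_on_mult[OF op C_k_on_const] C_k_on_of_real[OF op] smooth_sG)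
  then show ?thesis using False by (simp add: cof_def[abs_def])
qed

text \<open>Cartan's first structure equation, that is, vanishing torsion. Its real and imaginary
  parts are the facts \<open>r\<close> and \<open>i\<close> of the proof.\<close>

lemma cof_structure:
  assumes "x \<in> B"
  shows "pd 1 (cof 2) x - pd 2 (cof 1) x = \<i> * (of_real (om 1 x) * cof 2 x - of_real (om 2 x) * cof 1 x)"
proof -
  define s where "s = sG x"
  define j where "j = inverse s"
  have s: "s * s = G x" "s > 0" using pos(1)[OF assms(1)] by (auto simp: s_def sG_def)
  have j: "s * j = 1" using s by (simp add: j_def)
  have iG: "inverse (G x) = j * j" unfolding s(1)[symmetric] j_def by simp
  note d = diffs[OF assms(1)] diffs2[OF assms(1)]
  have ps: "pd i sG x = 1/2 * pd i G x * j" for i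
    unfolding sG_def[abs_def] using pd_sqrt[OF d(3) pos(1)[OF assms(1)]] by (simp add: j_def s_def sG_def)
  have pj: "pd i (\<lambda>x. inverse (sG x)) x = - (pd i sG x * (j * j))" for i
    using pd_inverse[OF d(12)] s by (simp add: j_def s_def)
  have c2: "pd 1 (cof 2) x = \<i> * of_real (pd 1 sG x)"
    unfolding cof_def[abs_def] using d by (simp add: pd_mult pd_of_real pd_const differentiable_of_real)
  have c1: "pd 2 (cof 1) x = of_real (rt x * - (pd 2 sG x * (j * j)) + pd 2 rt x * j)
     + \<i> * of_real (F x * - (pd 2 sG x * (j * j)) + pd 2 F x * j)"
    unfolding cof_def[abs_def] using d
    by (simp add: pd_mult pd_add pd_of_real pd_const differentiable_mult differentiable_of_real pj j_def s_def
         del: of_real_mult)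
  have *: "dt x = rt x * rt x" using dtpos[OF assms] by (simp add: rt_def)
  have c122: "ch1_22 x * (rt x * rt x) = G x * (pd 2 F x - 1/2 * pd 1 G x) - F x * (1/2 * pd 2 G x)"
    using dtpos[OF assms] unfolding *[symmetric] ch1_22_def by simp
  have o: "om 1 x = rt x * (j * j) * ch1_12 x" "om 2 x = rt x * (j * j) * ch1_22 x"
    by (auto simp: om_def iG)
  have ps': "2 * pd i sG x = pd i G x * j" for i using ps[of i] by simp
  have c122': "2 * (ch1_22 x * (rt x * rt x)) = G x * (2 * pd 2 F x - pd 1 G x) - F x * pd 2 G x"
    using c122 by (simp add: algebra_simps)
  have r: "rt x * (pd 2 sG x * (j * j)) - pd 2 rt x * j = om 2 x * (F x * j) - om 1 x * s"
    using ps'[of 2] s(1) j unfolding o pd_rt[OF assms] compat[OF assms] by algebra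
  have i: "pd 1 sG x + F x * (pd 2 sG x * (j * j)) - pd 2 F x * j = - (om 2 x * (rt x * j))"
    using ps'[of 2] ps'[of 1] c122' s(1) j unfolding o by algebra
  have "cof 1 x = of_real (rt x * j) + \<i> * of_real (F x * j)" "cof 2 x = \<i> * of_real s"
    by (auto simp: cof_def s_def j_def)
  then show ?thesis
    unfolding c1 c2 using r i by (simp add: complex_eq_iff algebra_simps)
qed

end

text \<open>By \<open>cof_structure\<close> the coframe fails to be closed only through a rotation
  at rate \<open>om\<close>. If \<tau> is a primitive of \<open>om\<close>, the factor
  \<open>exp (- \<i> * \<tau>)\<close> cancels this rotation and the resulting form has a primitive
  \<phi>. The coframe is orthonormal and the factor has modulus 1, so the squared norm of the
  derivative of \<phi> is the metric.\<close>

lemma (in smooth_metric) flat_primitive: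
  assumes B: "convex B" and S: "S \<subseteq> B" "convex S" "x0 \<in> S"
    and K: "\<And>x. x \<in> S \<Longrightarrow> curv1 x * E x + curv2 x * F x = 0"
  obtains \<phi> :: "real^2 \<Rightarrow> complex" where "C_inf_on \<phi> B"
    "\<And>x v. x \<in> S \<Longrightarrow> (norm (frechet_derivative \<phi> (at x) v))\<^sup>2 =
      E x * (v $ 1)\<^sup>2 + 2 * F x * v $ 1 * v $ 2 + G x * (v $ 2)\<^sup>2"
proof -
  have x0: "x0 \<in> B" using S by auto
  obtain \<tau> where \<tau>: "C_inf_on \<tau> B" "\<And>i x. x \<in> S \<Longrightarrow> pd i \<tau> x = om i x"
    using poincare_lemma[of B x0 om S, OF op B x0 smooth_om S] om_closed K S(1) by (metis subsetD)
  define e where "e x = exp (- \<i> * complex_of_real (\<tau> x))" for x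
  define a where "a i x = e x * cof i x" for i :: 2 and x
  have e: "C_inf_on e B"
    unfolding e_def[abs_def] using \<tau>(1)
    by (intro allI C_k_on_exp[OF op] C_k_on_mult[OF op C_k_on_const] C_k_on_of_real[OF op]) auto
  have a: "C_inf_on (a i) B" for i
    unfolding a_def[abs_def] using C_k_on_mult[OF op, of _ e "cof i"] e smooth_cof by blast
  have pa: "pd j (a i) x = e x * pd j (cof i) x - \<i> * of_real (om j x) * a i x" if "x \<in> S" for i j x
  proof -
    have xB: "x \<in> B" using that S by auto
    have d: "\<tau> differentiable at x" "cof i differentiable at x" "e differentiable at x"
      using C_inf_on_differentiable[OF \<tau>(1) xB] C_inf_on_differentiable[OF smooth_cof xB]
        C_inf_on_differentiable[OF e xB] by auto
    have "(\<lambda>x. - \<i> * complex_of_real (\<tau> x)) differentiable at x"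
      using d by (intro differentiable_mult differentiable_const differentiable_of_real)
    then have "pd j e x = e x * (- \<i> * of_real (om j x))"
      unfolding e_def[abs_def]
      using pd_mult[of "\<lambda>_. - \<i>" x "\<lambda>x. complex_of_real (\<tau> x)" j] d \<tau>(2)[OF that]
      by (simp add: pd_exp pd_const pd_of_real differentiable_of_real)
    then show ?thesis unfolding a_def[abs_def] using d by (simp add: pd_mult)
  qed
  have "pd 1 (a 2) x = pd 2 (a 1) x" if "x \<in> S" for x
  proof -
    have "pd 1 (a 2) x - pd 2 (a 1) x = e x * (pd 1 (cof 2) x - pd 2 (cof 1) x) -
       \<i> * (of_real (om 1 x) * a 2 x - of_real (om 2 x) * a 1 x)"
      unfolding pa[OF that] by (simp add: algebra_simps)
    also have "\<dots> = 0"
      unfolding cof_structure[OF subsetD[OF S(1) that]] a_def by (simp add: algebra_simps)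
    finally show ?thesis by simp
  qed
  then obtain \<phi> where \<phi>: "C_inf_on \<phi> B" "\<And>i x. x \<in> S \<Longrightarrow> pd i \<phi> x = a i x"
    using poincare_lemma[of B x0 a S, OF op B x0 a S] by metis
  have "(norm (frechet_derivative \<phi> (at x) v))\<^sup>2 = E x * (v $ 1)\<^sup>2 + 2 * F x * v $ 1 * v $ 2 + G x * (v $ 2)\<^sup>2"
    if "x \<in> S" for x v
  proof -
    have xB: "x \<in> B" using that S by auto
    define s where "s = sG x"
    define j where "j = inverse s"
    have s: "s * s = G x" "s > 0" using pos(1)[OF xB] by (auto simp: s_def sG_def)
    have j: "s * j = 1" using s by (simp add: j_def)
    have r: "rt x * rt x = E x * G x - F x * F x" using dtpos[OF xB] by (simp add: rt_def dt_def)
    have "frechet_derivative \<phi> (at x) v = e x * (of_real (v $ 1) * cof 1 x + of_real (v $ 2) * cof 2 x)"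
      using frechet_derivative_pd[OF C_inf_on_differentiable[OF \<phi>(1) xB], of v]
      unfolding \<phi>(2)[OF that] a_def by (simp add: scaleR_conv_of_real algebra_simps)
    moreover have "norm (e x) = 1" by (simp add: e_def)
    ultimately have "norm (frechet_derivative \<phi> (at x) v) = norm (of_real (v $ 1) * cof 1 x + of_real (v $ 2) * cof 2 x)"
      by (simp add: norm_mult)
    also have "of_real (v $ 1) * cof 1 x + of_real (v $ 2) * cof 2 x =
        Complex (v $ 1 * (rt x * j)) (v $ 1 * (F x * j) + v $ 2 * s)"
    proof -
      have "cof 1 x = of_real (rt x * j) + \<i> * of_real (F x * j)" "cof 2 x = \<i> * of_real s"
        by (auto simp: cof_def s_def j_def)
      then show ?thesis by (simp add: complex_eq_iff)
    qed
    finally have "(norm (frechet_derivative \<phi> (at x) v))\<^sup>2 = (v $ 1 * (rt x * j))\<^sup>2 + (v $ 1 * (F x * j) + v $ 2 * s)\<^sup>2"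
      by (simp add: cmod_power2)
    also have "\<dots> = E x * (v $ 1)\<^sup>2 + 2 * F x * v $ 1 * v $ 2 + G x * (v $ 2)\<^sup>2"
    proof -
      \<comment> \<open>The quadratic form with its square completed, which is what orthonormality
        of the Gram--Schmidt coframe amounts to.\<close>
      have "(a * (q * j))\<^sup>2 + (a * (f * j) + b * s)\<^sup>2 = e * a\<^sup>2 + 2 * f * a * b + g * b\<^sup>2"
        if "s * s = g" "s * j = 1" "q * q = e * g - f * f" for a b q j s e f g :: real
      proof -
        have "(s * j) * (s * j) = 1" using that(2) by simp
        then have jg: "g * (j * j) = 1" using that(1) by (simp add: algebra_simps)
        have "a\<^sup>2 * (j * j) * (e * g) = e * a\<^sup>2 * (g * (j * j))" by (simp add: algebra_simps)
        then have "a\<^sup>2 * (j * j) * (q * q + f * f) = e * a\<^sup>2" using that(3) jg by simp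
        moreover have "(a * (q * j))\<^sup>2 + (a * (f * j) + b * s)\<^sup>2 =
            a\<^sup>2 * (j * j) * (q * q + f * f) + 2 * f * a * b * (s * j) + b\<^sup>2 * (s * s)"
          by (simp add: power2_eq_square algebra_simps)
        ultimately show ?thesis unfolding that(1,2) by simp
      qed
      from this[OF s(1) j r] show ?thesis .
    qed
    finally show ?thesis .
  qed
  then show ?thesis using that \<phi>(1) by blast
qed

section \<open>Two by two matrices and the half plane\<close>

lemma matrix_inv_unique:
  fixes A :: "real^'n^'n"
  assumes "A ** C = mat 1" "C ** A = mat 1"
  shows "matrix_inv A = C"
proof -
  have "A ** matrix_inv A = mat 1 \<and> matrix_inv A ** A = mat 1"
    unfolding matrix_inv_def by (rule someI[of _ C]) (use assms in simp)
  then have "C = (matrix_inv A ** A) ** C" "matrix_inv A = matrix_inv A ** (A ** C)"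
    using assms by (auto simp: matrix_mul_lid matrix_mul_rid)
  then show ?thesis by (metis matrix_mul_assoc)
qed

lemma matrix_inv_2:
  fixes A :: "real^2^2"
  assumes "d * (A $ 1 $ 1 * A $ 2 $ 2 - A $ 1 $ 2 * A $ 2 $ 1) = 1"
  shows "matrix_inv A $ 1 $ 1 = A $ 2 $ 2 * d" "matrix_inv A $ 1 $ 2 = - A $ 1 $ 2 * d"
    "matrix_inv A $ 2 $ 1 = - A $ 2 $ 1 * d" "matrix_inv A $ 2 $ 2 = A $ 1 $ 1 * d"
proof -
  define C :: "real^2^2" where "C = vector [vector [A $ 2 $ 2 * d, - A $ 1 $ 2 * d], vector [- A $ 2 $ 1 * d, A $ 1 $ 1 * d]]"
  have "A ** C = mat 1 \<and> C ** A = mat 1"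
    by (simp add: vec_eq_iff forall_2 matrix_matrix_mult_def sum_2 mat_def C_def, intro conjI; use assms in algebra)
  then have "matrix_inv A = C" using matrix_inv_unique by blast
  then show "matrix_inv A $ 1 $ 1 = A $ 2 $ 2 * d" "matrix_inv A $ 1 $ 2 = - A $ 1 $ 2 * d"
    "matrix_inv A $ 2 $ 1 = - A $ 2 $ 1 * d" "matrix_inv A $ 2 $ 2 = A $ 1 $ 1 * d"
    by (simp_all add: C_def)
qed

lemma quadratic_form_2:
  fixes A :: "real^2^2"
  shows "v \<bullet> (A *v w) = A $ 1 $ 1 * v $ 1 * w $ 1 + A $ 1 $ 2 * v $ 1 * w $ 2 + A $ 2 $ 1 * v $ 2 * w $ 1 + A $ 2 $ 2 * v $ 2 * w $ 2"
  by (simp add: inner_vec_def matrix_vector_mult_def sum_2 algebra_simps)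

lemma posdef_2:
  fixes A :: "real^2^2"
  assumes "A $ 2 $ 1 = A $ 1 $ 2" "\<And>v. v \<noteq> 0 \<Longrightarrow> 0 < v \<bullet> (A *v v)"
  shows "0 < A $ 2 $ 2" "0 < A $ 1 $ 1 * A $ 2 $ 2 - A $ 1 $ 2 * A $ 1 $ 2"
proof -
  show G: "0 < A $ 2 $ 2"
    using assms(2)[of "axis 2 1"] by (simp add: quadratic_form_2 axis_eq_0_iff) (simp add: axis_def)
  \<comment> \<open>A vector orthogonal, for the form \<open>A\<close>, to the second axis:
    \<open>A *v v\<close> is the determinant times the first axis, so the form takes the value
    \<open>A $ 2 $ 2\<close> times the determinant at \<open>v\<close>.\<close>
  define v :: "real^2" where "v = vector [A $ 2 $ 2, - A $ 1 $ 2]"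
  have "v \<noteq> 0" using G by (auto simp: v_def vec_eq_iff forall_2)
  from assms(2)[OF this] have "0 < A $ 2 $ 2 * (A $ 1 $ 1 * A $ 2 $ 2 - A $ 1 $ 2 * A $ 1 $ 2)"
    unfolding quadratic_form_2 assms(1) by (simp add: v_def algebra_simps)
  then show "0 < A $ 1 $ 1 * A $ 2 $ 2 - A $ 1 $ 2 * A $ 1 $ 2"
    using G by (simp add: zero_less_mult_iff)
qed

definition upper :: "(real^2) set" where "upper = {x. 0 < x $ 2}"

lemma open_upper: "open upper"
  unfolding upper_def by (intro open_Collect_less continuous_intros)

lemma upper_subset: "upper \<subseteq> half_plane"
  by (auto simp: upper_def half_plane_def)

lemma convex_upper: "convex upper"
proof -
  have eq: "upper = {x. axis 2 1 \<bullet> x > 0}" by (auto simp: upper_def inner_axis inner_commute)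
  show ?thesis unfolding eq by (rule convex_halfspace_gt)
qed

lemma convex_half_plane: "convex half_plane"
proof -
  have eq: "half_plane = {x. axis 2 1 \<bullet> x \<ge> 0}" by (auto simp: half_plane_def inner_axis inner_commute)
  show ?thesis unfolding eq by (rule convex_halfspace_ge)
qed

lemma closed_half_plane: "closed half_plane"
proof -
  have eq: "half_plane = {x. axis 2 1 \<bullet> x \<ge> 0}" by (auto simp: half_plane_def inner_axis inner_commute)
  show ?thesis unfolding eq by (rule closed_halfspace_ge)
qed

lemma half_plane_approach:
  assumes "x \<in> half_plane" "0 < r"
  obtains X where "X \<longlonglongrightarrow> x" "\<And>n. X n \<in> upper" "\<And>n. X n \<in> ball x r" "\<And>n::nat. X n \<in> half_plane"
proof -
  \<comment> \<open>With \<open>n + 2\<close> the shift is at most \<open>r / 2\<close>, hence stays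
    in the ball already for \<open>n = 0\<close>.\<close>
  define X where "X n = x + (r / (real n + 2)) *\<^sub>R axis 2 1" for n :: nat
  have "(\<lambda>n. r / (real n + 2)) \<longlonglongrightarrow> 0" by real_asymp
  then have "X \<longlonglongrightarrow> x + 0 *\<^sub>R axis 2 1"
    unfolding X_def[abs_def] by (intro tendsto_intros)
  moreover have "X n \<in> upper" for n
    using assms by (auto simp: X_def upper_def half_plane_def add_nonneg_pos)
  moreover have "X n \<in> ball x r" for n
    using assms by (auto simp: X_def dist_norm field_simps add_pos_nonneg)
  ultimately show ?thesis using that[of X] upper_subset by auto
qed

text \<open>Carries identities known only at interior points to the edge: the vanishing of the
  curvature of the extended metric, and the rigid-motion formula for \<psi>.\<close>

lemma half_plane_continuous_eq:
  fixes p q :: "real^2 \<Rightarrow> 'b::metric_space"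
  assumes "continuous_on (ball x0 r \<inter> half_plane) p" "continuous_on (ball x0 r \<inter> half_plane) q"
    "\<And>y. y \<in> ball x0 r \<inter> upper \<Longrightarrow> p y = q y" "x \<in> ball x0 r \<inter> half_plane"
  shows "p x = q x"
proof -
  obtain r' where r': "r' > 0" "ball x r' \<subseteq> ball x0 r"
    using assms(4) open_ball openE by (metis IntD1)
  obtain X where X: "X \<longlonglongrightarrow> x" "\<And>n. X n \<in> upper" "\<And>n. X n \<in> ball x r'" "\<And>n::nat. X n \<in> half_plane"
    using half_plane_approach[OF _ r'(1), of x] assms(4) by auto
  have XS: "X n \<in> ball x0 r \<inter> half_plane" for n using X(3,4) r'(2) by blast
  have "(\<lambda>n. p (X n)) \<longlonglongrightarrow> p x" "(\<lambda>n. q (X n)) \<longlonglongrightarrow> q x"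
    using continuous_on_tendsto_compose[OF assms(1) X(1) assms(4)]
      continuous_on_tendsto_compose[OF assms(2) X(1) assms(4)] XS by auto
  moreover have "p (X n) = q (X n)" for n using assms(3) X(2) XS by blast
  ultimately show ?thesis using LIMSEQ_unique by auto
qed

section \<open>Flat coordinates in a chart\<close>

lemma openin_half_plane_ball:
  assumes "openin (top_of_set half_plane) D" "x \<in> D"
  obtains r where "0 < r" "ball x r \<inter> half_plane \<subseteq> D"
  using assms unfolding openin_contains_ball by blast

lemma pderiv_within_eq_pd:
  assumes "open U" "U \<subseteq> D" "x \<in> U" "\<And>y. y \<in> U \<Longrightarrow> f y = p y" "p differentiable at x"
  shows "pderiv_within D i f x = pd i p x"
proof -
  have "at x within D = at x"
    using assms(1-3) by (meson at_within_interior interior_maximal subsetD)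
  moreover have "frechet_derivative p (at x) = frechet_derivative f (at x)"
    using frechet_derivative_transform_within_open[OF assms(5,1,3)] assms(4) by metis
  ultimately show ?thesis by (simp add: pderiv_within_def pd_def)
qed

text \<open>At a boundary point the ball sticks out of the half plane. The map \<phi> is a
  diffeomorphism of the whole ball onto its image, but is related to the metric \<open>h\<close>
  only on the part inside the half plane.\<close>

definition flat_coord :: "(real^2 \<Rightarrow> real^2^2) \<Rightarrow> real^2 \<Rightarrow> real \<Rightarrow> (real^2 \<Rightarrow> complex) \<Rightarrow> bool" where
  "flat_coord h x0 r \<phi> \<longleftrightarrow> 0 < r \<and> C_inf_on \<phi> (ball x0 r) \<and> inj_on \<phi> (ball x0 r) \<and>
     open (\<phi> ` ball x0 r) \<and> C_inf_on (inv_into (ball x0 r) \<phi>) (\<phi> ` ball x0 r) \<and>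
     (\<forall>x\<in>ball x0 r. inj (frechet_derivative \<phi> (at x))) \<and>
     (\<forall>x\<in>ball x0 r \<inter> half_plane. \<forall>v. (norm (frechet_derivative \<phi> (at x) v))\<^sup>2 = v \<bullet> (h x *v v))"

text \<open>The curvature is defined by derivatives within the chart domain, while the construction
  of \<phi> needs a metric on an open ball. So the components are extended to \<open>H\<close>,
  which is still positive definite on a small ball; at interior points the two kinds of derivative
  agree, and continuity transfers the vanishing of the curvature to the edge. Beyond the edge
  \<open>H\<close> need not be flat, hence the set \<open>S\<close> in \<open>flat_primitive\<close>
  is the half ball.\<close>

lemma flat_coordinates:
  fixes g :: "'a metric" and c :: "'a chart"
  defines "D \<equiv> snd c ` fst c"
  assumes D: "openin (top_of_set half_plane) D" and "smooth_on D (g c)"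
    and sym: "\<And>x. x \<in> D \<Longrightarrow> transpose (g c x) = g c x"
    and posg: "\<And>x v. x \<in> D \<Longrightarrow> v \<noteq> 0 \<Longrightarrow> 0 < v \<bullet> (g c x *v v)"
    and K: "\<And>x. x \<in> D \<Longrightarrow> gauss_curvature c g x = 0"
    and "x0 \<in> D"
  obtains r \<phi> where "flat_coord (g c) x0 r \<phi>" "ball x0 r \<inter> half_plane \<subseteq> D"
proof -
  define h where "h = g c"
  obtain W H where W: "open W" "x0 \<in> W" "C_inf_on H W" "\<And>x. x \<in> W \<inter> D \<Longrightarrow> H x = h x"
    using bspec[OF assms(3)[unfolded smooth_on_def] \<open>x0 \<in> D\<close>] unfolding h_def by metis
  define E where "E x = H x $ 1 $ 1" for x
  define F where "F x = H x $ 1 $ 2" for x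
  define G where "G x = H x $ 2 $ 2" for x
  have sy: "h x $ 2 $ 1 = h x $ 1 $ 2" if "x \<in> D" for x
    using arg_cong[OF sym[OF that], of "\<lambda>A. A $ 2 $ 1"] by (simp add: transpose_def h_def)
  have comp: "C_inf_on (\<lambda>x. H x $ i $ j) W" for i j
  proof -
    have "bounded_linear (\<lambda>A :: real^2^2. A $ i $ j)"
      by (rule bounded_linear_compose[OF bounded_linear_vec_nth bounded_linear_vec_nth])
    from C_k_on_linear_comp[OF this W(1)] W(3) show ?thesis by blast
  qed
  have EFG: "C_inf_on E W" "C_inf_on F W" "C_inf_on G W"
    using comp unfolding E_def[abs_def] F_def[abs_def] G_def[abs_def] by auto
  have posD: "0 < h x $ 2 $ 2" "0 < h x $ 1 $ 1 * h x $ 2 $ 2 - h x $ 1 $ 2 * h x $ 1 $ 2" if "x \<in> D" for x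
    using posdef_2[OF sy[OF that]] posg[OF that] by (auto simp: h_def)
  have "open {x \<in> W. 0 < G x}" "open {x \<in> W. 0 < E x * G x - F x * F x}"
  proof -
    have *: "open {x \<in> W. 0 < f x}" if "continuous_on W f" for f :: "real^2 \<Rightarrow> real"
    proof -
      have "{x \<in> W. 0 < f x} = W \<inter> f -` {0<..}" by auto
      then show ?thesis using continuous_open_preimage[OF that W(1), of "{0<..}"] by simp
    qed
    show "open {x \<in> W. 0 < G x}" "open {x \<in> W. 0 < E x * G x - F x * F x}"
      by (intro * continuous_intros C_inf_on_continuous EFG)+
  qed
  then have "open ({x \<in> W. 0 < G x} \<inter> {x \<in> W. 0 < E x * G x - F x * F x})" by blast
  moreover have "x0 \<in> {x \<in> W. 0 < G x} \<inter> {x \<in> W. 0 < E x * G x - F x * F x}"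
    using posD[OF \<open>x0 \<in> D\<close>] W(2) W(4)[of x0] \<open>x0 \<in> D\<close> by (auto simp: E_def F_def G_def)
  ultimately obtain r1 where r1: "r1 > 0" "ball x0 r1 \<subseteq> {x \<in> W. 0 < G x} \<inter> {x \<in> W. 0 < E x * G x - F x * F x}"
    using openE by blast
  obtain r2 where r2: "r2 > 0" "ball x0 r2 \<inter> half_plane \<subseteq> D"
    using openin_half_plane_ball[OF D \<open>x0 \<in> D\<close>] .
  define r where "r = min r1 r2"
  define B where "B = ball x0 r"
  have r: "r > 0" using r1 r2 by (simp add: r_def)
  have B: "open B" "convex B" "x0 \<in> B" "B \<subseteq> W" "B \<inter> half_plane \<subseteq> D" "\<And>x. x \<in> B \<Longrightarrow> 0 < G x"
    "\<And>x. x \<in> B \<Longrightarrow> 0 < E x * G x - F x * F x"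
    using r1 r2 r by (auto simp: B_def r_def)
  interpret smooth_metric B E F G
    using B(1,6,7) EFG by unfold_locales (blast intro: C_k_on_subset[OF _ B(4)])+
  define U where "U = B \<inter> upper"
  have U: "open U" "U \<subseteq> D" "U \<subseteq> B" using B(1,5) open_upper upper_subset by (auto simp: U_def)
  have hH: "h y $ i $ j = H y $ i $ j" if "y \<in> U" for y i j
  proof -
    have "y \<in> W \<inter> D" using that U B(4) by blast
    then show ?thesis using W(4) by simp
  qed
  have HE: "H y $ 1 $ 1 = E y" "H y $ 1 $ 2 = F y" "H y $ 2 $ 1 = F y" "H y $ 2 $ 2 = G y" if "y \<in> U" for y
    using hH[OF that, of 1 2] hH[OF that, of 2 1] sy[of y] U that by (auto simp: E_def F_def G_def)
  have ph: "pderiv_within D i (\<lambda>y. h y $ a $ b) y =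
      pd i (if a = 1 then if b = 1 then E else F else if b = 1 then F else G) y" if "y \<in> U" for y i a b
  proof (rule pderiv_within_eq_pd[OF U(1,2) that])
    show "h y $ a $ b = (if a = 1 then if b = 1 then E else F else if b = 1 then F else G) y" if "y \<in> U" for y
      using hH[OF that] HE[OF that] exhaust_2[of a] exhaust_2[of b] by auto
  qed (use diffs[of y] that U in auto)
  have Q: "christoffel D h 1 1 1 y = ch1_11 y" "christoffel D h 2 1 1 y = ch2_11 y"
    "christoffel D h 1 1 2 y = ch1_12 y" "christoffel D h 2 1 2 y = ch2_12 y"
    "christoffel D h 1 2 1 y = ch1_12 y" "christoffel D h 2 2 1 y = ch2_12 y"
    "christoffel D h 1 2 2 y = ch1_22 y" "christoffel D h 2 2 2 y = ch2_22 y" if "y \<in> U" for y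
  proof -
    have "inverse (dt y) * (h y $ 1 $ 1 * h y $ 2 $ 2 - h y $ 1 $ 2 * h y $ 2 $ 1) = 1"
      using dtpos[of y] that U by (auto simp: hH HE dt_def)
    note i = matrix_inv_2[OF this]
    show "christoffel D h 1 1 1 y = ch1_11 y" "christoffel D h 2 1 1 y = ch2_11 y"
      "christoffel D h 1 1 2 y = ch1_12 y" "christoffel D h 2 1 2 y = ch2_12 y"
      "christoffel D h 1 2 1 y = ch1_12 y" "christoffel D h 2 2 1 y = ch2_12 y"
      "christoffel D h 1 2 2 y = ch1_22 y" "christoffel D h 2 2 2 y = ch2_22 y"
      unfolding christoffel_def sum_2 i ph[OF that] hH[OF that] HE[OF that]
        ch1_11_def ch2_11_def ch1_12_def ch2_12_def ch1_22_def ch2_22_def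
      by (simp_all add: algebra_simps)
  qed
  have PQ: "pderiv_within D 1 (christoffel D h 1 2 2) y = pd 1 ch1_22 y"
    "pderiv_within D 1 (christoffel D h 2 2 2) y = pd 1 ch2_22 y"
    "pderiv_within D 2 (christoffel D h 1 1 2) y = pd 2 ch1_12 y"
    "pderiv_within D 2 (christoffel D h 2 1 2) y = pd 2 ch2_12 y" if "y \<in> U" for y
  proof -
    have yB: "y \<in> B" using that U(3) by blast
    note * = pderiv_within_eq_pd[OF U(1,2) that]
    show "pderiv_within D 1 (christoffel D h 1 2 2) y = pd 1 ch1_22 y" by (rule *[OF Q(7) diffs(9)[OF yB]])
    show "pderiv_within D 1 (christoffel D h 2 2 2) y = pd 1 ch2_22 y" by (rule *[OF Q(8) diffs(10)[OF yB]])
    show "pderiv_within D 2 (christoffel D h 1 1 2) y = pd 2 ch1_12 y" by (rule *[OF Q(3) diffs(7)[OF yB]])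
    show "pderiv_within D 2 (christoffel D h 2 1 2) y = pd 2 ch2_12 y" by (rule *[OF Q(4) diffs(8)[OF yB]])
  qed
  have K0: "curv1 y * E y + curv2 y * F y = 0" if "y \<in> U" for y
  proof -
    have yD: "y \<in> D" using that U by auto
    have "det (h y) \<noteq> 0" using posD(2)[OF yD] sy[OF yD] by (simp add: det_2)
    then have "(\<Sum>l\<in>UNIV. curvature_tensor D h l 1 2 2 y * h y $ l $ 1) = 0"
      using K[OF yD] unfolding gauss_curvature_def D_def[symmetric] h_def[symmetric] by simp
    moreover have "curvature_tensor D h 1 1 2 2 y = curv1 y" "curvature_tensor D h 2 1 2 2 y = curv2 y"
      unfolding curvature_tensor_def sum_2 Q[OF that] PQ[OF that] curv1_def curv2_def by (simp_all add: algebra_simps)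
    ultimately show ?thesis by (simp add: sum_2 hH[OF that] HE[OF that])
  qed
  \<comment> \<open>The expression is continuous on the whole ball because it is formed from the
    smooth extension, so its zeros at interior points force zeros on the edge.\<close>
  have K1: "curv1 x * E x + curv2 x * F x = 0" if "x \<in> B \<inter> half_plane" for x
  proof (rule half_plane_continuous_eq[of x0 r])
    have c: "continuous_on B (\<lambda>x. curv1 x * E x + curv2 x * F x)"
      unfolding curv1_def curv2_def
      by (intro continuous_intros C_inf_on_continuous C_inf_on_pd smooth_ch E F)
    show "continuous_on (ball x0 r \<inter> half_plane) (\<lambda>x. curv1 x * E x + curv2 x * F x)"
      using c by (rule continuous_on_subset) (auto simp: B_def)
  qed (use K0 that in \<open>auto simp: U_def B_def\<close>)
  have x0h: "x0 \<in> half_plane" using \<open>x0 \<in> D\<close> D openin_imp_subset by blast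
  obtain \<phi> :: "real^2 \<Rightarrow> complex" where \<phi>: "C_inf_on \<phi> B"
    "\<And>x v. x \<in> B \<inter> half_plane \<Longrightarrow> (norm (frechet_derivative \<phi> (at x) v))\<^sup>2 =
      E x * (v $ 1)\<^sup>2 + 2 * F x * v $ 1 * v $ 2 + G x * (v $ 2)\<^sup>2"
  proof (rule flat_primitive[OF B(2), of "B \<inter> half_plane" x0])
    show "convex (B \<inter> half_plane)" using B(2) convex_half_plane by (rule convex_Int)
  qed (use B(3) x0h K1 in auto)
  have \<phi>h: "(norm (frechet_derivative \<phi> (at x) v))\<^sup>2 = v \<bullet> (h x *v v)" if "x \<in> B \<inter> half_plane" for x v
  proof -
    have "x \<in> D" "x \<in> W \<inter> D" using that B(4,5) by auto
    then show ?thesis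
      using W(4)[of x] sy[of x] unfolding \<phi>(2)[OF that]
      by (simp add: quadratic_form_2 E_def F_def G_def power2_eq_square)
  qed
  have lin: "linear (frechet_derivative \<phi> (at x0))"
    using C_inf_on_has_derivative[OF \<phi>(1) B(3)] by (rule has_derivative_linear)
  have "inj (frechet_derivative \<phi> (at x0))"
    unfolding linear_injective_0[OF lin]
  proof (intro allI impI)
    fix v assume "frechet_derivative \<phi> (at x0) v = 0"
    then have "v \<bullet> (h x0 *v v) = 0" using \<phi>h[of x0 v] B(3) x0h by simp
    then show "v = 0" using posg[OF \<open>x0 \<in> D\<close>, of v] unfolding h_def by fastforce
  qed
  from smooth_inverse_function[OF B(1) \<phi>(1) B(3) this]
  obtain U' V \<gamma> where inv: "open U'" "U' \<subseteq> B" "x0 \<in> U'" "open V" "homeomorphism U' V \<phi> \<gamma>"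
    "C_inf_on \<gamma> V" "\<And>x. x \<in> U' \<Longrightarrow> inj (frechet_derivative \<phi> (at x))" by metis
  obtain s where s: "s > 0" "ball x0 s \<subseteq> U'" by (rule openE[OF inv(1,3)])
  have injU: "inj_on \<phi> U'" by (rule inj_on_inverseI[of _ \<gamma>]) (rule homeomorphism_apply1[OF inv(5)])
  have op': "open (\<phi> ` ball x0 s)"
  proof -
    have "openin (top_of_set U') (ball x0 s)" unfolding openin_open_eq[OF inv(1)] using s(2) by simp
    then have "openin (top_of_set V) (\<phi> ` ball x0 s)" by (rule homeomorphism_imp_open_map[OF inv(5)])
    then show ?thesis unfolding openin_open_eq[OF inv(4)] by simp
  qed
  have "flat_coord (g c) x0 s \<phi>" unfolding flat_coord_def h_def[symmetric]
  proof (intro conjI ballI)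
    show "C_inf_on \<phi> (ball x0 s)" using \<phi>(1) C_k_on_subset[OF _ subset_trans[OF s(2) inv(2)]] by blast
    show "inj_on \<phi> (ball x0 s)" using injU s(2) inj_on_subset by blast
    have VV: "\<phi> ` ball x0 s \<subseteq> V" using s(2) inv(5) by (auto simp: homeomorphism_def)
    show "C_inf_on (inv_into (ball x0 s) \<phi>) (\<phi> ` ball x0 s)"
    proof
      fix k
      show "C_k_on k (inv_into (ball x0 s) \<phi>) (\<phi> ` ball x0 s)"
      proof (rule C_k_on_cong[OF op'])
        show "C_k_on k \<gamma> (\<phi> ` ball x0 s)" using C_k_on_subset[OF _ VV] inv(6) by blast
        show "\<gamma> z = inv_into (ball x0 s) \<phi> z" if zz: "z \<in> \<phi> ` ball x0 s" for z
        proof -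
          obtain x where x: "x \<in> ball x0 s" "z = \<phi> x" using zz by blast
          then show ?thesis
            using homeomorphism_apply1[OF inv(5) subsetD[OF s(2) x(1)]]
              inv_into_f_f[OF inj_on_subset[OF injU s(2)] x(1)] by simp
        qed
      qed
    qed
    show "\<forall>v. (norm (frechet_derivative \<phi> (at x) v))\<^sup>2 = v \<bullet> (h x *v v)" if "x \<in> ball x0 s \<inter> half_plane" for x
    proof
      fix v
      have "x \<in> B \<inter> half_plane" using that s(2) inv(2) by blast
      then show "(norm (frechet_derivative \<phi> (at x) v))\<^sup>2 = v \<bullet> (h x *v v)" by (rule \<phi>h)
    qed
    show "inj (frechet_derivative \<phi> (at x))" if "x \<in> ball x0 s" for x
      using that s(2) inv(7) by blast
  qed (use s op' in auto)
  moreover have "ball x0 s \<inter> half_plane \<subseteq> D" using s(2) inv(2) B(5) by auto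
  ultimately show ?thesis using that by blast
qed

section \<open>The maximum principle near a boundary point\<close>

text \<open>The mean value inequality for \<phi> minus its linear part at \<open>x0\<close>.
  Estimates for difference quotients have two moving points, so differentiability at
  \<open>x0\<close> alone would not suffice.\<close>

lemma strict_derivative:
  fixes \<phi> :: "real^2 \<Rightarrow> 'b::euclidean_space"
  assumes "C_inf_on \<phi> (ball x0 r)" "0 < r" "0 < \<eta>"
  obtains s where "0 < s" "s \<le> r" "\<And>x y. x \<in> ball x0 s \<Longrightarrow> y \<in> ball x0 s \<Longrightarrow>
    norm (\<phi> x - \<phi> y - frechet_derivative \<phi> (at x0) (x - y)) \<le> \<eta> * norm (x - y)"
proof -
  let ?D = "\<lambda>x. frechet_derivative \<phi> (at x)"
  have x0: "x0 \<in> ball x0 r" using assms by simp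
  have cont: "isCont (pd i \<phi>) x0" for i
    using C_inf_on_continuous[OF C_inf_on_pd[OF assms(1), of i]] x0
    by (simp add: continuous_on_eq_continuous_at)
  have "\<forall>i. \<exists>d>0. \<forall>x. dist x x0 < d \<longrightarrow> dist (pd i \<phi> x) (pd i \<phi> x0) < \<eta> / 2"
    using cont assms(3) unfolding continuous_at_eps_delta by (meson half_gt_zero)
  then obtain s where s: "\<And>i. s i > 0" "\<And>i x. dist x x0 < s i \<Longrightarrow> dist (pd i \<phi> x) (pd i \<phi> x0) < \<eta> / 2"
    by metis
  define s' where "s' = min r (min (s 1) (s 2))"
  show ?thesis
  proof (rule that[of s'])
    show "0 < s'" "s' \<le> r" using s(1) assms(2) by (auto simp: s'_def)
    fix x y assume xy: "x \<in> ball x0 s'" "y \<in> ball x0 s'"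
    have lin: "linear (?D x)" if "x \<in> ball x0 r" for x
      using C_inf_on_has_derivative[OF assms(1) that] by (rule has_derivative_linear)
    have "norm ((\<phi> x - ?D x0 x) - (\<phi> y - ?D x0 y)) \<le> \<eta> * norm (x - y)"
    proof (rule differentiable_bound[OF convex_ball _ _ xy, of "\<lambda>x. \<phi> x - ?D x0 x" "\<lambda>x v. ?D x v - ?D x0 v"])
      fix x assume x: "x \<in> ball x0 s'"
      then have xr: "x \<in> ball x0 r" by (auto simp: s'_def)
      show "((\<lambda>x. \<phi> x - ?D x0 x) has_derivative (\<lambda>v. ?D x v - ?D x0 v)) (at x within ball x0 s')"
        using C_inf_on_has_derivative[OF assms(1) xr] linear_imp_has_derivative[OF lin[OF x0]]
        by (intro has_derivative_diff) (auto intro: has_derivative_at_withinI)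
      show "onorm (\<lambda>v. ?D x v - ?D x0 v) \<le> \<eta>"
      proof (rule onorm_le)
        fix v
        have "?D x v - ?D x0 v = v $ 1 *\<^sub>R (pd 1 \<phi> x - pd 1 \<phi> x0) + v $ 2 *\<^sub>R (pd 2 \<phi> x - pd 2 \<phi> x0)"
          unfolding frechet_derivative_pd[OF C_inf_on_differentiable[OF assms(1) xr], of v]
            frechet_derivative_pd[OF C_inf_on_differentiable[OF assms(1) x0], of v] by (simp add: algebra_simps)
        also have "norm \<dots> \<le> \<bar>v $ 1\<bar> * norm (pd 1 \<phi> x - pd 1 \<phi> x0) + \<bar>v $ 2\<bar> * norm (pd 2 \<phi> x - pd 2 \<phi> x0)"
          using norm_triangle_ineq[of "v $ 1 *\<^sub>R (pd 1 \<phi> x - pd 1 \<phi> x0)" "v $ 2 *\<^sub>R (pd 2 \<phi> x - pd 2 \<phi> x0)"] by simp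
        also have "\<dots> \<le> norm v * (\<eta> / 2) + norm v * (\<eta> / 2)"
          using s(2)[of x 1] s(2)[of x 2] x
          by (intro add_mono mult_mono component_le_norm_cart) (auto simp: s'_def dist_norm norm_minus_commute)
        finally show "norm (?D x v - ?D x0 v) \<le> \<eta> * norm v" by simp
      qed
    qed
    then show "norm (\<phi> x - \<phi> y - ?D x0 (x - y)) \<le> \<eta> * norm (x - y)"
      by (simp add: linear_diff[OF lin[OF x0]] algebra_simps)
  qed
qed

text \<open>The image of the open half disc is open by invariance of domain, and its closure lies in
  the image of the compact half disc. So its frontier comes from the flat edge and the arc, the two
  places where a bound is assumed.\<close>

lemma half_disc_maximum:
  fixes \<phi> :: "real^2 \<Rightarrow> complex"
  assumes cont: "continuous_on (ball x0 r) \<phi>" and inj: "inj_on \<phi> (ball x0 r)" and s: "s < r"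
    and F: "continuous_on (\<phi> ` (cball x0 s \<inter> half_plane)) F" "F holomorphic_on \<phi> ` (ball x0 s \<inter> upper)"
    and bd: "\<And>x. x \<in> cball x0 s \<inter> half_plane \<Longrightarrow> x $ 2 = 0 \<or> dist x0 x = s \<Longrightarrow> norm (F (\<phi> x)) \<le> b"
    and "x \<in> ball x0 s \<inter> upper"
  shows "norm (F (\<phi> x)) \<le> b"
proof -
  define K where "K = cball x0 s \<inter> half_plane"
  define O' where "O' = ball x0 s \<inter> upper"
  have KO: "O' \<subseteq> K" "K \<subseteq> ball x0 r"
    using s upper_subset by (auto simp: K_def O'_def)
  have opO: "open O'" using open_upper by (auto simp: O'_def)
  have op: "open (\<phi> ` O')"
    using cont inj KO by (intro invariance_of_domain_gen opO) (auto intro: continuous_on_subset inj_on_subset)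
  have "compact K" unfolding K_def using closed_half_plane by (simp add: compact_Int_closed)
  then have com: "compact (\<phi> ` K)" using cont KO by (intro compact_continuous_image) (auto intro: continuous_on_subset)
  have cl: "closure (\<phi> ` O') \<subseteq> \<phi> ` K"
    using KO com by (intro closure_minimal image_mono compact_imp_closed)
  show ?thesis
  proof (rule maximum_modulus_frontier[of F "\<phi> ` O'"])
    show "F holomorphic_on interior (\<phi> ` O')" using op F(2) by (simp add: interior_open O'_def)
    show "continuous_on (closure (\<phi> ` O')) F" using F(1) cl unfolding K_def[symmetric] by (rule continuous_on_subset)
    show "bounded (\<phi> ` O')" using com KO by (meson bounded_subset compact_imp_bounded image_mono)
    show "\<phi> x \<in> \<phi> ` O'" using assms(7) by (auto simp: O'_def)
    fix z assume "z \<in> frontier (\<phi> ` O')"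
    then have z: "z \<in> closure (\<phi> ` O')" "z \<notin> \<phi> ` O'"
      using op by (auto simp: frontier_def interior_open)
    then obtain y where y: "y \<in> K" "z = \<phi> y" using cl by blast
    then have "y \<notin> O'" using z by auto
    then have "y $ 2 = 0 \<or> dist x0 y = s"
      using y(1) by (auto simp: K_def O'_def upper_def half_plane_def)
    then show "norm (F z) \<le> b" using bd[of y] y unfolding K_def by auto
  qed
qed

text \<open>The image of the half disc is almost a half plane near \<open>\<phi> x0\<close>, so a rotated square root does it.
  The factors \<open>exp (- k Q)\<close> absorb the uncontrolled part of the boundary of a half disc in the maximum principle.\<close>

lemma boundary_barrier:
  fixes \<phi> :: "real^2 \<Rightarrow> complex"
  assumes \<phi>: "C_inf_on \<phi> (ball x0 r)" "0 < r" and x0: "x0 $ 2 = 0" and inj: "inj (frechet_derivative \<phi> (at x0))"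
  obtains s Q where "0 < s" "s \<le> r" "continuous_on (\<phi> ` (ball x0 s \<inter> half_plane)) Q"
    "Q holomorphic_on \<phi> ` (ball x0 s \<inter> upper)" "Q (\<phi> x0) = 0"
    "\<And>x. x \<in> ball x0 s \<inter> half_plane \<Longrightarrow> x \<noteq> x0 \<Longrightarrow> 0 < Re (Q (\<phi> x))"
proof -
  define A where "A = frechet_derivative \<phi> (at x0)"
  have lin: "linear A" unfolding A_def
    using C_inf_on_has_derivative[OF \<phi>(1), of x0] \<phi>(2) has_derivative_linear by auto
  obtain m where m: "m > 0" "\<And>v. m * norm v \<le> norm (A v)"
    using linear_inj_bounded_below_pos[OF lin] inj unfolding A_def by blast
  define a where "a = A (axis 1 1)"
  define b where "b = A (axis 2 1)"
  have Av: "A v = v $ 1 *\<^sub>R a + v $ 2 *\<^sub>R b" for v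
    using arg_cong[OF vec_2_expand[of v], of A] by (simp add: linear_add[OF lin] linear_cmul[OF lin] a_def b_def)
  have a0: "a \<noteq> 0" using m(2)[of "axis 1 1"] m(1) by (auto simp: a_def)
  \<comment> \<open>Multiplication by \<kappa> puts the image of the edge direction on the imaginary
    axis and that of the inward direction into the closed right half plane, whichever orientation
    \<phi> has.\<close>
  define \<kappa> where "\<kappa> = (if Im (cnj a * b) \<le> 0 then \<i> * cnj a else - \<i> * cnj a)"
  have \<kappa>: "\<kappa> \<noteq> 0" "Re (\<kappa> * a) = 0" "Re (\<kappa> * b) \<ge> 0" using a0 by (auto simp: \<kappa>_def)
  have \<kappa>A: "Re (\<kappa> * A v) \<ge> 0" if "v $ 2 \<ge> 0" for v
  proof -
    have "Re (\<kappa> * A v) = v $ 1 * Re (\<kappa> * a) + v $ 2 * Re (\<kappa> * b)"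
      by (simp add: Av algebra_simps)
    then show ?thesis using \<kappa> that by simp
  qed
  \<comment> \<open>With error constant \<open>m / 3\<close> the distance
    \<open>norm (\<phi> x - \<phi> x0)\<close> is at least
    \<open>2 / 3 * (m * norm (x - x0))\<close>, so the error is at most half of it. Thus \<zeta>
    stays in a sector of half-angle 120 degrees, away from the cut of \<open>csqrt\<close>.\<close>
  obtain s where s: "0 < s" "s \<le> r" "\<And>x y. x \<in> ball x0 s \<Longrightarrow> y \<in> ball x0 s \<Longrightarrow>
    norm (\<phi> x - \<phi> y - A (x - y)) \<le> (m / 3) * norm (x - y)"
    unfolding A_def using strict_derivative[OF \<phi>, of "m / 3"] m(1) by auto
  define \<zeta> where "\<zeta> z = \<kappa> * (z - \<phi> x0)" for z
  define Q where "Q z = csqrt (\<zeta> z)" for z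
  have sec: "\<zeta> (\<phi> x) \<noteq> 0 \<and> Re (\<zeta> (\<phi> x)) \<ge> - (norm (\<zeta> (\<phi> x)) / 2)"
    if "x \<in> ball x0 s \<inter> half_plane" "x \<noteq> x0" for x
  proof -
    define e where "e = \<phi> x - \<phi> x0 - A (x - x0)"
    have e: "norm e \<le> m / 3 * norm (x - x0)" unfolding e_def using s that by (intro s(3)) auto
    have d: "\<phi> x - \<phi> x0 = A (x - x0) + e" by (simp add: e_def)
    have "m * norm (x - x0) \<le> norm (A (x - x0))" by (rule m(2))
    also have "\<dots> \<le> norm (\<phi> x - \<phi> x0) + norm e"
      using norm_triangle_ineq4[of "\<phi> x - \<phi> x0" e] by (simp add: e_def)
    finally have lower: "2 / 3 * (m * norm (x - x0)) \<le> norm (\<phi> x - \<phi> x0)" using e by simp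
    moreover have "norm (x - x0) > 0" using that by simp
    ultimately have nz: "\<phi> x - \<phi> x0 \<noteq> 0" using m(1) by (auto simp: mult_le_0_iff)
    have "Re (\<zeta> (\<phi> x)) = Re (\<kappa> * A (x - x0)) + Re (\<kappa> * e)" unfolding \<zeta>_def d by (simp add: algebra_simps)
    moreover have "Re (\<kappa> * A (x - x0)) \<ge> 0" using that x0 by (intro \<kappa>A) (auto simp: half_plane_def)
    moreover have "\<bar>Re (\<kappa> * e)\<bar> \<le> norm \<kappa> * norm e" using abs_Re_le_cmod[of "\<kappa> * e"] by (simp add: norm_mult)
    moreover have "norm \<kappa> * norm e \<le> norm \<kappa> * (norm (\<phi> x - \<phi> x0) / 2)"
      using e lower by (intro mult_left_mono) auto
    ultimately have "Re (\<zeta> (\<phi> x)) \<ge> - (norm (\<zeta> (\<phi> x)) / 2)" by (simp add: \<zeta>_def norm_mult)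
    then show ?thesis using nz \<kappa>(1) by (simp add: \<zeta>_def)
  qed
  have nonpos: "\<zeta> (\<phi> x) \<notin> \<real>\<^sub>\<le>\<^sub>0" if "x \<in> ball x0 s \<inter> half_plane" "x \<noteq> x0" for x
  proof
    assume "\<zeta> (\<phi> x) \<in> \<real>\<^sub>\<le>\<^sub>0"
    then have n: "Im (\<zeta> (\<phi> x)) = 0" "Re (\<zeta> (\<phi> x)) \<le> 0" by (auto simp: complex_nonpos_Reals_iff)
    then have "norm (\<zeta> (\<phi> x)) = - Re (\<zeta> (\<phi> x))" by (simp add: cmod_eq_Re)
    then show False using sec[OF that] n by (auto simp: complex_eq_iff)
  qed
  have contz: "isCont \<zeta> z" for z unfolding \<zeta>_def by (intro continuous_intros)
  show ?thesis
  proof (rule that[of s Q])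
    show "continuous_on (\<phi> ` (ball x0 s \<inter> half_plane)) Q"
    proof (rule continuous_at_imp_continuous_on, rule ballI)
      fix z assume "z \<in> \<phi> ` (ball x0 s \<inter> half_plane)"
      then obtain x where x: "x \<in> ball x0 s \<inter> half_plane" "z = \<phi> x" by blast
      show "isCont Q z"
      proof (cases "x = x0")
        case True
        \<comment> \<open>The origin lies on the cut, so continuity there comes from the modulus,
          which is the square root of \<open>norm (\<zeta> z)\<close>.\<close>
        have "isCont (\<lambda>z. sqrt (norm (\<zeta> z))) z" using contz by (intro continuous_intros)
        moreover have "\<zeta> z = 0" using True x by (simp add: \<zeta>_def)
        ultimately have "((\<lambda>z. norm (Q z)) \<longlongrightarrow> 0) (at z)"
          by (simp add: Q_def isCont_def)
        then have "(Q \<longlongrightarrow> 0) (at z)" by (rule tendsto_norm_zero_cancel)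
        then show ?thesis using \<open>\<zeta> z = 0\<close> by (simp add: isCont_def Q_def)
      next
        case False
        have "isCont (\<lambda>z. csqrt (\<zeta> z)) z"
          using contz nonpos[OF x(1) False] x(2) by (intro isCont_o2[OF _ continuous_at_csqrt]) auto
        then show ?thesis unfolding Q_def .
      qed
    qed
    show "Q holomorphic_on \<phi> ` (ball x0 s \<inter> upper)" unfolding Q_def
    proof (intro holomorphic_on_csqrt')
      show "\<zeta> holomorphic_on \<phi> ` (ball x0 s \<inter> upper)" unfolding \<zeta>_def by (intro holomorphic_intros)
      show "\<zeta> z \<notin> \<real>\<^sub>\<le>\<^sub>0" if "z \<in> \<phi> ` (ball x0 s \<inter> upper)" for z
      proof -
        obtain x where x: "x \<in> ball x0 s" "x \<in> upper" "z = \<phi> x" using \<open>z \<in> _\<close> by blast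
        moreover have "x \<noteq> x0" using x(2) x0 by (auto simp: upper_def)
        ultimately show ?thesis using nonpos[of x] subsetD[OF upper_subset x(2)] by auto
      qed
    qed
    show "Q (\<phi> x0) = 0" by (simp add: Q_def \<zeta>_def)
    show "0 < Re (Q (\<phi> x))" if "x \<in> ball x0 s \<inter> half_plane" "x \<noteq> x0" for x
    proof -
      have "norm (\<zeta> (\<phi> x)) + Re (\<zeta> (\<phi> x)) > 0" using sec[OF that] zero_less_norm_iff[of "\<zeta> (\<phi> x)"] by linarith
      then show ?thesis by (simp add: Q_def)
    qed
  qed (use s in auto)
qed

text \<open>Each of the four factors \<open>1 + e\<close> has its source: the assumed boundary
  estimate \<open>bd\<close>; moving the pole out of the domain (\<open>ext\<close>); and removing
  near \<open>x0\<close> the barrier of the first stage and that of the second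
  (\<open>small\<close>).\<close>

lemma boundary_derivative_bound:
  fixes \<phi> :: "real^2 \<Rightarrow> complex"
  assumes \<phi>: "C_inf_on \<phi> (ball x0 r)" "0 < r" and x0: "x0 $ 2 = 0"
    and inj: "inj_on \<phi> (ball x0 r)" "inj (frechet_derivative \<phi> (at x0))"
    and F: "continuous_on (\<phi> ` (ball x0 r \<inter> half_plane)) F" "F holomorphic_on \<phi> ` (ball x0 r \<inter> upper)"
    and bd: "\<exists>d>0. \<forall>x\<in>ball x0 d. \<forall>y\<in>ball x0 d. x $ 2 = 0 \<longrightarrow> y $ 2 = 0 \<longrightarrow>
      norm (F (\<phi> x) - F (\<phi> y)) \<le> (1 + e) * norm (\<phi> x - \<phi> y)"
    and e: "0 < e"
  obtains d where "0 < d" "d \<le> r" "\<And>x. x \<in> ball x0 d \<inter> upper \<Longrightarrow> norm (deriv F (\<phi> x)) \<le> (1 + e) ^ 4"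
proof -
  define A where "A = frechet_derivative \<phi> (at x0)"
  have lin: "linear A" unfolding A_def
    using C_inf_on_has_derivative[OF \<phi>(1), of x0] \<phi>(2) has_derivative_linear by auto
  obtain m where m: "m > 0" "\<And>v. m * norm v \<le> norm (A v)"
    using linear_inj_bounded_below_pos[OF lin] inj(2) unfolding A_def by blast
  define a where "a = A (axis 1 1)"
  define b where "b = A (axis 2 1)"
  have Av: "A v = v $ 1 *\<^sub>R a + v $ 2 *\<^sub>R b" for v
    using arg_cong[OF vec_2_expand[of v], of A] by (simp add: linear_add[OF lin] linear_cmul[OF lin] a_def b_def)
  have a0: "a \<noteq> 0" using m(2)[of "axis 1 1"] m(1) by (auto simp: a_def)
  \<comment> \<open>a direction pointing out of the half plane whose image is orthogonal to that of the boundary\<close>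
  define u :: "real^2" where "u = vector [(a \<bullet> b) / (a \<bullet> a), -1]"
  have u: "u $ 2 = -1" "a \<bullet> A u = 0" using a0 by (auto simp: u_def Av inner_diff_right)
  have u_nz: "norm u > 0" using u(1) by (metis norm_zero zero_index neg_0_equal_iff_equal zero_less_norm_iff zero_neq_one)
  \<comment> \<open>Pythagoras: moving \<open>y\<close> along \<open>u\<close> adds to the edge
    vector something orthogonal in the image, so the linearised distance cannot decrease.\<close>
  have perp: "norm (A (x - y)) \<le> norm (A (x - (y + t *\<^sub>R u)))" if "x $ 2 = 0" "y $ 2 = 0" for x y t
  proof -
    define l where "l = x $ 1 - y $ 1"
    have 1: "A (x - y) = l *\<^sub>R a" using that by (simp add: Av l_def)
    have 2: "A (x - (y + t *\<^sub>R u)) = l *\<^sub>R a - t *\<^sub>R A u"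
      unfolding 1[symmetric] linear_cmul[OF lin, symmetric] linear_diff[OF lin, symmetric] by (simp add: algebra_simps)
    have "0 \<le> t * t * (A u \<bullet> A u)" by simp
    then have "(norm (l *\<^sub>R a))\<^sup>2 \<le> (norm (l *\<^sub>R a - t *\<^sub>R A u))\<^sup>2"
      unfolding power2_norm_eq_inner using u(2) by (simp add: inner_diff inner_commute mult.assoc)
    then show ?thesis unfolding 1 2 by (rule power2_le_imp_le) simp
  qed
  \<comment> \<open>\<open>m / 2\<close> serves the lower bound \<open>low\<close>;
    \<open>e * m / (2 + e)\<close> is the solution of
    \<open>m + \<eta> = (1 + e) * (m - \<eta>)\<close>, which is what \<open>ext\<close>
    needs.\<close>
  define \<eta> where "\<eta> = min (m / 2) (e * m / (2 + e))"
  have \<eta>: "0 < \<eta>" using m(1) e by (simp add: \<eta>_def)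
  have \<eta>m: "\<eta> \<le> m / 2" unfolding \<eta>_def by (rule min.cobounded1)
  have "\<eta> \<le> e * m / (2 + e)" by (simp add: \<eta>_def)
  then have \<eta>e: "m + \<eta> \<le> (1 + e) * (m - \<eta>)" using e by (simp add: field_simps)
  obtain s1 where s1: "0 < s1" "s1 \<le> r" "\<And>x y. x \<in> ball x0 s1 \<Longrightarrow> y \<in> ball x0 s1 \<Longrightarrow>
      norm (\<phi> x - \<phi> y - A (x - y)) \<le> \<eta> * norm (x - y)"
    using strict_derivative[OF \<phi> \<eta>] unfolding A_def by blast
  obtain s2 Q where s2: "0 < s2" "s2 \<le> r" and Q: "continuous_on (\<phi> ` (ball x0 s2 \<inter> half_plane)) Q"
    "Q holomorphic_on \<phi> ` (ball x0 s2 \<inter> upper)" "Q (\<phi> x0) = 0"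
    "\<And>x. x \<in> ball x0 s2 \<inter> half_plane \<Longrightarrow> x \<noteq> x0 \<Longrightarrow> 0 < Re (Q (\<phi> x))"
    using boundary_barrier[OF \<phi> x0 inj(2)] by blast
  obtain s3 where s3: "s3 > 0" "\<And>x y. x \<in> ball x0 s3 \<Longrightarrow> y \<in> ball x0 s3 \<Longrightarrow> x $ 2 = 0 \<Longrightarrow> y $ 2 = 0 \<Longrightarrow>
      norm (F (\<phi> x) - F (\<phi> y)) \<le> (1 + e) * norm (\<phi> x - \<phi> y)"
    using bd by blast
  define s where "s = min s1 (min s2 s3) / 2"
  have s: "0 < s" "s < r" using s1 s2 s3 by (auto simp: s_def)
  define K where "K = cball x0 s \<inter> half_plane"
  define U where "U = ball x0 s \<inter> upper"
  have KB: "K \<subseteq> ball x0 s1" "K \<subseteq> ball x0 s2 \<inter> half_plane" "K \<subseteq> ball x0 s3" "K \<subseteq> ball x0 r \<inter> half_plane"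
    using s1 s2 s3 s by (auto simp: K_def s_def)
  have UB: "U \<subseteq> K" "U \<subseteq> ball x0 s2 \<inter> upper" "U \<subseteq> ball x0 r \<inter> upper"
    using s1 s2 s3 s upper_subset by (auto simp: K_def U_def s_def)
  have x0K: "x0 \<in> K" using x0 s by (simp add: K_def half_plane_def)
  have cont\<phi>: "continuous_on (ball x0 r) \<phi>" using C_inf_on_continuous[OF \<phi>(1)] .
  have Ks1: "cball x0 s \<subseteq> ball x0 s1" using s1 s2 s3 by (auto simp: s_def)
  have low: "m / 2 * norm (x - y) \<le> norm (\<phi> x - \<phi> y)" if "x \<in> ball x0 s1" "y \<in> ball x0 s1" for x y
  proof -
    have "m * norm (x - y) \<le> norm (A (x - y))" by (rule m(2))
    also have "\<dots> \<le> norm (\<phi> x - \<phi> y) + norm (\<phi> x - \<phi> y - A (x - y))"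
      using norm_triangle_ineq4[of "\<phi> x - \<phi> y" "\<phi> x - \<phi> y - A (x - y)"] by simp
    also have "\<dots> \<le> norm (\<phi> x - \<phi> y) + m / 2 * norm (x - y)"
      using s1(3)[OF that] mult_right_mono[OF \<eta>m, of "norm (x - y)"] by simp
    finally show ?thesis by simp
  qed
  \<comment> \<open>Putting the pole at \<open>\<phi> (y + t *\<^sub>R u)\<close> instead of
    \<open>\<phi> y\<close> enlarges the quotient at edge points by at most \<open>1 + e\<close>:
    this is \<open>perp\<close> up to the error of linearisation.\<close>
  have ext: "norm (\<phi> x - \<phi> y) \<le> (1 + e) * norm (\<phi> x - \<phi> (y + t *\<^sub>R u))"
    if "x \<in> ball x0 s1" "y \<in> ball x0 s1" "y + t *\<^sub>R u \<in> ball x0 s1" "x $ 2 = 0" "y $ 2 = 0" for x y t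
  proof -
    define w where "w = y + t *\<^sub>R u"
    have lower: "(m - \<eta>) * norm (A (x - w)) \<le> m * norm (\<phi> x - \<phi> w)"
    proof -
      have "norm (A (x - w)) \<le> norm (\<phi> x - \<phi> w) + norm (\<phi> x - \<phi> w - A (x - w))"
        using norm_triangle_ineq4[of "\<phi> x - \<phi> w" "\<phi> x - \<phi> w - A (x - w)"] by simp
      then have "m * norm (A (x - w)) \<le> m * norm (\<phi> x - \<phi> w) + \<eta> * (m * norm (x - w))"
        using s1(3)[OF that(1,3)] m(1) unfolding w_def by (smt (verit) mult.left_commute mult_left_mono distrib_left)
      also have "\<dots> \<le> m * norm (\<phi> x - \<phi> w) + \<eta> * norm (A (x - w))"
        using mult_left_mono[OF m(2)[of "x - w"], of \<eta>] \<eta> by simp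
      finally show ?thesis by (simp add: algebra_simps)
    qed
    have "norm (\<phi> x - \<phi> y) \<le> norm (A (x - y)) + norm (\<phi> x - \<phi> y - A (x - y))"
      using norm_triangle_ineq[of "A (x - y)" "\<phi> x - \<phi> y - A (x - y)"] by simp
    then have "m * norm (\<phi> x - \<phi> y) \<le> m * norm (A (x - y)) + \<eta> * (m * norm (x - y))"
      using s1(3)[OF that(1,2)] m(1) by (smt (verit) mult.left_commute mult_left_mono distrib_left)
    also have "\<dots> \<le> (m + \<eta>) * norm (A (x - y))"
      using mult_left_mono[OF m(2)[of "x - y"], of \<eta>] \<eta> by (simp add: algebra_simps)
    also have "\<dots> \<le> (m + \<eta>) * norm (A (x - w))"
      using perp[OF that(4,5), of t] m(1) \<eta> unfolding w_def by (intro mult_left_mono) auto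
    also have "\<dots> \<le> (1 + e) * ((m - \<eta>) * norm (A (x - w)))"
      using mult_right_mono[OF \<eta>e, of "norm (A (x - w))"] by (simp add: mult.assoc)
    also have "\<dots> \<le> (1 + e) * (m * norm (\<phi> x - \<phi> w))"
      using lower e by (intro mult_left_mono) auto
    finally have "m * norm (\<phi> x - \<phi> y) \<le> m * ((1 + e) * norm (\<phi> x - \<phi> w))"
      using e by (simp add: algebra_simps)
    then show ?thesis using m(1) unfolding w_def by simp
  qed
  have comK: "compact K" unfolding K_def using closed_half_plane by (simp add: compact_Int_closed)
  \<comment> \<open>A crude bound for the numerators, the only information available on the
    arcs.\<close>
  obtain C where C: "C > 0" "\<And>x y. x \<in> K \<Longrightarrow> y \<in> K \<Longrightarrow> norm (F (\<phi> x) - F (\<phi> y)) \<le> C"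
  proof -
    have "continuous_on K (\<lambda>x. F (\<phi> x))"
      by (rule continuous_on_compose2[OF F(1)]) (use KB(4) cont\<phi> in \<open>auto intro: continuous_on_subset\<close>)
    then have "bounded ((\<lambda>x. F (\<phi> x)) ` K)" by (intro compact_imp_bounded compact_continuous_image comK)
    then obtain C' where C': "C' > 0" "\<And>x. x \<in> K \<Longrightarrow> norm (F (\<phi> x)) \<le> C'" by (auto simp: bounded_pos)
    show ?thesis
    proof (rule that[of "2 * C'"])
      show "norm (F (\<phi> x) - F (\<phi> y)) \<le> 2 * C'" if "x \<in> K" "y \<in> K" for x y
        using norm_triangle_ineq4[of "F (\<phi> x)" "F (\<phi> y)"] C'(2)[OF that(1)] C'(2)[OF that(2)] by linarith
    qed (use C' in simp)
  qed
  have mulle: "a * b \<le> B" if "a \<le> B" "b \<le> 1" "0 \<le> a" for a b B :: real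
    using mult_left_le[OF that(2,3)] that(1) by linarith
  define q where "q x = Re (Q (\<phi> x))" for x
  have contq: "continuous_on K q" unfolding q_def
    by (intro continuous_intros continuous_on_compose2[OF Q(1)])
      (use KB(2,4) cont\<phi> in \<open>auto intro: continuous_on_subset\<close>)
  have q0: "q x \<ge> 0" if "x \<in> K" for x
    using Q(3) Q(4)[OF subsetD[OF KB(2) that]] unfolding q_def by (cases "x = x0") (auto intro: less_imp_le)
  \<comment> \<open>On an arc away from \<open>x0\<close> the function \<open>q\<close> has a
    positive minimum \<open>l\<close>. With \<open>k = c / l\<close> the barrier beats the constant
    \<open>c\<close>, since \<open>exp\<close> exceeds its argument.\<close>
  have barr: "\<exists>k\<ge>0. \<forall>x\<in>half_plane. dist x0 x = \<rho> \<longrightarrow> c * exp (- k * q x) \<le> 1"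
    if "0 < \<rho>" "\<rho> \<le> s" "0 < c" for \<rho> c
  proof -
    define T where "T = sphere x0 \<rho> \<inter> half_plane"
    have T: "compact T" "T \<subseteq> K" using closed_half_plane that by (auto simp: T_def K_def compact_Int_closed)
    obtain l where l: "l > 0" "\<And>x. x \<in> T \<Longrightarrow> l \<le> q x"
    proof (cases "T = {}")
      case False
      then obtain y where y: "y \<in> T" "\<And>x. x \<in> T \<Longrightarrow> q y \<le> q x"
        using continuous_attains_inf[OF T(1)] continuous_on_subset[OF contq T(2)] by blast
      have "y \<noteq> x0" using y(1) \<open>0 < \<rho>\<close> by (auto simp: T_def)
      then have "q y > 0" unfolding q_def using Q(4) y(1) T(2) KB(2) by blast
      then show ?thesis using that y(2) by blast
    next
      case True
      then show ?thesis using that[of 1] by simp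
    qed
    have "c * exp (- (c / l) * q x) \<le> 1" if "x \<in> T" for x
    proof -
      have "c \<le> c / l * q x" using l(1) l(2)[OF that] \<open>0 < c\<close> by (simp add: field_simps)
      also have "\<dots> \<le> exp (c / l * q x)" by (rule order_trans[OF _ exp_ge_add_one_self]) simp
      finally show ?thesis by (simp add: exp_minus field_simps)
    qed
    then show ?thesis using l(1) \<open>0 < c\<close> by (intro exI[of _ "c / l"]) (auto simp: T_def)
  qed
  define Ex where "Ex k z = exp (- of_real k * Q z)" for k :: real and z
  have nEx: "norm (Ex k (\<phi> x)) = exp (- k * q x)" for k x by (simp add: Ex_def q_def)
  have Ex1: "norm (Ex k (\<phi> x)) \<le> 1" if "x \<in> K" "k \<ge> 0" for k x
    using q0[OF that(1)] that(2) by (simp add: nEx)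
  have contEx: "continuous_on (\<phi> ` K) (Ex k)" for k unfolding Ex_def
    using continuous_on_subset[OF Q(1) image_mono[OF KB(2)]] by (intro continuous_intros)
  have holEx: "Ex k holomorphic_on \<phi> ` U" for k unfolding Ex_def
    using holomorphic_on_subset[OF Q(2) image_mono[OF UB(2)]] by (intro holomorphic_intros)
  have contF: "continuous_on (\<phi> ` K) F" using F(1) KB(4) by (meson continuous_on_subset image_mono)
  have holF: "F holomorphic_on \<phi> ` U" using F(2) UB(3) by (meson holomorphic_on_subset image_mono)

  \<comment> \<open>On the arc of radius \<open>s\<close> the pole is at distance at least
    \<open>s / 2\<close> in the chart, hence at least \<open>m * s / 4\<close> in the image by
    \<open>low\<close>.\<close>
  obtain k1 where k1: "k1 \<ge> 0" "\<And>x. x \<in> half_plane \<Longrightarrow> dist x0 x = s \<Longrightarrow> C / (m * s / 4) * exp (- k1 * q x) \<le> 1"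
    using barr[of s "C / (m * s / 4)"] s C(1) m(1) by auto
  \<comment> \<open>First stage: \<open>y\<close> on the edge and \<open>x\<close> inside. The
    barrier factor stays in the estimate, because it can be removed only close to
    \<open>x0\<close>.\<close>
  have claim: "norm (F (\<phi> x) - F (\<phi> y)) * exp (- k1 * q x) \<le> (1 + e)\<^sup>2 * norm (\<phi> x - \<phi> y)"
    if "y \<in> ball x0 (s / 4)" "y $ 2 = 0" "x \<in> U" for x y
  proof -
    have yK: "y \<in> K" using that(1,2) s by (auto simp: K_def half_plane_def)
    have *: "norm (F (\<phi> x) - F (\<phi> y)) * exp (- k1 * q x) \<le> (1 + e)\<^sup>2 * norm (\<phi> x - \<phi> (y + t *\<^sub>R u))"
      if t: "0 < t" "t * norm u \<le> s / 4" for t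
    proof -
      define w where "w = y + t *\<^sub>R u"
      have "dist x0 w \<le> dist x0 y + t * norm u"
        using norm_triangle_ineq4[of "x0 - y" "t *\<^sub>R u"] t(1) by (simp add: w_def dist_norm algebra_simps)
      then have dw: "dist x0 w < s / 2" using t(2) \<open>y \<in> ball x0 (s / 4)\<close> by simp
      then have wB: "w \<in> ball x0 s1" "w \<in> ball x0 r" using s(1) Ks1 s(2) by (auto simp: subset_iff)
      have "w \<notin> half_plane" using \<open>y $ 2 = 0\<close> u(1) t(1) by (simp add: w_def half_plane_def)
      then have zw: "\<phi> x' \<noteq> \<phi> w" if "x' \<in> K" for x'
        using inj_onD[OF inj(1), of x' w] KB(4) that wB by blast
      define h where "h z = (F z - F (\<phi> y)) / (z - \<phi> w) * Ex k1 z" for z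
      have "norm (h (\<phi> x)) \<le> (1 + e)\<^sup>2"
      proof (rule half_disc_maximum[OF cont\<phi> inj(1) s(2)])
        show "x \<in> ball x0 s \<inter> upper" using \<open>x \<in> U\<close> by (simp add: U_def)
        show "continuous_on (\<phi> ` (cball x0 s \<inter> half_plane)) h"
          unfolding h_def K_def[symmetric] by (intro continuous_intros contF contEx) (use zw in auto)
        show "h holomorphic_on \<phi> ` (ball x0 s \<inter> upper)"
          unfolding h_def U_def[symmetric] by (intro holomorphic_intros holF holEx) (use zw UB(1) in auto)
        fix x' assume x': "x' \<in> cball x0 s \<inter> half_plane" "x' $ 2 = 0 \<or> dist x0 x' = s"
        then have x'K: "x' \<in> K" by (simp add: K_def)
        have x's: "x' \<in> ball x0 s1" using x'K KB(1) by blast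
        have nz: "norm (\<phi> x' - \<phi> w) > 0" using zw[OF x'K] by simp
        show "norm (h (\<phi> x')) \<le> (1 + e)\<^sup>2"
        proof (cases "x' $ 2 = 0")
          case True
          have "norm (F (\<phi> x') - F (\<phi> y)) \<le> (1 + e) * norm (\<phi> x' - \<phi> y)"
            using x'K yK KB(3) True \<open>y $ 2 = 0\<close> by (intro s3) auto
          also have "\<dots> \<le> (1 + e) * ((1 + e) * norm (\<phi> x' - \<phi> w))"
            using ext[OF x's _ _ True \<open>y $ 2 = 0\<close>, of t] yK KB(1) wB(1) e unfolding w_def
            by (intro mult_left_mono) auto
          finally have "norm ((F (\<phi> x') - F (\<phi> y)) / (\<phi> x' - \<phi> w)) \<le> (1 + e)\<^sup>2"
            using nz by (simp add: norm_divide divide_le_eq power2_eq_square algebra_simps)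
          then show ?thesis unfolding h_def norm_mult
            by (rule mulle[OF _ Ex1[OF x'K k1(1)] norm_ge_zero])
        next
          case False
          then have ds: "dist x0 x' = s" using x' by blast
          have "s / 2 \<le> norm (x' - w)"
            using dist_triangle[of x0 x' w] ds dw by (simp add: dist_norm norm_minus_commute)
          then have "m / 2 * (s / 2) \<le> m / 2 * norm (x' - w)" using m(1) by (intro mult_left_mono) auto
          then have l: "m * s / 4 \<le> norm (\<phi> x' - \<phi> w)" using low[OF x's wB(1)] by simp
          have "norm ((F (\<phi> x') - F (\<phi> y)) / (\<phi> x' - \<phi> w)) \<le> C / (m * s / 4)"
            unfolding norm_divide using C l m(1) s(1) x'K yK by (intro frac_le) auto
          then have "norm (h (\<phi> x')) \<le> C / (m * s / 4) * exp (- k1 * q x')"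
            unfolding h_def norm_mult nEx by (intro mult_right_mono) auto
          also have "\<dots> \<le> 1" using x'(1) ds by (intro k1(2)) auto
          also have "1 \<le> (1 + e)\<^sup>2" using e by simp
          finally show ?thesis .
        qed
      qed
      moreover have "norm (\<phi> x - \<phi> w) > 0" using zw[of x] \<open>x \<in> U\<close> UB(1) by auto
      moreover have "a / c * k \<le> b \<Longrightarrow> 0 < c \<Longrightarrow> a * k \<le> b * c" for a b c k :: real
        by (simp add: divide_le_eq)
      ultimately show ?thesis unfolding h_def norm_mult norm_divide nEx w_def[symmetric] by blast
    qed
    \<comment> \<open>Shifts of length at most \<open>s / 4\<close> keep the pole within
      \<open>s / 2\<close> of \<open>x0\<close>.\<close>
    define c where "c = s / 4 / norm u"
    define t where "t n = c * inverse (real (Suc n))" for n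
    have c: "0 < c" "c * norm u = s / 4" using s(1) u_nz by (auto simp: c_def)
    have t: "0 < t n" "t n * norm u \<le> s / 4" for n
    proof -
      show "0 < t n" using c by (simp add: t_def)
      have "inverse (real (Suc n)) \<le> 1" by (simp add: inverse_le_1_iff)
      then have "t n \<le> c" using c(1) unfolding t_def by (intro mult_left_le) auto
      then show "t n * norm u \<le> s / 4" unfolding c(2)[symmetric] by (rule mult_right_mono) simp
    qed
    have "t \<longlonglongrightarrow> 0"
      unfolding t_def[abs_def] by (rule tendsto_mult_right_zero[OF LIMSEQ_inverse_real_of_nat])
    then have "(\<lambda>n. y + t n *\<^sub>R u) \<longlonglongrightarrow> y + 0 *\<^sub>R u" by (intro tendsto_intros)
    moreover have "isCont \<phi> y" using cont\<phi> yK KB(4) by (auto simp: continuous_on_eq_continuous_at)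
    ultimately have "(\<lambda>n. \<phi> (y + t n *\<^sub>R u)) \<longlonglongrightarrow> \<phi> y" using isCont_tendsto_compose by fastforce
    then have "(\<lambda>n. (1 + e)\<^sup>2 * norm (\<phi> x - \<phi> (y + t n *\<^sub>R u))) \<longlonglongrightarrow> (1 + e)\<^sup>2 * norm (\<phi> x - \<phi> y)"
      by (intro tendsto_intros)
    then show ?thesis by (rule LIMSEQ_le_const) (use *[OF t] in blast)
  qed

  \<comment> \<open>Second stage, on the half disc of radius \<open>s / 8\<close>, whose edge points
    are covered by \<open>claim\<close>. With \<open>y\<close> within \<open>s / 16\<close> of
    \<open>x0\<close>, the arc is at distance at least \<open>s / 16\<close> from \<open>y\<close>,
    which gives \<open>m * s / 32\<close>.\<close>
  obtain k2 where k2: "k2 \<ge> 0" "\<And>x. x \<in> half_plane \<Longrightarrow> dist x0 x = s / 8 \<Longrightarrow> C / (m * s / 32) * exp (- k2 * q x) \<le> 1"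
    using barr[of "s / 8" "C / (m * s / 32)"] s C(1) m(1) by auto
  have "q x0 = 0" using Q(3) by (simp add: q_def)
  moreover have "0 < ln (1 + e) / (k1 + k2 + 1)" using e k1(1) k2(1) by simp
  then obtain d where d: "d > 0" "\<And>x. x \<in> K \<Longrightarrow> dist x x0 < d \<Longrightarrow> dist (q x) (q x0) < ln (1 + e) / (k1 + k2 + 1)"
    using contq[unfolded continuous_on_iff, rule_format, OF x0K] by metis
  ultimately have d: "d > 0" "\<And>x. x \<in> K \<Longrightarrow> dist x x0 < d \<Longrightarrow> q x < ln (1 + e) / (k1 + k2 + 1)"
    by (auto simp: dist_real_def abs_less_iff)
  \<comment> \<open>As \<open>q\<close> is continuous and vanishes at \<open>x0\<close>, dividing
    the barrier out again costs at most \<open>1 + e\<close> near \<open>x0\<close>; the bound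
    \<open>k1 + k2\<close> covers both barriers at once.\<close>
  have small: "exp (k * q x) \<le> 1 + e" if "x \<in> K" "dist x x0 < d" "0 \<le> k" "k \<le> k1 + k2" for x k
  proof -
    have "k * q x \<le> (k1 + k2 + 1) * (ln (1 + e) / (k1 + k2 + 1))"
      using d(2)[OF that(1,2)] that(3,4) q0[OF that(1)] by (intro mult_mono) auto
    also have "\<dots> = ln (1 + e)" using k1(1) k2(1) by simp
    finally show ?thesis using e by (metis exp_le_cancel_iff exp_ln add_pos_pos zero_less_one)
  qed
  show ?thesis
  proof (rule that[of "min d (s / 16)"])
    show "0 < min d (s / 16)" "min d (s / 16) \<le> r" using d s by auto
    fix y assume y: "y \<in> ball x0 (min d (s / 16)) \<inter> upper"
    have yU: "y \<in> U" using y s by (auto simp: U_def)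
    have yK: "y \<in> K" using yU UB(1) by blast
    define s' where "s' = s / 8"
    define K' where "K' = cball x0 s' \<inter> half_plane"
    define U' where "U' = ball x0 s' \<inter> upper"
    have KU': "K' \<subseteq> K" "U' \<subseteq> U" "U' \<subseteq> K'" "y \<in> U'" "s' < r"
      using s y upper_subset by (auto simp: K'_def U'_def K_def U_def s'_def)
    define w where "w = \<phi> y"
    \<comment> \<open>Now the pole is an interior point of the domain and removable; the value
      filled in is the derivative that is to be estimated.\<close>
    define H where "H z = (if z = w then deriv F w else (F z - F w) / (z - w))" for z
    define h where "h z = H z * Ex k2 z" for z
    have opU: "open (\<phi> ` U')"
    proof (rule invariance_of_domain_gen)
      show "open U'" using open_upper by (auto simp: U'_def)
      have "U' \<subseteq> ball x0 r" using KU' KB(4) by blast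
      then show "continuous_on U' \<phi>" "inj_on \<phi> U'" using cont\<phi> inj(1) by (auto intro: continuous_on_subset inj_on_subset)
    qed simp
    have wU: "w \<in> \<phi> ` U'" using KU'(4) by (simp add: w_def)
    have holH: "H holomorphic_on \<phi> ` U'" unfolding H_def
      using pole_lemma[of F "\<phi> ` U'" w] holomorphic_on_subset[OF holF image_mono[OF KU'(2)]] wU opU
      by (simp add: interior_open)
    have contF': "continuous_on (\<phi> ` K') F" using contF KU'(1) by (meson continuous_on_subset image_mono)
    have contH: "continuous_on (\<phi> ` K') H"
      unfolding continuous_on_eq_continuous_within
    proof
      fix z assume z: "z \<in> \<phi> ` K'"
      show "continuous (at z within \<phi> ` K') H"
      proof (cases "z = w")
        case True
        have "isCont H w"
          using continuous_on_interior[OF holomorphic_on_imp_continuous_on[OF holH], of w] opU wU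
          by (simp add: interior_open)
        then show ?thesis using True by (simp add: continuous_at_imp_continuous_at_within)
      next
        case False
        have "continuous (at z within \<phi> ` K') (\<lambda>z. (F z - F w) / (z - w))"
          using contF' z False by (intro continuous_intros) (auto simp: continuous_on_eq_continuous_within)
        then show ?thesis
        proof (rule continuous_transform_within[where \<delta> = "dist z w"])
          show "(F z' - F w) / (z' - w) = H z'" if "dist z' z < dist z w" for z'
            using that by (auto simp: H_def dist_commute)
        qed (use z False in auto)
      qed
    qed
    have "norm (h (\<phi> y)) \<le> (1 + e) ^ 3"
    proof (rule half_disc_maximum[OF cont\<phi> inj(1) KU'(5)])
      show "y \<in> ball x0 s' \<inter> upper" using KU'(4) by (simp add: U'_def)
      show "continuous_on (\<phi> ` (cball x0 s' \<inter> half_plane)) h"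
        unfolding h_def K'_def[symmetric]
        by (intro continuous_intros contH continuous_on_subset[OF contEx image_mono[OF KU'(1)]])
      show "h holomorphic_on \<phi> ` (ball x0 s' \<inter> upper)"
        unfolding h_def U'_def[symmetric]
        by (intro holomorphic_intros holH holomorphic_on_subset[OF holEx image_mono[OF KU'(2)]])
      fix x assume x: "x \<in> cball x0 s' \<inter> half_plane" "x $ 2 = 0 \<or> dist x0 x = s'"
      have xK: "x \<in> K" using x(1) KU'(1) by (auto simp: K'_def)
      have "x \<noteq> y"
        using x(2) y by (auto simp: upper_def s'_def)
      moreover have "x \<in> ball x0 r" "y \<in> ball x0 r" using xK yK KB(4) by blast+
      ultimately have zw: "\<phi> x \<noteq> w" using inj_onD[OF inj(1), of x y] unfolding w_def by blast
      then have Hx: "H (\<phi> x) = (F (\<phi> x) - F w) / (\<phi> x - w)" and nz: "norm (\<phi> x - w) > 0" by (auto simp: H_def)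
      show "norm (h (\<phi> x)) \<le> (1 + e) ^ 3"
      proof (cases "x $ 2 = 0")
        case True
        \<comment> \<open>\<open>claim\<close> with exchanged roles: \<open>x\<close> is the edge
          point here and \<open>y\<close> the interior one.\<close>
        have "norm (F (\<phi> y) - F (\<phi> x)) * exp (- k1 * q y) \<le> (1 + e)\<^sup>2 * norm (\<phi> y - \<phi> x)"
          using x(1) s True yU by (intro claim) (auto simp: s'_def)
        then have "norm (F (\<phi> x) - F w) \<le> (1 + e)\<^sup>2 * norm (\<phi> x - w) * exp (k1 * q y)"
          by (simp add: w_def norm_minus_commute exp_minus field_simps)
        also have "\<dots> \<le> (1 + e)\<^sup>2 * norm (\<phi> x - w) * (1 + e)"
          using y e k2(1) k1(1) by (intro mult_left_mono small yK) (auto simp: dist_commute)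
        finally have "norm (H (\<phi> x)) \<le> (1 + e) ^ 3" unfolding Hx norm_divide
          using nz by (simp add: divide_le_eq power2_eq_square power3_eq_cube algebra_simps)
        then show ?thesis unfolding h_def norm_mult
          by (rule mulle[OF _ Ex1[OF xK k2(1)] norm_ge_zero])
      next
        case False
        then have ds: "dist x0 x = s'" using x by blast
        have "s / 16 \<le> norm (x - y)"
          using dist_triangle[of x0 x y] ds y by (simp add: dist_norm norm_minus_commute s'_def)
        then have "m / 2 * (s / 16) \<le> m / 2 * norm (x - y)" using m(1) by (intro mult_left_mono) auto
        then have l: "m * s / 32 \<le> norm (\<phi> x - w)" using low[OF subsetD[OF KB(1) xK] subsetD[OF KB(1) yK]] by (simp add: w_def)
        have "norm (H (\<phi> x)) \<le> C / (m * s / 32)"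
          unfolding Hx norm_divide using C l m(1) s(1) xK yK by (intro frac_le) (auto simp: w_def)
        then have "norm (h (\<phi> x)) \<le> C / (m * s / 32) * exp (- k2 * q x)"
          unfolding h_def norm_mult nEx by (intro mult_right_mono) auto
        also have "\<dots> \<le> 1" using x(1) ds by (intro k2(2)) (auto simp: s'_def)
        also have "1 \<le> (1 + e) ^ 3" using e by simp
        finally show ?thesis .
      qed
    qed
    moreover have "h (\<phi> y) = deriv F w * Ex k2 (\<phi> y)" by (simp add: h_def H_def w_def)
    ultimately have "norm (deriv F w) \<le> (1 + e) ^ 3 * exp (k2 * q y)"
      by (simp add: norm_mult nEx exp_minus field_simps)
    also have "\<dots> \<le> (1 + e) ^ 3 * (1 + e)"
      using y e k2(1) k1(1) by (intro mult_left_mono small yK) (auto simp: dist_commute)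
    finally show "norm (deriv F (\<phi> y)) \<le> (1 + e) ^ 4" by (simp add: w_def power_def algebra_simps eval_nat_numeral)
  qed
qed

section \<open>Charts and conformal maps in flat coordinates\<close>

lemma flat_coord_mono:
  assumes "flat_coord h x0 r \<phi>" "0 < r'" "r' \<le> r"
  shows "flat_coord h x0 r' \<phi>"
proof -
  note f = assms(1)[unfolded flat_coord_def]
  have sub: "ball x0 r' \<subseteq> ball x0 r" using assms by auto
  have inj: "inj_on \<phi> (ball x0 r)" using f by blast
  have op: "open (\<phi> ` ball x0 r')"
  proof (rule invariance_of_domain_gen)
    have "continuous_on (ball x0 r) \<phi>" using f by (intro C_inf_on_continuous) blast
    then show "continuous_on (ball x0 r') \<phi>" using sub by (rule continuous_on_subset)
    show "inj_on \<phi> (ball x0 r')" using inj sub by (rule inj_on_subset)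
  qed auto
  have "C_k_on k (inv_into (ball x0 r') \<phi>) (\<phi> ` ball x0 r')" for k
  proof (rule C_k_on_cong[OF op])
    show "C_k_on k (inv_into (ball x0 r) \<phi>) (\<phi> ` ball x0 r')"
      using f C_k_on_subset[OF _ image_mono[OF sub]] by blast
    fix z assume "z \<in> \<phi> ` ball x0 r'"
    then obtain x where x: "x \<in> ball x0 r'" "z = \<phi> x" by blast
    then show "inv_into (ball x0 r) \<phi> z = inv_into (ball x0 r') \<phi> z"
      using inv_into_f_f[OF inj, of x] inv_into_f_f[OF inj_on_subset[OF inj sub] x(1)] sub by auto
  qed
  moreover have "C_inf_on \<phi> (ball x0 r')" using f C_k_on_subset[OF _ sub] by blast
  ultimately show ?thesis
    using f op sub inj_on_subset[OF inj sub] assms(2) unfolding flat_coord_def by (auto simp del: mem_ball)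
qed

lemma flat_coord_cnj:
  assumes "flat_coord h x0 r \<phi>"
  shows "flat_coord h x0 r (\<lambda>x. cnj (\<phi> x))"
proof -
  note f = assms[unfolded flat_coord_def]
  let ?B = "ball x0 r"
  have sm: "C_inf_on (\<lambda>x. cnj (\<phi> x)) ?B"
    using f C_k_on_linear_comp[OF bounded_linear_cnj open_ball, of _ \<phi>] by blast
  have inj: "inj_on \<phi> ?B" using f by blast
  have inj': "inj_on (\<lambda>x. cnj (\<phi> x)) ?B" using inj by (auto simp: inj_on_def)
  have im: "(\<lambda>x. cnj (\<phi> x)) ` ?B = cnj -` (\<phi> ` ?B)"
    by (auto simp: image_iff) (metis complex_cnj_cnj mem_ball)
  have op: "open ((\<lambda>x. cnj (\<phi> x)) ` ?B)"
    unfolding im using f by (intro continuous_open_vimage) (auto intro!: continuous_intros)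
  have D: "frechet_derivative (\<lambda>x. cnj (\<phi> x)) (at x) v = cnj (frechet_derivative \<phi> (at x) v)" if "x \<in> ?B" for x v
  proof -
    have "(\<phi> has_derivative frechet_derivative \<phi> (at x)) (at x)"
      using f that by (intro C_inf_on_has_derivative[of \<phi> ?B]) auto
    from bounded_linear.has_derivative[OF bounded_linear_cnj this] frechet_derivative_at show ?thesis by metis
  qed
  have "C_k_on k (inv_into ?B (\<lambda>x. cnj (\<phi> x))) ((\<lambda>x. cnj (\<phi> x)) ` ?B)" for k
  proof (rule C_k_on_cong[OF op])
    show "C_k_on k (\<lambda>z. inv_into ?B \<phi> (cnj z)) ((\<lambda>x. cnj (\<phi> x)) ` ?B)"
      by (rule C_k_on_compose[OF op _ _ C_k_on_bounded_linear[OF bounded_linear_cnj op], of "\<phi> ` ?B"])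
        (use f in auto)
    fix z assume "z \<in> (\<lambda>x. cnj (\<phi> x)) ` ?B"
    then obtain x where x: "x \<in> ?B" "z = cnj (\<phi> x)" by blast
    then show "inv_into ?B \<phi> (cnj z) = inv_into ?B (\<lambda>x. cnj (\<phi> x)) z"
      using inv_into_f_f[OF inj x(1)] inv_into_f_f[OF inj' x(1)] by simp
  qed
  moreover have "inj (frechet_derivative (\<lambda>x. cnj (\<phi> x)) (at x))" if "x \<in> ?B" for x
  proof -
    have "inj (frechet_derivative \<phi> (at x))" using f that by blast
    then show ?thesis by (auto simp: inj_def D[OF that])
  qed
  ultimately show ?thesis
    using f sm inj' op D unfolding flat_coord_def by (auto simp del: mem_ball)
qed

text \<open>A conformal linear map of \<open>\<complex>\<close> is complex linear or antilinear; by continuity the alternative is constant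
  on a connected set.\<close>

lemma conformal_holomorphic:
  fixes G :: "complex \<Rightarrow> complex"
  assumes S: "open S" "connected S" and G: "C_inf_on G S"
    and conf: "\<And>z w. z \<in> S \<Longrightarrow> (norm (frechet_derivative G (at z) w))\<^sup>2 = \<rho> z * (norm w)\<^sup>2"
    and \<rho>: "\<And>z. z \<in> S \<Longrightarrow> 0 < \<rho> z"
  obtains H where "H = G \<or> H = (\<lambda>z. cnj (G z))" "H holomorphic_on S" "\<And>z. z \<in> S \<Longrightarrow> norm (deriv H z) = sqrt (\<rho> z)"
proof -
  let ?D = "\<lambda>z. frechet_derivative G (at z)"
  define a where "a z = ?D z 1" for z
  define b where "b z = ?D z \<i>" for z
  have der: "(G has_derivative ?D z) (at z)" if "z \<in> S" for z
    using G that by (rule C_inf_on_has_derivative)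
  have lin: "linear (?D z)" if "z \<in> S" for z using der[OF that] by (rule has_derivative_linear)
  have Dw: "?D z w = of_real (Re w) * a z + of_real (Im w) * b z" if "z \<in> S" for z w
  proof -
    have "w = Re w *\<^sub>R 1 + Im w *\<^sub>R \<i>" by (simp add: complex_eq_iff)
    then have "?D z w = ?D z (Re w *\<^sub>R 1 + Im w *\<^sub>R \<i>)" by simp
    then show ?thesis unfolding a_def b_def linear_add[OF lin[OF that]] linear_cmul[OF lin[OF that]]
      by (simp add: scaleR_conv_of_real)
  qed
  have cont: "continuous_on S a" "continuous_on S b"
    unfolding a_def b_def using C_inf_on_continuous[OF C_inf_on_frechet[OF G]] by auto
  \<comment> \<open>The first two equations make the images of 1 and \<i> equally long; the third,
    from \<open>1 + \<i>\<close>, makes them orthogonal.\<close>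
  have na: "(norm (a z))\<^sup>2 = \<rho> z" "(norm (b z))\<^sup>2 = \<rho> z" "(norm (a z + b z))\<^sup>2 = 2 * \<rho> z" if "z \<in> S" for z
    using conf[OF that, of 1] conf[OF that, of \<i>] conf[OF that, of "1 + \<i>"] Dw[OF that, of "1 + \<i>"]
    by (simp_all add: a_def b_def cmod_power2)
  have a0: "a z \<noteq> 0" if "z \<in> S" for z using na(1)[OF that] \<rho>[OF that] by auto
  \<comment> \<open>The number \<open>t\<close> has the inner product of \<open>a z\<close> and
    \<open>b z\<close> as real part and their determinant as imaginary part, so it is purely
    imaginary of modulus \<open>\<rho> z\<close>.\<close>
  have alt: "b z = \<i> * a z \<or> b z = - \<i> * a z" if "z \<in> S" for z
  proof -
    define t where "t = cnj (a z) * b z"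
    have "Re t = 0" using na[OF that] unfolding t_def cmod_power2 plus_complex.sel power2_sum by simp
    moreover have "(norm t)\<^sup>2 = (\<rho> z)\<^sup>2"
      using na[OF that] by (simp add: t_def norm_mult power_mult_distrib power2_eq_square[of "\<rho> z"])
    ultimately have "(Im t)\<^sup>2 = (\<rho> z)\<^sup>2" by (simp add: cmod_power2)
    then have "Im t = \<rho> z \<or> Im t = - \<rho> z" by (simp add: power2_eq_iff)
    then have "t = \<i> * of_real (\<rho> z) \<or> t = - \<i> * of_real (\<rho> z)"
      using \<open>Re t = 0\<close> by (auto simp: complex_eq_iff)
    moreover have "of_real (\<rho> z) = cnj (a z) * a z"
      using na(1)[OF that] complex_norm_square[of "a z"] by (simp add: mult.commute)
    ultimately have "cnj (a z) * b z = cnj (a z) * (\<i> * a z) \<or> cnj (a z) * b z = cnj (a z) * (- \<i> * a z)"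
      by (auto simp: t_def algebra_simps)
    then show ?thesis using a0[OF that] unfolding mult_cancel_left by simp
  qed
  \<comment> \<open>The two alternatives define disjoint closed subsets covering \<open>S\<close>;
    disjoint because \<open>a z\<close> does not vanish.\<close>
  have "closedin (top_of_set S) {z \<in> S. b z - \<i> * a z = 0}" "closedin (top_of_set S) {z \<in> S. b z + \<i> * a z = 0}"
    by (intro continuous_closedin_preimage_constant continuous_intros cont)+
  moreover have "S \<subseteq> {z \<in> S. b z - \<i> * a z = 0} \<union> {z \<in> S. b z + \<i> * a z = 0}"
    using alt by (auto simp: eq_neg_iff_add_eq_0)
  moreover have "{z \<in> S. b z - \<i> * a z = 0} \<inter> {z \<in> S. b z + \<i> * a z = 0} = {}"
  proof -
    have "a z = 0" if "b z - \<i> * a z = 0" "b z + \<i> * a z = 0" for z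
    proof -
      have "2 * \<i> * a z = (b z + \<i> * a z) - (b z - \<i> * a z)" by (simp add: algebra_simps)
      then show ?thesis using that by simp
    qed
    then show ?thesis using a0 by blast
  qed
  ultimately have "{z \<in> S. b z - \<i> * a z = 0} = {} \<or> {z \<in> S. b z + \<i> * a z = 0} = {}"
    using S(2) unfolding connected_closedin by (metis (no_types, lifting))
  then consider "\<And>z. z \<in> S \<Longrightarrow> b z = \<i> * a z" | "\<And>z. z \<in> S \<Longrightarrow> b z = - \<i> * a z"
    using alt by (auto simp: eq_neg_iff_add_eq_0)
  then show ?thesis
  proof cases
    case 1
    have "(G has_field_derivative a z) (at z)" if "z \<in> S" for z
    proof -
      have "?D z = (*) (a z)" using Dw[OF that] 1[OF that]
        by (auto simp: fun_eq_iff complex_eq_iff algebra_simps)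
      then show ?thesis using der[OF that] by (simp add: has_field_derivative_def)
    qed
    note d = this
    show ?thesis
    proof (rule that[of G])
      show "G holomorphic_on S" using d S(1) by (auto simp: holomorphic_on_open)
      show "norm (deriv G z) = sqrt (\<rho> z)" if "z \<in> S" for z
        using DERIV_imp_deriv[OF d[OF that]] na(1)[OF that] by (simp add: real_sqrt_unique)
    qed simp
  next
    case 2
    have "((\<lambda>z. cnj (G z)) has_field_derivative cnj (a z)) (at z)" if "z \<in> S" for z
    proof -
      have "(\<lambda>w. cnj (?D z w)) = (*) (cnj (a z))" using Dw[OF that] 2[OF that]
        by (auto simp: fun_eq_iff complex_eq_iff algebra_simps)
      then show ?thesis using bounded_linear.has_derivative[OF bounded_linear_cnj der[OF that]]
        by (simp add: has_field_derivative_def)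
    qed
    note d = this
    show ?thesis
    proof (rule that[of "\<lambda>z. cnj (G z)"])
      show "(\<lambda>z. cnj (G z)) holomorphic_on S" using d S(1) by (auto simp: holomorphic_on_open)
      show "norm (deriv (\<lambda>z. cnj (G z)) z) = sqrt (\<rho> z)" if "z \<in> S" for z
        using DERIV_imp_deriv[OF d[OF that]] na(1)[OF that] by (simp add: real_sqrt_unique)
    qed simp
  qed
qed

section \<open>Charts, and the boundary as a chart-independent set\<close>

lemma is_chart_facts:
  assumes "is_chart M c"
  shows "fst c \<subseteq> M" "openin (top_of_set M) (fst c)" "openin (top_of_set half_plane) (snd c ` fst c)"
    "snd c ` fst c \<subseteq> half_plane" "inj_on (snd c) (fst c)" "continuous_on (fst c) (snd c)"
    "continuous_on (snd c ` fst c) (inv_chart c)"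
    "\<And>p. p \<in> fst c \<Longrightarrow> inv_chart c (snd c p) = p"
    "\<And>x. x \<in> snd c ` fst c \<Longrightarrow> inv_chart c x \<in> fst c"
    "\<And>x. x \<in> snd c ` fst c \<Longrightarrow> snd c (inv_chart c x) = x"
proof -
  obtain h where h: "homeomorphism (fst c) (snd c ` fst c) (snd c) h"
    and o: "openin (top_of_set M) (fst c)" "openin (top_of_set half_plane) (snd c ` fst c)"
    using assms unfolding is_chart_def by blast
  show "openin (top_of_set M) (fst c)" "openin (top_of_set half_plane) (snd c ` fst c)" by fact+
  show "fst c \<subseteq> M" "snd c ` fst c \<subseteq> half_plane" using o openin_imp_subset by blast+
  show inj: "inj_on (snd c) (fst c)" by (rule inj_on_inverseI[of _ h]) (rule homeomorphism_apply1[OF h])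
  show "continuous_on (fst c) (snd c)" by (rule homeomorphism_cont1[OF h])
  show i: "inv_chart c (snd c p) = p" if "p \<in> fst c" for p
    unfolding inv_chart_def by (rule inv_into_f_f[OF inj that])
  show "inv_chart c x \<in> fst c" "snd c (inv_chart c x) = x" if "x \<in> snd c ` fst c" for x
    using that i by auto
  show "continuous_on (snd c ` fst c) (inv_chart c)"
    by (rule continuous_on_eq[OF homeomorphism_cont2[OF h]]) (use i homeomorphism_apply1[OF h] in auto)
qed

locale bordered_surface =
  fixes M :: "'a::{t2_space,second_countable_topology} set" and \<A> :: "'a chart set"
  assumes surface: "smooth_surface M \<A>"
begin

abbreviation "bd \<equiv> boundary_of M \<A>"
abbreviation "cdom c \<equiv> snd c ` fst c"

lemma chart: "c \<in> \<A> \<Longrightarrow> is_chart M c"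
  using surface by (simp add: smooth_surface_def)

lemma chart_at: assumes "p \<in> M" obtains c where "c \<in> \<A>" "p \<in> fst c"
  using assms surface unfolding smooth_surface_def by blast

lemma openin_chart_preimage:
  assumes "c \<in> \<A>" "openin (top_of_set M) V" "continuous_on M f" "f ` M \<subseteq> M"
  shows "openin (top_of_set half_plane) {x \<in> cdom c. f (inv_chart c x) \<in> V}"
proof -
  note c = is_chart_facts[OF chart[OF assms(1)]]
  have cont: "continuous_on (cdom c) (\<lambda>x. f (inv_chart c x))"
    by (rule continuous_on_compose2[OF assms(3) c(7)]) (use c(1,9) in blast)
  have im: "(\<lambda>x. f (inv_chart c x)) \<in> cdom c \<rightarrow> M" using c(1,9) assms(4) by blast
  have "openin (top_of_set (cdom c)) (cdom c \<inter> (\<lambda>x. f (inv_chart c x)) -` V)"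
    by (rule continuous_openin_preimage[OF cont im assms(2)])
  then have "openin (top_of_set half_plane) (cdom c \<inter> (\<lambda>x. f (inv_chart c x)) -` V)"
    by (rule openin_trans[OF _ c(3)])
  then show ?thesis by (simp add: Int_def vimage_def)
qed

text \<open>Invariance of the boundary, needed because \<open>boundary_of\<close> asks for only one
  chart. If \<open>p\<close> were an interior point in the chart \<open>c\<close>, invariance of
  domain would make a full disc around \<open>snd d p\<close> part of the range of \<open>d\<close>;
  that range lies in the half plane, which has \<open>snd d p\<close> on its edge.\<close>

lemma boundary_iff:
  assumes "c \<in> \<A>" "p \<in> fst c"
  shows "p \<in> bd \<longleftrightarrow> snd c p $ 2 = 0"
proof
  assume "snd c p $ 2 = 0"
  then show "p \<in> bd" using assms is_chart_facts(1)[OF chart[OF assms(1)]] by (auto simp: boundary_of_def)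
next
  assume "p \<in> bd"
  then obtain d where d: "d \<in> \<A>" "p \<in> fst d" "snd d p $ 2 = 0" by (auto simp: boundary_of_def)
  note c = is_chart_facts[OF chart[OF assms(1)]] and d' = is_chart_facts[OF chart[OF d(1)]]
  show "snd c p $ 2 = 0"
  proof (rule ccontr)
    assume "snd c p $ 2 \<noteq> 0"
    then have px: "snd c p \<in> upper" using c(4) assms(2) by (auto simp: upper_def half_plane_def)
    define X where "X = {x \<in> cdom c. id (inv_chart c x) \<in> fst d}"
    have "openin (top_of_set half_plane) X" unfolding X_def
      by (rule openin_chart_preimage[OF assms(1) d'(2)]) auto
    then obtain T where T: "open T" "X = T \<inter> half_plane" by (auto simp: openin_open)
    have "X \<inter> upper = T \<inter> upper" using T(2) upper_subset by blast
    then have opX: "open (X \<inter> upper)" using T(1) open_upper by auto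
    have sub: "inv_chart c ` (X \<inter> upper) \<subseteq> fst d" by (auto simp: X_def)
    have "open ((\<lambda>x. snd d (inv_chart c x)) ` (X \<inter> upper))"
    proof (rule invariance_of_domain[OF _ opX])
      show "continuous_on (X \<inter> upper) (\<lambda>x. snd d (inv_chart c x))"
        by (rule continuous_on_compose2[OF d'(6) continuous_on_subset[OF c(7)]]) (auto simp: X_def)
      show "inj_on (\<lambda>x. snd d (inv_chart c x)) (X \<inter> upper)"
      proof (rule inj_onI)
        fix x y assume "x \<in> X \<inter> upper" "y \<in> X \<inter> upper" "snd d (inv_chart c x) = snd d (inv_chart c y)"
        then have "inv_chart c x = inv_chart c y" "x \<in> cdom c" "y \<in> cdom c"
          using inj_onD[OF d'(5)] by (auto simp: X_def)
        then show "x = y" using c(10) by metis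
      qed
    qed
    moreover have "snd d p \<in> (\<lambda>x. snd d (inv_chart c x)) ` (X \<inter> upper)"
      using px assms(2) d(2) c(8)[OF assms(2)] by (intro image_eqI[of _ _ "snd c p"]) (auto simp: X_def)
    ultimately obtain e where e: "e > 0" "ball (snd d p) e \<subseteq> (\<lambda>x. snd d (inv_chart c x)) ` (X \<inter> upper)"
      using openE by blast
    have "snd d p - (e / 2) *\<^sub>R axis 2 1 \<in> ball (snd d p) e" using e(1) by (simp add: dist_norm)
    then have "snd d p - (e / 2) *\<^sub>R axis 2 1 \<in> half_plane"
      using e(2) sub d'(4) by blast
    then show False using d(3) e(1) by (simp add: half_plane_def)
  qed
qed

lemma upper_iff:
  assumes "c \<in> \<A>" "x \<in> cdom c"
  shows "inv_chart c x \<in> M - bd \<longleftrightarrow> x \<in> upper"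
  using boundary_iff[OF assms(1) is_chart_facts(9)[OF chart[OF assms(1)] assms(2)]]
    is_chart_facts[OF chart[OF assms(1)]] assms(2)
  by (auto simp: upper_def half_plane_def)

end

text \<open>The derivative within \<open>D\<close> is unique even on the edge, since from every
  point a short step in each positive coordinate direction stays in \<open>D\<close>.\<close>

lemma frechet_derivative_half_plane:
  fixes f :: "real^2 \<Rightarrow> 'b::real_normed_vector"
  assumes "openin (top_of_set half_plane) D" "x \<in> D" "(f has_derivative f') (at x within D)"
  shows "frechet_derivative f (at x within D) = f'"
proof -
  obtain r where r: "0 < r" "ball x r \<inter> half_plane \<subseteq> D"
    using openin_half_plane_ball[OF assms(1,2)] .
  have xh: "x \<in> half_plane" using assms(1,2) openin_imp_subset by blast
  have "(f has_derivative frechet_derivative f (at x within D)) (at x within D)"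
    using assms(3) frechet_derivative_works differentiable_def by blast
  then show ?thesis
  proof (rule frechet_derivative_unique_within[OF _ assms(3)])
    fix i :: "real^2" and e :: real assume i: "i \<in> Basis" and e: "0 < e"
    define d where "d = min r e / 2"
    have d: "0 < d" "d < r" "d < e" using r(1) e by (auto simp: d_def)
    have "i $ 2 \<ge> 0" using i by (auto simp: Basis_vec_def axis_def)
    then have "x + d *\<^sub>R i \<in> half_plane" using xh d by (simp add: half_plane_def)
    moreover have "x + d *\<^sub>R i \<in> ball x r" using i d by (simp add: dist_norm)
    ultimately show "\<exists>d. 0 < \<bar>d\<bar> \<and> \<bar>d\<bar> < e \<and> x + d *\<^sub>R i \<in> D" using d r(2) by (intro exI[of _ d]) auto
  qed
qed

lemma smooth_on_imp_C_inf_on: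
  fixes f :: "'a::euclidean_space \<Rightarrow> 'b::real_normed_vector"
  assumes "smooth_on D f" "open U" "U \<subseteq> D"
  shows "C_inf_on f U"
proof
  fix k
  show "C_k_on k f U"
  proof (rule C_k_on_locally[OF assms(2)])
    fix x assume x: "x \<in> U"
    then obtain W F where W: "open W" "x \<in> W" "C_inf_on F W" "\<And>y. y \<in> W \<inter> D \<Longrightarrow> F y = f y"
      using bspec[OF assms(1)[unfolded smooth_on_def], of x] assms(3) by (metis subsetD)
    have o: "open (W \<inter> U)" using W(1) assms(2) by blast
    have "C_k_on k F (W \<inter> U)" using C_k_on_subset[of k F W "W \<inter> U"] W(3) by blast
    then have "C_k_on k f (W \<inter> U)" by (rule C_k_on_cong[OF o, rotated]) (use W(4) assms(3) in blast)
    then show "\<exists>V. open V \<and> x \<in> V \<and> C_k_on k f V" using o W(2) x by blast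
  qed
qed

text \<open>Evaluating pulled-back components on vectors reduces statements about
  \<open>pullback\<close> to squared norms in flat coordinates.\<close>

lemma inner_pullback:
  fixes J A :: "real^2^2"
  shows "u \<bullet> ((transpose J ** A ** J) *v v) = (J *v u) \<bullet> (A *v (J *v v))"
proof -
  have "u \<bullet> (transpose J *v z) = (J *v u) \<bullet> z" for z
    by (metis dot_lmul_matrix inner_commute transpose_matrix_vector)
  then show ?thesis unfolding matrix_vector_mul_assoc[symmetric] by blast
qed

section \<open>Flat representatives of a conformal map\<close>

lemma flat_coord_inverse:
  assumes "flat_coord h x0 r \<phi>"
  defines "\<gamma> \<equiv> inv_into (ball x0 r) \<phi>"
  shows "\<And>x. x \<in> ball x0 r \<Longrightarrow> \<gamma> (\<phi> x) = x" "\<And>z. z \<in> \<phi> ` ball x0 r \<Longrightarrow> \<gamma> z \<in> ball x0 r"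
    "\<And>z. z \<in> \<phi> ` ball x0 r \<Longrightarrow> \<phi> (\<gamma> z) = z" "C_inf_on \<gamma> (\<phi> ` ball x0 r)"
    "open (\<phi> ` ball x0 r)" "inj_on \<phi> (ball x0 r)" "C_inf_on \<phi> (ball x0 r)"
    "\<And>S. open S \<Longrightarrow> S \<subseteq> ball x0 r \<Longrightarrow> open (\<phi> ` S)"
proof -
  note f = assms(1)[unfolded flat_coord_def]
  show inj: "inj_on \<phi> (ball x0 r)" and sm: "C_inf_on \<phi> (ball x0 r)" using f by blast+
  show "open (\<phi> ` ball x0 r)" "C_inf_on \<gamma> (\<phi> ` ball x0 r)" using f unfolding \<gamma>_def by blast+
  show "\<gamma> (\<phi> x) = x" if "x \<in> ball x0 r" for x unfolding \<gamma>_def by (rule inv_into_f_f[OF inj that])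
  show "\<gamma> z \<in> ball x0 r" "\<phi> (\<gamma> z) = z" if "z \<in> \<phi> ` ball x0 r" for z
    unfolding \<gamma>_def using inv_into_into[OF that] f_inv_into_f[OF that] by auto
  show "open (\<phi> ` S)" if "open S" "S \<subseteq> ball x0 r" for S
    using C_inf_on_continuous[OF sm] inj that
    by (intro invariance_of_domain_gen) (auto intro: continuous_on_subset inj_on_subset)
qed

context bordered_surface
begin

text \<open>In flat coordinates \<open>\<psi>\<close> is the function \<open>G\<close>; if it is antiholomorphic, replacing \<open>\<phi>2\<close> by its conjugate makes
  it holomorphic. Here \<open>\<sigma>\<close> is the square root of the conformal factor.\<close>

definition flat_rep where
  "flat_rep g1 g2 \<psi> \<sigma> c d p \<phi>1 \<phi>2 r1 r2 G \<longleftrightarrow>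
      flat_coord (g1 c) (snd c p) r1 \<phi>1 \<and> ball (snd c p) r1 \<inter> half_plane \<subseteq> cdom c \<and>
      flat_coord (g2 d) (snd d (\<psi> p)) r2 \<phi>2 \<and> ball (snd d (\<psi> p)) r2 \<inter> half_plane \<subseteq> cdom d \<and>
      (\<forall>x\<in>ball (snd c p) r1 \<inter> half_plane. \<psi> (inv_chart c x) \<in> fst d \<and>
         local_rep c d \<psi> x \<in> ball (snd d (\<psi> p)) r2 \<and> G (\<phi>1 x) = \<phi>2 (local_rep c d \<psi> x)) \<and>
      continuous_on (\<phi>1 ` (ball (snd c p) r1 \<inter> half_plane)) G \<and>
      G holomorphic_on \<phi>1 ` (ball (snd c p) r1 \<inter> upper) \<and>
      (\<forall>x\<in>ball (snd c p) r1 \<inter> upper. norm (deriv G (\<phi>1 x)) = \<sigma> (inv_chart c x))"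

text \<open>It asks for holomorphy instead of conformality and ranges over all pairs of charts, so
  passing to the inverse of \<psi> exchanges \<open>c\<close> with \<open>d\<close> and
  \<open>g1\<close> with \<open>g2\<close>. No differentiability on the boundary is
  included.\<close>

definition conf_data where
  "conf_data g1 g2 \<psi> \<sigma> \<longleftrightarrow> (\<forall>p\<in>M. \<forall>c\<in>\<A>. \<forall>d\<in>\<A>. p \<in> fst c \<longrightarrow> \<psi> p \<in> fst d \<longrightarrow>
    (\<exists>\<phi>1 \<phi>2 r1 r2 G. flat_rep g1 g2 \<psi> \<sigma> c d p \<phi>1 \<phi>2 r1 r2 G))"

lemma conf_dataE:
  assumes "conf_data g1 g2 \<psi> \<sigma>" "p \<in> M" "c \<in> \<A>" "d \<in> \<A>" "p \<in> fst c" "\<psi> p \<in> fst d"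
  obtains \<phi>1 \<phi>2 r1 r2 G where
    "flat_coord (g1 c) (snd c p) r1 \<phi>1" "ball (snd c p) r1 \<inter> half_plane \<subseteq> cdom c"
    "flat_coord (g2 d) (snd d (\<psi> p)) r2 \<phi>2" "ball (snd d (\<psi> p)) r2 \<inter> half_plane \<subseteq> cdom d"
    "\<And>x. x \<in> ball (snd c p) r1 \<inter> half_plane \<Longrightarrow> \<psi> (inv_chart c x) \<in> fst d"
    "\<And>x. x \<in> ball (snd c p) r1 \<inter> half_plane \<Longrightarrow> local_rep c d \<psi> x \<in> ball (snd d (\<psi> p)) r2"
    "\<And>x. x \<in> ball (snd c p) r1 \<inter> half_plane \<Longrightarrow> G (\<phi>1 x) = \<phi>2 (local_rep c d \<psi> x)"
    "continuous_on (\<phi>1 ` (ball (snd c p) r1 \<inter> half_plane)) G"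
    "G holomorphic_on \<phi>1 ` (ball (snd c p) r1 \<inter> upper)"
    "\<And>x. x \<in> ball (snd c p) r1 \<inter> upper \<Longrightarrow> norm (deriv G (\<phi>1 x)) = \<sigma> (inv_chart c x)"
proof -
  obtain \<phi>1 \<phi>2 r1 r2 G where "flat_rep g1 g2 \<psi> \<sigma> c d p \<phi>1 \<phi>2 r1 r2 G"
    using assms unfolding conf_data_def by blast
  then show ?thesis using that unfolding flat_rep_def by metis
qed

lemma flat_at:
  assumes "flat_metric M \<A> g" "c \<in> \<A>" "x \<in> cdom c"
  obtains r \<phi> where "flat_coord (g c) x r \<phi>" "ball x r \<inter> half_plane \<subseteq> cdom c"
proof (rule flat_coordinates[of c g x])
  show "openin (top_of_set half_plane) (cdom c)" by (rule is_chart_facts(3)[OF chart[OF assms(2)]])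
qed (use assms that in \<open>auto simp: flat_metric_def riemannian_metric_def\<close>)

lemma local_rep_neighbourhood:
  assumes "c \<in> \<A>" "d \<in> \<A>" "p \<in> fst c" "\<psi> p \<in> fst d" "continuous_on M \<psi>" "\<psi> ` M \<subseteq> M" "0 < e"
  obtains r where "0 < r" "ball (snd c p) r \<inter> half_plane \<subseteq> cdom c"
    "\<And>x. x \<in> ball (snd c p) r \<inter> half_plane \<Longrightarrow> \<psi> (inv_chart c x) \<in> fst d"
    "\<And>x. x \<in> ball (snd c p) r \<inter> half_plane \<Longrightarrow> local_rep c d \<psi> x \<in> ball (snd d (\<psi> p)) e"
    "continuous_on (ball (snd c p) r \<inter> half_plane) (local_rep c d \<psi>)"
proof -
  note c = is_chart_facts[OF chart[OF assms(1)]] and d = is_chart_facts[OF chart[OF assms(2)]]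
  define V where "V = fst d \<inter> snd d -` ball (snd d (\<psi> p)) e"
  have "openin (top_of_set (fst d)) V" unfolding V_def
    by (rule continuous_openin_preimage_gen[OF d(6)]) simp
  then have V: "openin (top_of_set M) V" using d(2) openin_trans by blast
  define X where "X = {x \<in> cdom c. \<psi> (inv_chart c x) \<in> V}"
  have "openin (top_of_set half_plane) X" unfolding X_def by (rule openin_chart_preimage[OF assms(1) V assms(5,6)])
  moreover have "snd c p \<in> X" using assms c(8) by (auto simp: X_def V_def)
  ultimately obtain r where r: "0 < r" "ball (snd c p) r \<inter> half_plane \<subseteq> X" using openin_half_plane_ball by blast
  show ?thesis
  proof (rule that[OF r(1)])
    show "continuous_on (ball (snd c p) r \<inter> half_plane) (local_rep c d \<psi>)"
    proof (rule continuous_on_subset[OF _ r(2)])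
      have 1: "continuous_on X (inv_chart c)" by (rule continuous_on_subset[OF c(7)]) (auto simp: X_def)
      have 2: "continuous_on X (\<lambda>x. \<psi> (inv_chart c x))"
        by (rule continuous_on_compose2[OF assms(5) 1]) (use c(1,9) in \<open>auto simp: X_def\<close>)
      have "continuous_on X (\<lambda>x. snd d (\<psi> (inv_chart c x)))"
        by (rule continuous_on_compose2[OF d(6) 2]) (auto simp: X_def V_def)
      then show "continuous_on X (local_rep c d \<psi>)" by (simp add: local_rep_def o_def)
    qed
  qed (use r(2) in \<open>auto simp: X_def V_def local_rep_def\<close>)
qed

text \<open>The flat coordinates turn both metrics into the Euclidean one, so \<open>G0\<close>,
  which is \<psi> read in them, is conformal with factor \<rho> on the image of the open half disc.
  That image is connected, whence one of the two alternatives of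
  \<open>conformal_holomorphic\<close> holds throughout.\<close>

lemma conformal_conf_data:
  assumes flat: "flat_metric M \<A> g1" "flat_metric M \<A> g2"
    and \<psi>: "continuous_on M \<psi>" "\<psi> ` M \<subseteq> M"
    and conf: "conformal_map (M - bd) \<A> g1 (M - bd) \<A> g2 \<psi>"
  obtains \<sigma> where "\<And>q. q \<in> M - bd \<Longrightarrow> 0 < \<sigma> q" "conf_data g1 g2 \<psi> \<sigma>"
proof -
  define S where "S = M - bd"
  have sm: "smooth_map S \<A> S \<A> \<psi>" using conf unfolding conformal_map_def S_def by blast
  obtain \<rho> where \<rho>: "\<And>q. q \<in> S \<Longrightarrow> 0 < \<rho> q" "\<And>c d x. c \<in> \<A> \<Longrightarrow> d \<in> \<A> \<Longrightarrow> x \<in> local_dom S c d \<psi> \<Longrightarrow>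
      pullback S c d \<psi> g2 x = \<rho> (inv_chart c x) *\<^sub>R g1 c x"
    using conf unfolding conformal_map_def S_def by metis
  have "conf_data g1 g2 \<psi> (\<lambda>q. sqrt (\<rho> q))" unfolding conf_data_def
  proof (intro ballI impI)
    fix p c d assume p: "p \<in> M" "c \<in> \<A>" "d \<in> \<A>" "p \<in> fst c" "\<psi> p \<in> fst d"
    define x0 where "x0 = snd c p"
    define y0 where "y0 = snd d (\<psi> p)"
    define L where "L = local_rep c d \<psi>"
    note c = is_chart_facts[OF chart[OF p(2)]] and d = is_chart_facts[OF chart[OF p(3)]]
    have dom0: "x0 \<in> cdom c" "y0 \<in> cdom d" using p by (auto simp: x0_def y0_def)
    obtain r \<phi>1 where \<phi>1: "flat_coord (g1 c) x0 r \<phi>1" "ball x0 r \<inter> half_plane \<subseteq> cdom c"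
      by (rule flat_at[OF flat(1) p(2) dom0(1)])
    obtain r2 \<phi>2 where \<phi>2: "flat_coord (g2 d) y0 r2 \<phi>2" "ball y0 r2 \<inter> half_plane \<subseteq> cdom d"
      by (rule flat_at[OF flat(2) p(3) dom0(2)])
    have r: "0 < r" "0 < r2" using \<phi>1 \<phi>2 unfolding flat_coord_def by blast+
    note nb = local_rep_neighbourhood[OF p(2-5) \<psi> r(2), folded x0_def y0_def L_def]
    obtain r' where r': "0 < r'" "ball x0 r' \<inter> half_plane \<subseteq> cdom c"
      "\<And>x. x \<in> ball x0 r' \<inter> half_plane \<Longrightarrow> \<psi> (inv_chart c x) \<in> fst d"
      "\<And>x. x \<in> ball x0 r' \<inter> half_plane \<Longrightarrow> L x \<in> ball y0 r2"
      "continuous_on (ball x0 r' \<inter> half_plane) L"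
      by (rule nb) (rule that; assumption)
    define r1 where "r1 = min r r'"
    have r1: "0 < r1" "r1 \<le> r" "ball x0 r1 \<inter> half_plane \<subseteq> ball x0 r' \<inter> half_plane"
      using r(1) r'(1) by (auto simp: r1_def)
    note \<phi>1' = flat_coord_mono[OF \<phi>1(1) r1(1,2)]
    note i1 = flat_coord_inverse[OF \<phi>1'] and i2 = flat_coord_inverse[OF \<phi>2(1)]
    define \<gamma> where "\<gamma> = inv_into (ball x0 r1) \<phi>1"
    define U where "U = ball x0 r1 \<inter> upper"
    have U: "open U" "connected U" "U \<subseteq> ball x0 r1" "U \<subseteq> ball x0 r1 \<inter> half_plane" "U \<subseteq> ball x0 r' \<inter> half_plane"
      using open_upper upper_subset r1(3) unfolding U_def
      by (auto intro!: convex_connected convex_Int convex_upper)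
    have Udom: "U \<subseteq> local_dom S c d \<psi>"
    proof
      fix x assume x: "x \<in> U"
      then have xd: "x \<in> cdom c" "\<psi> (inv_chart c x) \<in> fst d" using U(5) r'(2,3) by blast+
      then have "inv_chart c x \<in> S" using upper_iff[OF p(2) xd(1)] x by (auto simp: S_def U_def)
      then show "x \<in> local_dom S c d \<psi>"
        unfolding local_dom_def using xd c(9,10)[OF xd(1)] by (intro image_eqI[of _ _ "inv_chart c x"]) auto
    qed
    have LU: "C_inf_on L U" unfolding L_def
      using sm p(2,3) U(1) Udom unfolding smooth_map_def by (intro smooth_on_imp_C_inf_on[of "local_dom S c d \<psi>"]) auto
    have LB: "L ` U \<subseteq> ball y0 r2 \<inter> half_plane"
    proof
      fix y assume "y \<in> L ` U"
      then obtain x where x: "x \<in> U" "y = L x" by blast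
      then have "y \<in> ball y0 r2" "\<psi> (inv_chart c x) \<in> fst d" using U(5) r'(3,4) by blast+
      then show "y \<in> ball y0 r2 \<inter> half_plane" using x(2) d(4) by (auto simp: L_def local_rep_def)
    qed
    define B where "B x = \<phi>2 (L x)" for x
    have BU: "C_inf_on B U" unfolding B_def[abs_def]
      using C_k_on_compose[OF U(1) open_ball, of L y0 r2 _ \<phi>2] LU LB i2(7) by blast
    have dB: "(norm (frechet_derivative B (at x) v))\<^sup>2 = \<rho> (inv_chart c x) * (norm (frechet_derivative \<phi>1 (at x) v))\<^sup>2"
      if x: "x \<in> U" for x v
    proof -
      have dL: "(L has_derivative frechet_derivative L (at x)) (at x)" using LU x by (rule C_inf_on_has_derivative)
      have Lx: "L x \<in> ball y0 r2 \<inter> half_plane" using LB x by blast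
      have d2: "(\<phi>2 has_derivative frechet_derivative \<phi>2 (at (L x))) (at (L x))"
        using i2(7) Lx by (intro C_inf_on_has_derivative[of _ "ball y0 r2"]) auto
      have B': "frechet_derivative B (at x) v = frechet_derivative \<phi>2 (at (L x)) (frechet_derivative L (at x) v)"
        using fun_cong[OF frechet_derivative_at[OF diff_chain_at[OF dL d2]], of v] by (simp add: o_def B_def[abs_def])
      have "at x within local_dom S c d \<psi> = at x"
        using U(1) Udom x by (meson at_within_interior interior_maximal subsetD)
      then have J: "local_jac S c d \<psi> x *v w = frechet_derivative L (at x) w" for w
        unfolding local_jac_def L_def[symmetric] using has_derivative_linear[OF dL] by (simp add: matrix_works)
      have "(norm (frechet_derivative B (at x) v))\<^sup>2 =
          frechet_derivative L (at x) v \<bullet> (g2 d (L x) *v frechet_derivative L (at x) v)"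
        unfolding B' using \<phi>2(1) Lx unfolding flat_coord_def by blast
      also have "\<dots> = v \<bullet> (pullback S c d \<psi> g2 x *v v)"
        unfolding pullback_def inner_pullback J L_def ..
      also have "\<dots> = \<rho> (inv_chart c x) * (v \<bullet> (g1 c x *v v))"
        using \<rho>(2)[OF p(2,3) subsetD[OF Udom x]] by (simp add: scaleR_matrix_vector_assoc[symmetric])
      also have "v \<bullet> (g1 c x *v v) = (norm (frechet_derivative \<phi>1 (at x) v))\<^sup>2"
      proof -
        have "x \<in> ball x0 r1 \<inter> half_plane" using U(4) x by blast
        then show ?thesis using \<phi>1' unfolding flat_coord_def by simp
      qed
      finally show ?thesis .
    qed
    define G0 where "G0 z = B (\<gamma> z)" for z
    have opU: "open (\<phi>1 ` U)" using i1(8)[OF U(1,3)] .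
    have \<gamma>U: "\<gamma> ` \<phi>1 ` U \<subseteq> U" using i1(1) U(3) unfolding \<gamma>_def by (auto simp: subset_iff)
    have \<gamma>sm: "C_inf_on \<gamma> (\<phi>1 ` U)" using i1(4) C_k_on_subset[OF _ image_mono[OF U(3)]] unfolding \<gamma>_def by blast
    have G0: "C_inf_on G0 (\<phi>1 ` U)" unfolding G0_def[abs_def]
      using C_k_on_compose[OF opU U(1) \<gamma>U, of _ B] \<gamma>sm BU by blast
    have conn: "connected (\<phi>1 ` U)"
      using C_inf_on_continuous[OF i1(7)] U(2,3) by (intro connected_continuous_image) (auto intro: continuous_on_subset)
    have cG0: "(norm (frechet_derivative G0 (at z) w))\<^sup>2 = \<rho> (inv_chart c (\<gamma> z)) * (norm w)\<^sup>2" if z: "z \<in> \<phi>1 ` U" for z w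
    proof -
      have x: "\<gamma> z \<in> U" using \<gamma>U z by blast
      have "\<phi>1 ` U \<subseteq> \<phi>1 ` ball x0 r1" using U(3) by blast
      have dg: "(\<gamma> has_derivative frechet_derivative \<gamma> (at z)) (at z)" using \<gamma>sm z by (rule C_inf_on_has_derivative)
      have dB': "(B has_derivative frechet_derivative B (at (\<gamma> z))) (at (\<gamma> z))" using BU x by (rule C_inf_on_has_derivative)
      have d1: "(\<phi>1 has_derivative frechet_derivative \<phi>1 (at (\<gamma> z))) (at (\<gamma> z))"
        using i1(7) by (rule C_inf_on_has_derivative) (use x U(3) in blast)
      have "frechet_derivative G0 (at z) w = frechet_derivative B (at (\<gamma> z)) (frechet_derivative \<gamma> (at z) w)"
        using fun_cong[OF frechet_derivative_at[OF diff_chain_at[OF dg dB']], of w] by (simp add: o_def G0_def[abs_def])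
      moreover have "frechet_derivative \<phi>1 (at (\<gamma> z)) (frechet_derivative \<gamma> (at z) w) = w"
      proof -
        have "((\<lambda>z. \<phi>1 (\<gamma> z)) has_derivative (\<lambda>w. frechet_derivative \<phi>1 (at (\<gamma> z)) (frechet_derivative \<gamma> (at z) w))) (at z)"
          using diff_chain_at[OF dg d1] by (simp add: o_def)
        then have "((\<lambda>z. z) has_derivative (\<lambda>w. frechet_derivative \<phi>1 (at (\<gamma> z)) (frechet_derivative \<gamma> (at z) w))) (at z)"
          by (rule has_derivative_transform_within_open[OF _ opU z])
            (use i1(3) \<open>\<phi>1 ` U \<subseteq> \<phi>1 ` ball x0 r1\<close> in \<open>auto simp: \<gamma>_def\<close>)
        from has_derivative_unique[OF this has_derivative_ident] show ?thesis by metis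
      qed
      ultimately show ?thesis using dB[OF x] by simp
    qed
    have \<rho>pos: "0 < \<rho> (inv_chart c (\<gamma> z))" if "z \<in> \<phi>1 ` U" for z
    proof -
      have x: "\<gamma> z \<in> U" using \<gamma>U that by blast
      then have "\<gamma> z \<in> cdom c" using U(5) r'(2) by blast
      then show ?thesis using upper_iff[OF p(2)] x \<rho>(1) by (auto simp: S_def U_def)
    qed
    obtain H where H: "H = G0 \<or> H = (\<lambda>z. cnj (G0 z))" "H holomorphic_on \<phi>1 ` U"
      "\<And>z. z \<in> \<phi>1 ` U \<Longrightarrow> norm (deriv H z) = sqrt (\<rho> (inv_chart c (\<gamma> z)))"
      using conformal_holomorphic[OF opU conn G0 cG0 \<rho>pos] by metis
    \<comment> \<open>Conjugation is absorbed into the target coordinate, which remains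
      flat.\<close>
    obtain \<phi>2' where \<phi>2': "flat_coord (g2 d) y0 r2 \<phi>2'" "\<And>z. H z = \<phi>2' (L (\<gamma> z))"
    proof (cases "H = G0")
      case True
      then show ?thesis using that[of \<phi>2] \<phi>2(1) by (simp add: G0_def B_def)
    next
      case False
      then show ?thesis using that[of "\<lambda>x. cnj (\<phi>2 x)"] flat_coord_cnj[OF \<phi>2(1)] H(1) by (simp add: G0_def B_def)
    qed
    have contH: "continuous_on (\<phi>1 ` (ball x0 r1 \<inter> half_plane)) H"
    proof -
      have im: "\<gamma> ` \<phi>1 ` (ball x0 r1 \<inter> half_plane) \<subseteq> ball x0 r1 \<inter> half_plane"
        using i1(1) unfolding \<gamma>_def by auto
      have 1: "continuous_on (\<phi>1 ` (ball x0 r1 \<inter> half_plane)) \<gamma>"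
        using C_inf_on_continuous[OF i1(4)] unfolding \<gamma>_def by (rule continuous_on_subset) blast
      have 2: "continuous_on (\<phi>1 ` (ball x0 r1 \<inter> half_plane)) (\<lambda>z. L (\<gamma> z))"
        by (rule continuous_on_compose2[OF r'(5) 1]) (use im r1(3) in blast)
      have "continuous_on (\<phi>1 ` (ball x0 r1 \<inter> half_plane)) (\<lambda>z. \<phi>2' (L (\<gamma> z)))"
        by (rule continuous_on_compose2[OF C_inf_on_continuous[OF flat_coord_inverse(7)[OF \<phi>2'(1)]] 2])
          (use im r1(3) r'(4) in blast)
      then show ?thesis unfolding \<phi>2'(2) .
    qed
    have \<gamma>1: "\<gamma> (\<phi>1 x) = x" if "x \<in> ball x0 r1" for x unfolding \<gamma>_def by (rule i1(1)[OF that])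
    show "\<exists>\<phi>1 \<phi>2 r1 r2 G. flat_rep g1 g2 \<psi> (\<lambda>q. sqrt (\<rho> q)) c d p \<phi>1 \<phi>2 r1 r2 G"
      unfolding flat_rep_def x0_def[symmetric] y0_def[symmetric] L_def[symmetric]
    proof (rule exI[of _ \<phi>1], rule exI[of _ \<phi>2'], rule exI[of _ r1], rule exI[of _ r2], rule exI[of _ H],
        intro conjI ballI)
      fix x assume x: "x \<in> ball x0 r1 \<inter> half_plane"
      then have x': "x \<in> ball x0 r' \<inter> half_plane" using r1(3) by blast
      show "\<psi> (inv_chart c x) \<in> fst d" "L x \<in> ball y0 r2" using r'(3,4)[OF x'] by auto
      have "\<gamma> (\<phi>1 x) = x" using \<gamma>1 x by blast
      then show "H (\<phi>1 x) = \<phi>2' (L x)" by (simp add: \<phi>2'(2))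
    next
      fix x assume x: "x \<in> ball x0 r1 \<inter> upper"
      then have "\<gamma> (\<phi>1 x) = x" using \<gamma>1 by blast
      then show "norm (deriv H (\<phi>1 x)) = sqrt (\<rho> (inv_chart c x))"
        using H(3)[of "\<phi>1 x"] x by (simp add: U_def)
    next
      show "ball x0 r1 \<inter> half_plane \<subseteq> cdom c" using r1(3) r'(2) by blast
      show "H holomorphic_on \<phi>1 ` (ball x0 r1 \<inter> upper)" using H(2) by (simp add: U_def)
    qed (fact \<phi>1' \<phi>2'(1) \<phi>2(2) contH)+
  qed
  then show ?thesis using that[of "\<lambda>q. sqrt (\<rho> q)"] \<rho>(1) unfolding S_def by simp
qed

end

section \<open>Bounds for the conformal factor\<close>

context bordered_surface
begin

lemma homeomorphism_boundary:
  assumes "homeomorphism M M \<psi> \<psi>'" "\<forall>p\<in>bd. \<psi> p = p"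
  shows "\<forall>p\<in>bd. \<psi>' p = p" "q \<in> M \<Longrightarrow> \<psi> q \<in> bd \<longleftrightarrow> q \<in> bd"
proof -
  have bM: "bd \<subseteq> M" by (auto simp: boundary_of_def)
  show "\<forall>p\<in>bd. \<psi>' p = p" using assms(2) homeomorphism_apply1[OF assms(1)] bM by (metis subsetD)
  show "\<psi> q \<in> bd \<longleftrightarrow> q \<in> bd" if "q \<in> M"
    using assms(2) homeomorphism_apply1[OF assms(1)] bM that by (metis subsetD)
qed

lemma local_rep_upper:
  assumes "homeomorphism M M \<psi> \<psi>'" "\<forall>p\<in>bd. \<psi> p = p" "c \<in> \<A>" "d \<in> \<A>" "x \<in> cdom c"
    "\<psi> (inv_chart c x) \<in> fst d"
  shows "inv_chart d (local_rep c d \<psi> x) = \<psi> (inv_chart c x)" "local_rep c d \<psi> x \<in> cdom d"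
    "local_rep c d \<psi> x \<in> upper \<longleftrightarrow> x \<in> upper"
proof -
  note c = is_chart_facts[OF chart[OF assms(3)]] and d = is_chart_facts[OF chart[OF assms(4)]]
  show i: "inv_chart d (local_rep c d \<psi> x) = \<psi> (inv_chart c x)" and l: "local_rep c d \<psi> x \<in> cdom d"
    using d(8)[OF assms(6)] assms(6) by (auto simp: local_rep_def)
  have "inv_chart c x \<in> M" using c(1,9) assms(5) by blast
  moreover have "\<psi> (inv_chart c x) \<in> M" using d(1) assms(6) by blast
  ultimately show "local_rep c d \<psi> x \<in> upper \<longleftrightarrow> x \<in> upper"
    using upper_iff[OF assms(3,5)] upper_iff[OF assms(4) l] homeomorphism_boundary(2)[OF assms(1,2)] i by simp
qed

text \<open>An injective holomorphic function has a holomorphic inverse with reciprocal derivative.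
  Injectivity of \<open>G\<close> comes from \<psi>, and continuity of \<psi>' gives that of the new
  representative up to the edge; no differentiability of \<psi>' is presupposed.\<close>

lemma conf_data_inverse:
  assumes cd: "conf_data g1 g2 \<psi> \<sigma>" and hom: "homeomorphism M M \<psi> \<psi>'" and id: "\<forall>p\<in>bd. \<psi> p = p"
  shows "conf_data g2 g1 \<psi>' (\<lambda>q. 1 / \<sigma> (\<psi>' q))"
  unfolding conf_data_def
proof (intro ballI impI)
  fix p c d assume p: "p \<in> M" "c \<in> \<A>" "d \<in> \<A>" "p \<in> fst c" "\<psi>' p \<in> fst d"
  have hom': "homeomorphism M M \<psi>' \<psi>" using hom by (rule homeomorphism_symD)
  note id' = homeomorphism_boundary(1)[OF hom id]
  have pp: "\<psi>' p \<in> M" "\<psi> (\<psi>' p) = p"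
    using hom p(1) homeomorphism_image2[OF hom] homeomorphism_apply2[OF hom] by auto
  have \<psi>M: "continuous_on M \<psi>'" "\<psi>' ` M \<subseteq> M"
    using homeomorphism_cont2[OF hom] homeomorphism_image2[OF hom] by auto
  note c = is_chart_facts[OF chart[OF p(2)]] and d = is_chart_facts[OF chart[OF p(3)]]
  define x0 where "x0 = snd c p"
  define y0 where "y0 = snd d (\<psi>' p)"
  have "\<psi> (\<psi>' p) \<in> fst c" using pp p by simp
  from conf_dataE[OF cd pp(1) p(3,2,5) this, unfolded pp(2), folded x0_def y0_def]
  obtain \<phi>1 \<phi>2 r1 r2 G where 1:
    "flat_coord (g1 d) y0 r1 \<phi>1" "ball y0 r1 \<inter> half_plane \<subseteq> cdom d"
    "flat_coord (g2 c) x0 r2 \<phi>2" "ball x0 r2 \<inter> half_plane \<subseteq> cdom c"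
    "\<And>x. x \<in> ball y0 r1 \<inter> half_plane \<Longrightarrow> \<psi> (inv_chart d x) \<in> fst c"
    "\<And>x. x \<in> ball y0 r1 \<inter> half_plane \<Longrightarrow> local_rep d c \<psi> x \<in> ball x0 r2"
    "\<And>x. x \<in> ball y0 r1 \<inter> half_plane \<Longrightarrow> G (\<phi>1 x) = \<phi>2 (local_rep d c \<psi> x)"
    "continuous_on (\<phi>1 ` (ball y0 r1 \<inter> half_plane)) G"
    "G holomorphic_on \<phi>1 ` (ball y0 r1 \<inter> upper)"
    "\<And>x. x \<in> ball y0 r1 \<inter> upper \<Longrightarrow> norm (deriv G (\<phi>1 x)) = \<sigma> (inv_chart d x)"
    by metis
  have r: "0 < r1" "0 < r2" using 1(1,3) unfolding flat_coord_def by blast+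
  define L' where "L' = local_rep c d \<psi>'"
  note nb = local_rep_neighbourhood[OF p(2-5) \<psi>M r(1), folded x0_def y0_def L'_def]
  obtain r' where r': "0 < r'" "ball x0 r' \<inter> half_plane \<subseteq> cdom c"
    "\<And>x. x \<in> ball x0 r' \<inter> half_plane \<Longrightarrow> \<psi>' (inv_chart c x) \<in> fst d"
    "\<And>x. x \<in> ball x0 r' \<inter> half_plane \<Longrightarrow> L' x \<in> ball y0 r1"
    "continuous_on (ball x0 r' \<inter> half_plane) L'"
    by (rule nb) (rule that; assumption)
  define s where "s = min r2 r'"
  have s: "0 < s" "s \<le> r2" "ball x0 s \<inter> half_plane \<subseteq> ball x0 r' \<inter> half_plane" "ball x0 s \<subseteq> ball x0 r2"
    using r r'(1) by (auto simp: s_def)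
  note \<phi>2 = flat_coord_mono[OF 1(3) s(1,2)]
  note i1 = flat_coord_inverse[OF 1(1)] and i2 = flat_coord_inverse[OF \<phi>2] and i2' = flat_coord_inverse[OF 1(3)]
  define \<gamma> where "\<gamma> = inv_into (ball x0 s) \<phi>2"
  have \<gamma>2: "\<gamma> (\<phi>2 x) = x" if "x \<in> ball x0 s" for x unfolding \<gamma>_def by (rule i2(1)[OF that])
  define G' where "G' z = \<phi>1 (L' (\<gamma> z))" for z
  have fwd: "L' y \<in> ball y0 r1 \<inter> half_plane" "inv_chart d (L' y) = \<psi>' (inv_chart c y)"
    "local_rep d c \<psi> (L' y) = y" "L' y \<in> upper \<longleftrightarrow> y \<in> upper" if "y \<in> ball x0 s \<inter> half_plane" for y
  proof -
    have y: "y \<in> ball x0 r' \<inter> half_plane" using s(3) that by blast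
    note f = r'(3,4)[OF y]
    have yc: "y \<in> cdom c" using r'(2) y by blast
    note lu = local_rep_upper[OF hom' id' p(2,3) yc f(1), folded L'_def]
    show "inv_chart d (L' y) = \<psi>' (inv_chart c y)" "L' y \<in> upper \<longleftrightarrow> y \<in> upper" by (fact lu)+
    show "L' y \<in> ball y0 r1 \<inter> half_plane" using f(2) lu(2) d(4) by blast
    have "inv_chart c y \<in> M" using c(1) c(9)[OF yc] by blast
    then show "local_rep d c \<psi> (L' y) = y"
      unfolding local_rep_def[of d c] o_def lu(1) using homeomorphism_apply2[OF hom] c(10)[OF yc] by simp
  qed
  define \<Omega> where "\<Omega> = \<phi>1 ` (ball y0 r1 \<inter> upper)"
  have op: "open \<Omega>" unfolding \<Omega>_def using open_upper by (intro i1(8)) auto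
  have "inj_on G \<Omega>"
  proof (rule inj_onI)
    fix z z' assume "z \<in> \<Omega>" "z' \<in> \<Omega>" "G z = G z'"
    then obtain x x' where x: "x \<in> ball y0 r1 \<inter> upper" "x' \<in> ball y0 r1 \<inter> upper" "z = \<phi>1 x" "z' = \<phi>1 x'"
      unfolding \<Omega>_def by blast
    then have xh: "x \<in> ball y0 r1 \<inter> half_plane" "x' \<in> ball y0 r1 \<inter> half_plane" using upper_subset by blast+
    then have xd: "x \<in> cdom d" "x' \<in> cdom d" using 1(2) by blast+
    have "\<phi>2 (local_rep d c \<psi> x) = \<phi>2 (local_rep d c \<psi> x')" using \<open>G z = G z'\<close> x 1(7)[OF xh(1)] 1(7)[OF xh(2)] by simp
    then have "local_rep d c \<psi> x = local_rep d c \<psi> x'" using inj_onD[OF i2'(6)] 1(6) xh by blast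
    then have "\<psi> (inv_chart d x) = \<psi> (inv_chart d x')"
      unfolding local_rep_def o_def using inj_onD[OF c(5)] 1(5) xh by blast
    moreover have "inv_chart d x \<in> M" "inv_chart d x' \<in> M" using d(1) d(9)[OF xd(1)] d(9)[OF xd(2)] by auto
    ultimately have "inv_chart d x = inv_chart d x'" using homeomorphism_apply1[OF hom] by metis
    then show "z = z'" using d(10)[OF xd(1)] d(10)[OF xd(2)] x by metis
  qed
  with 1(9)[folded \<Omega>_def] op obtain g where g: "g holomorphic_on (G ` \<Omega>)"
    "\<And>z. z \<in> \<Omega> \<Longrightarrow> deriv G z * deriv g (G z) = 1" "\<And>z. z \<in> \<Omega> \<Longrightarrow> g (G z) = z"
    using holomorphic_has_inverse by metis
  define V where "V = \<phi>2 ` (ball x0 s \<inter> upper)"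
  have opV: "open V" unfolding V_def using open_upper by (intro i2(8)) auto
  have key: "\<phi>1 (L' y) \<in> \<Omega>" "G (\<phi>1 (L' y)) = \<phi>2 y" if "y \<in> ball x0 s \<inter> upper" for y
  proof -
    have y: "y \<in> ball x0 s \<inter> half_plane" using that upper_subset by blast
    show "\<phi>1 (L' y) \<in> \<Omega>" using fwd(1,4)[OF y] that by (auto simp: \<Omega>_def)
    show "G (\<phi>1 (L' y)) = \<phi>2 y" using 1(7)[OF fwd(1)[OF y]] fwd(3)[OF y] by simp
  qed
  have VG: "V \<subseteq> G ` \<Omega>" using key unfolding V_def by (metis (no_types, lifting) image_eqI image_subsetI)
  have eq: "g z = G' z" if zV: "z \<in> V" for z
  proof -
    obtain y where y: "y \<in> ball x0 s \<inter> upper" "z = \<phi>2 y" using zV unfolding V_def by blast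
    then show ?thesis using key[OF y(1)] g(3)[OF key(1)[OF y(1)]] \<gamma>2[of y] by (simp add: G'_def)
  qed
  have gV: "g holomorphic_on V" using g(1) VG by (rule holomorphic_on_subset)
  have holG': "G' holomorphic_on V" using gV eq by (rule holomorphic_transform)
  have cont: "continuous_on (\<phi>2 ` (ball x0 s \<inter> half_plane)) G'"
  proof -
    have im: "\<gamma> ` \<phi>2 ` (ball x0 s \<inter> half_plane) \<subseteq> ball x0 s \<inter> half_plane" using \<gamma>2 by auto
    have a: "continuous_on (\<phi>2 ` (ball x0 s \<inter> half_plane)) \<gamma>"
      using C_inf_on_continuous[OF i2(4)] unfolding \<gamma>_def by (rule continuous_on_subset) blast
    have b: "continuous_on (\<phi>2 ` (ball x0 s \<inter> half_plane)) (\<lambda>z. L' (\<gamma> z))"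
      by (rule continuous_on_compose2[OF r'(5) a]) (use im s(3) in blast)
    show ?thesis unfolding G'_def
      by (rule continuous_on_compose2[OF C_inf_on_continuous[OF i1(7)] b]) (use im fwd(1) in blast)
  qed
  show "\<exists>\<phi>1 \<phi>2 r1 r2 G. flat_rep g2 g1 \<psi>' (\<lambda>q. 1 / \<sigma> (\<psi>' q)) c d p \<phi>1 \<phi>2 r1 r2 G"
    unfolding flat_rep_def x0_def[symmetric] y0_def[symmetric] L'_def[symmetric]
  proof (rule exI[of _ \<phi>2], rule exI[of _ \<phi>1], rule exI[of _ s], rule exI[of _ r1], rule exI[of _ G'],
      intro conjI ballI)
    fix x assume x: "x \<in> ball x0 s \<inter> half_plane"
    show "\<psi>' (inv_chart c x) \<in> fst d" using r'(3) s(3) x by blast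
    show "L' x \<in> ball y0 r1" using fwd(1)[OF x] by blast
    show "G' (\<phi>2 x) = \<phi>1 (L' x)" using \<gamma>2 x by (simp add: G'_def)
  next
    fix x assume x: "x \<in> ball x0 s \<inter> upper"
    then have xh: "x \<in> ball x0 s \<inter> half_plane" using upper_subset by blast
    have "\<phi>2 x \<in> V" using x by (auto simp: V_def)
    then have "deriv G' (\<phi>2 x) = deriv g (\<phi>2 x)"
      using complex_derivative_transform_within_open[OF gV holG' opV _ eq] by simp
    moreover have "deriv G (\<phi>1 (L' x)) * deriv g (\<phi>2 x) = 1"
      using g(2)[OF key(1)[OF x]] key(2)[OF x] by simp
    ultimately have "norm (deriv G (\<phi>1 (L' x))) * norm (deriv G' (\<phi>2 x)) = 1"
      by (metis norm_mult norm_one)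
    moreover have "norm (deriv G (\<phi>1 (L' x))) = \<sigma> (\<psi>' (inv_chart c x))"
      using 1(10)[of "L' x"] fwd[OF xh] x by auto
    ultimately show "norm (deriv G' (\<phi>2 x)) = 1 / \<sigma> (\<psi>' (inv_chart c x))"
      by (metis mult_eq_0_iff nonzero_eq_divide_eq mult.commute zero_neq_one)
  next
    show "ball x0 s \<inter> half_plane \<subseteq> cdom c" using s(3) r'(2) by blast
    show "G' holomorphic_on \<phi>2 ` (ball x0 s \<inter> upper)" using holG' by (simp add: V_def)
  qed (fact \<phi>2 1(1,2) cont)+
qed

text \<open>One chart serves \<open>p\<close> and its image, and \<psi> fixes the edge, so there
  \<open>G\<close> carries \<open>\<phi>1 x\<close> to \<open>\<phi>2 x\<close>. By
  \<open>speed\<close> both coordinates stretch the edge direction at \<open>x0\<close> by the same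
  factor \<alpha>, so difference quotients of \<open>G\<close> along the edge are nearly 1;
  \<open>boundary_derivative_bound\<close> carries this inside.\<close>

lemma conf_data_boundary_limit:
  assumes cd: "conf_data g1 g2 \<psi> \<sigma>" and id: "\<forall>p\<in>bd. \<psi> p = p"
    and speed: "\<And>c x. c \<in> \<A> \<Longrightarrow> x \<in> cdom c \<Longrightarrow> x $ 2 = 0 \<Longrightarrow> g1 c x $ 1 $ 1 = g2 c x $ 1 $ 1"
    and "p \<in> bd" and m: "1 < m"
  obtains N where "openin (top_of_set M) N" "p \<in> N" "\<And>q. q \<in> N - bd \<Longrightarrow> \<sigma> q \<le> m"
proof -
  have pM: "p \<in> M" using \<open>p \<in> bd\<close> by (simp add: boundary_of_def)
  obtain c where cA: "c \<in> \<A>" "p \<in> fst c" using chart_at[OF pM] .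
  note c = is_chart_facts[OF chart[OF cA(1)]]
  have \<psi>p: "\<psi> p = p" using id \<open>p \<in> bd\<close> by blast
  define x0 where "x0 = snd c p"
  have x02: "x0 $ 2 = 0" using boundary_iff[OF cA] \<open>p \<in> bd\<close> by (simp add: x0_def)
  have x0d: "x0 \<in> cdom c" using cA by (simp add: x0_def)
  have "\<psi> p \<in> fst c" using \<psi>p cA by simp
  from conf_dataE[OF cd pM cA(1,1,2) this, unfolded \<psi>p, folded x0_def]
  obtain \<phi>1 \<phi>2 r1 r2 G where 1:
    "flat_coord (g1 c) x0 r1 \<phi>1" "ball x0 r1 \<inter> half_plane \<subseteq> cdom c"
    "flat_coord (g2 c) x0 r2 \<phi>2"
    "\<And>x. x \<in> ball x0 r1 \<inter> half_plane \<Longrightarrow> local_rep c c \<psi> x \<in> ball x0 r2"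
    "\<And>x. x \<in> ball x0 r1 \<inter> half_plane \<Longrightarrow> G (\<phi>1 x) = \<phi>2 (local_rep c c \<psi> x)"
    "continuous_on (\<phi>1 ` (ball x0 r1 \<inter> half_plane)) G"
    "G holomorphic_on \<phi>1 ` (ball x0 r1 \<inter> upper)"
    "\<And>x. x \<in> ball x0 r1 \<inter> upper \<Longrightarrow> norm (deriv G (\<phi>1 x)) = \<sigma> (inv_chart c x)"
    by metis
  have r: "0 < r1" "0 < r2" using 1(1,3) unfolding flat_coord_def by blast+
  note i1 = flat_coord_inverse[OF 1(1)] and i2 = flat_coord_inverse[OF 1(3)]
  have line: "G (\<phi>1 x) = \<phi>2 x" if "x \<in> ball x0 r1" "x $ 2 = 0" for x
  proof -
    have xh: "x \<in> ball x0 r1 \<inter> half_plane" using that by (simp add: half_plane_def)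
    then have xc: "x \<in> cdom c" using 1(2) by blast
    have "inv_chart c x \<in> bd" using boundary_iff[OF cA(1) c(9)[OF xc]] c(10)[OF xc] that by simp
    then have "local_rep c c \<psi> x = x" using id c(10)[OF xc] by (simp add: local_rep_def)
    then show ?thesis using 1(5)[OF xh] by simp
  qed
  define A1 where "A1 = frechet_derivative \<phi>1 (at x0)"
  define A2 where "A2 = frechet_derivative \<phi>2 (at x0)"
  define \<alpha> where "\<alpha> = norm (A1 (axis 1 1))"
  have lin: "linear A1" "linear A2"
    unfolding A1_def A2_def using C_inf_on_has_derivative[OF i1(7), of x0] C_inf_on_has_derivative[OF i2(7), of x0] r
    by (auto intro: has_derivative_linear)
  have x0h: "x0 \<in> half_plane" using x02 by (simp add: half_plane_def)
  have "(norm (A1 (axis 1 1)))\<^sup>2 = g1 c x0 $ 1 $ 1"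
    using 1(1) r x0h unfolding flat_coord_def A1_def by (simp add: quadratic_form_2) (simp add: axis_def)
  moreover have "(norm (A2 (axis 1 1)))\<^sup>2 = g2 c x0 $ 1 $ 1"
    using 1(3) r x0h unfolding flat_coord_def A2_def by (simp add: quadratic_form_2) (simp add: axis_def)
  ultimately have \<alpha>2: "norm (A2 (axis 1 1)) = \<alpha>"
    using speed[OF cA(1) x0d x02] unfolding \<alpha>_def by (metis norm_ge_zero power2_eq_imp_eq)
  have "inj A1" using 1(1) r unfolding flat_coord_def A1_def by simp
  then have \<alpha>: "\<alpha> > 0" using linear_0[OF lin(1)] unfolding \<alpha>_def by (metis axis_eq_0_iff injD zero_less_norm_iff zero_neq_one)
  \<comment> \<open>Chosen so that the bound \<open>(1 + e) ^ 4\<close> equals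
    \<open>m\<close>.\<close>
  define e where "e = m powr (1 / 4) - 1"
  have e: "0 < e" "(1 + e) ^ 4 = m" using m by (auto simp: e_def powr_power)
  have bdry: "\<exists>d>0. \<forall>x\<in>ball x0 d. \<forall>y\<in>ball x0 d. x $ 2 = 0 \<longrightarrow> y $ 2 = 0 \<longrightarrow>
      norm (G (\<phi>1 x) - G (\<phi>1 y)) \<le> (1 + e) * norm (\<phi>1 x - \<phi>1 y)"
  proof -
    \<comment> \<open>The solution of
      \<open>\<alpha> + \<eta> = (1 + e) * (\<alpha> - \<eta>)\<close>: upper estimate for
      \<open>\<phi>2\<close> against lower estimate for \<open>\<phi>1\<close>.\<close>
    define \<eta> where "\<eta> = e * \<alpha> / (2 + e)"
    have \<eta>: "0 < \<eta>" "\<alpha> + \<eta> = (1 + e) * (\<alpha> - \<eta>)" using e(1) \<alpha> by (auto simp: \<eta>_def field_simps)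
    obtain s1 where s1: "0 < s1" "s1 \<le> r1" "\<And>x y. x \<in> ball x0 s1 \<Longrightarrow> y \<in> ball x0 s1 \<Longrightarrow>
        norm (\<phi>1 x - \<phi>1 y - A1 (x - y)) \<le> \<eta> * norm (x - y)"
      using strict_derivative[OF i1(7) r(1) \<eta>(1)] unfolding A1_def by blast
    obtain s2 where s2: "0 < s2" "s2 \<le> r2" "\<And>x y. x \<in> ball x0 s2 \<Longrightarrow> y \<in> ball x0 s2 \<Longrightarrow>
        norm (\<phi>2 x - \<phi>2 y - A2 (x - y)) \<le> \<eta> * norm (x - y)"
      using strict_derivative[OF i2(7) r(2) \<eta>(1)] unfolding A2_def by blast
    show ?thesis
    proof (intro exI[of _ "min s1 s2"] conjI ballI impI)
      show "0 < min s1 s2" using s1 s2 by simp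
      fix x y assume xy: "x \<in> ball x0 (min s1 s2)" "y \<in> ball x0 (min s1 s2)" "x $ 2 = 0" "y $ 2 = 0"
      define l where "l = x $ 1 - y $ 1"
      have l: "x - y = l *\<^sub>R axis 1 1" using xy(3,4) by (simp add: vec_eq_iff forall_2 axis_def l_def)
      have nl: "norm (x - y) = \<bar>l\<bar>" unfolding l by simp
      have nA: "norm (A1 (x - y)) = \<bar>l\<bar> * \<alpha>" "norm (A2 (x - y)) = \<bar>l\<bar> * \<alpha>"
        unfolding l linear_cmul[OF lin(1)] linear_cmul[OF lin(2)] using \<alpha>2 by (auto simp: \<alpha>_def)
      have "norm (G (\<phi>1 x) - G (\<phi>1 y)) = norm (\<phi>2 x - \<phi>2 y)"
        using line xy s1(2) by simp
      also have "\<dots> \<le> norm (A2 (x - y)) + norm (\<phi>2 x - \<phi>2 y - A2 (x - y))"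
        using norm_triangle_ineq[of "A2 (x - y)" "\<phi>2 x - \<phi>2 y - A2 (x - y)"] by simp
      also have "\<dots> \<le> \<bar>l\<bar> * \<alpha> + \<eta> * \<bar>l\<bar>" using s2(3)[of x y] xy(1,2) nA(2) nl by simp
      also have "\<dots> = \<bar>l\<bar> * (\<alpha> + \<eta>)" by (simp add: algebra_simps)
      also have "\<dots> = (1 + e) * (\<bar>l\<bar> * \<alpha> - \<eta> * \<bar>l\<bar>)" unfolding \<eta>(2) by (simp add: algebra_simps)
      also have "\<bar>l\<bar> * \<alpha> - \<eta> * \<bar>l\<bar> \<le> norm (\<phi>1 x - \<phi>1 y)"
      proof -
        have "norm (A1 (x - y)) \<le> norm (\<phi>1 x - \<phi>1 y) + norm (\<phi>1 x - \<phi>1 y - A1 (x - y))"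
          using norm_triangle_ineq4[of "\<phi>1 x - \<phi>1 y" "\<phi>1 x - \<phi>1 y - A1 (x - y)"] by simp
        then show ?thesis using s1(3)[of x y] xy(1,2) nA(1) nl by simp
      qed
      finally show "norm (G (\<phi>1 x) - G (\<phi>1 y)) \<le> (1 + e) * norm (\<phi>1 x - \<phi>1 y)" using e(1) by simp
    qed
  qed
  have injD: "inj (frechet_derivative \<phi>1 (at x0))" using \<open>inj A1\<close> unfolding A1_def .
  obtain d where d: "0 < d" "d \<le> r1" "\<And>x. x \<in> ball x0 d \<inter> upper \<Longrightarrow> norm (deriv G (\<phi>1 x)) \<le> (1 + e) ^ 4"
    using boundary_derivative_bound[OF i1(7) r(1) x02 i1(6) injD 1(6,7) bdry e(1)] by blast
  define N where "N = fst c \<inter> snd c -` ball x0 d"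
  show ?thesis
  proof (rule that[of N])
    have "openin (top_of_set (fst c)) N" unfolding N_def
      by (rule continuous_openin_preimage_gen[OF c(6)]) simp
    then show "openin (top_of_set M) N" using c(2) openin_trans by blast
    show "p \<in> N" using cA d(1) by (simp add: N_def x0_def)
    fix q assume q: "q \<in> N - bd"
    then have "q \<in> fst c" by (simp add: N_def)
    have qx: "snd c q \<in> cdom c" "inv_chart c (snd c q) = q" using c(8)[OF \<open>q \<in> fst c\<close>] \<open>q \<in> fst c\<close> by auto
    have "q \<in> M" using c(1) \<open>q \<in> fst c\<close> by blast
    then have "snd c q \<in> ball x0 d \<inter> upper" using upper_iff[OF cA(1) qx(1)] qx(2) q by (auto simp: N_def)
    moreover from this have "snd c q \<in> ball x0 r1 \<inter> upper" using d(2) by auto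
    ultimately show "\<sigma> q \<le> m" using d(3)[of "snd c q"] 1(8)[of "snd c q"] e(2) qx(2) by simp
  qed
qed

end

section \<open>From equal arc length to equal metric coefficients along the boundary\<close>

lemma smooth_on_continuous:
  assumes "smooth_on D f"
  shows "continuous_on D f"
  unfolding continuous_on_eq_continuous_within
proof
  fix x assume x: "x \<in> D"
  obtain W F where W: "open W" "x \<in> W" "C_inf_on F W" "\<And>y. y \<in> W \<inter> D \<Longrightarrow> F y = f y"
    using bspec[OF assms[unfolded smooth_on_def] x] by metis
  obtain e where e: "e > 0" "ball x e \<subseteq> W" using openE[OF W(1,2)] .
  have "isCont F x" using C_inf_on_continuous[OF W(3)] W(1,2) by (simp add: continuous_on_eq_continuous_at)
  then have "continuous (at x within D) F" by (rule continuous_at_imp_continuous_at_within)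
  then show "continuous (at x within D) f"
    by (rule continuous_transform_within[OF _ e(1) x]) (use W(4) e(2) in \<open>auto simp: dist_commute subset_iff\<close>)
qed

context bordered_surface
begin

lemma local_dom_eq:
  assumes "c \<in> \<A>"
  shows "local_dom M c d \<psi> = {x \<in> cdom c. \<psi> (inv_chart c x) \<in> fst d}"
proof -
  note c = is_chart_facts[OF chart[OF assms]]
  show ?thesis unfolding local_dom_def using c(1,8,9,10) by (auto 0 3 intro!: image_eqI)
qed

lemma openin_local_dom:
  assumes "c \<in> \<A>" "d \<in> \<A>" "continuous_on M \<psi>" "\<psi> ` M \<subseteq> M"
  shows "openin (top_of_set half_plane) (local_dom M c d \<psi>)"
  unfolding local_dom_eq[OF assms(1)]
  by (rule openin_chart_preimage[OF assms(1) is_chart_facts(2)[OF chart[OF assms(2)]] assms(3,4)])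

text \<open>The Jacobian is taken within the domain, also at edge points; by uniqueness of that
  derivative it may be computed from any smooth extension.\<close>

lemma local_jac_extension:
  assumes "c \<in> \<A>" "d \<in> \<A>" "continuous_on M \<psi>" "\<psi> ` M \<subseteq> M" "x \<in> local_dom M c d \<psi>"
    and W: "open W" "x \<in> W" "C_inf_on F W" "\<And>y. y \<in> W \<inter> local_dom M c d \<psi> \<Longrightarrow> F y = local_rep c d \<psi> y"
  shows "local_jac M c d \<psi> x *v v = frechet_derivative F (at x) v"
proof -
  have dF: "(F has_derivative frechet_derivative F (at x)) (at x)" using W(3,2) by (rule C_inf_on_has_derivative)
  obtain e where e: "e > 0" "ball x e \<subseteq> W" using openE[OF W(1,2)] .
  have "(local_rep c d \<psi> has_derivative frechet_derivative F (at x)) (at x within local_dom M c d \<psi>)"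
    by (rule has_derivative_transform_within[OF has_derivative_at_withinI[OF dF] e(1) assms(5)])
      (use W(4) e(2) in \<open>auto simp: dist_commute subset_iff\<close>)
  then have eq: "frechet_derivative (local_rep c d \<psi>) (at x within local_dom M c d \<psi>) = frechet_derivative F (at x)"
    by (rule frechet_derivative_half_plane[OF openin_local_dom[OF assms(1-4)] assms(5)])
  show ?thesis
    unfolding local_jac_def eq using has_derivative_linear[OF dF] by (simp add: matrix_works)
qed

text \<open>The coordinate line from \<open>x\<close> along the edge is a curve in the boundary. Its
  initial pieces have equal lengths in both metrics, and differentiating in the end point gives
  equal speeds at \<open>x\<close>.\<close>

lemma boundary_speed:
  assumes g: "riemannian_metric M \<A> g1" "riemannian_metric M \<A> g2"
    and same: "same_arc_length bd \<A> g1 g2" and cA: "c \<in> \<A>" and x: "x \<in> cdom c" "x $ 2 = 0"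
  shows "g1 c x $ 1 $ 1 = g2 c x $ 1 $ 1"
proof -
  note c = is_chart_facts[OF chart[OF cA]]
  obtain r where r: "0 < r" "ball x r \<inter> half_plane \<subseteq> cdom c" using openin_half_plane_ball[OF c(3) x(1)] .
  define P :: "real \<Rightarrow> real^2" where "P t = x + (t - x $ 1) *\<^sub>R axis 1 1" for t
  have P2: "P t $ 2 = 0" "P (x $ 1) = x" for t using x(2) by (auto simp: P_def axis_def)
  define a where "a = x $ 1"
  define b where "b = x $ 1 + r / 2"
  have ab: "a < b" using r by (simp add: a_def b_def)
  have Pd: "P t \<in> cdom c" if "t \<in> {a..b}" for t
  proof -
    have "P t \<in> ball x r" using that r(1) by (auto simp: P_def dist_norm a_def b_def)
    then show ?thesis using r(2) P2(1) by (auto simp: half_plane_def)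
  qed
  have contP: "continuous_on S P" for S unfolding P_def by (intro continuous_intros)
  define \<gamma> where "\<gamma> t = inv_chart c (P t)" for t
  have \<gamma>bd: "\<gamma> t \<in> bd" "\<gamma> t \<in> fst c" "\<gamma> t \<in> M" if "t \<in> {a..b}" for t
    using boundary_iff[OF cA c(9)[OF Pd[OF that]]] c(9,10)[OF Pd[OF that]] P2(1) c(1) by (auto simp: \<gamma>_def)
  have cid: "continuous_on M id" "id ` M \<subseteq> M" by auto
  have ldom: "P t \<in> local_dom M c d id \<longleftrightarrow> \<gamma> t \<in> fst d" if "t \<in> {a..b}" for t d
    using Pd[OF that] by (simp add: local_dom_eq[OF cA] \<gamma>_def)
  have rep: "local_rep c d id (P t) = (snd d \<circ> \<gamma>) t" for d t by (simp add: local_rep_def \<gamma>_def)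
  have ext: "\<exists>W F. open W \<and> P t \<in> W \<and> C_inf_on F W \<and> (\<forall>y\<in>W \<inter> local_dom M c d id. F y = local_rep c d id y)"
    if "t \<in> {a..b}" "d \<in> \<A>" "\<gamma> t \<in> fst d" for t d
  proof -
    have "smooth_on (local_dom M c d id) (local_rep c d id)"
      using surface cA that(2) unfolding smooth_surface_def by blast
    from bspec[OF this[unfolded smooth_on_def], of "P t"] show ?thesis using ldom[OF that(1)] that(3) by blast
  qed
  have curve: "smooth_curve \<A> a' b' \<gamma>" if "a \<le> a'" "a' < b'" "b' \<le> b" for a' b'
    unfolding smooth_curve_def
  proof (intro conjI ballI)
    have sub: "{a'..b'} \<subseteq> {a..b}" using that by auto
    show "continuous_on {a'..b'} \<gamma>" unfolding \<gamma>_def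
      by (rule continuous_on_compose2[OF c(7) contP]) (use Pd sub in blast)
    fix d assume d: "d \<in> \<A>"
    show "smooth_on {t \<in> {a'..b'}. \<gamma> t \<in> fst d} (snd d \<circ> \<gamma>)"
      unfolding smooth_on_def
    proof
      fix t assume t: "t \<in> {t \<in> {a'..b'}. \<gamma> t \<in> fst d}"
      then have tab: "t \<in> {a..b}" using sub by blast
      obtain W F where W: "open W" "P t \<in> W" "C_inf_on F W" "\<forall>y\<in>W \<inter> local_dom M c d id. F y = local_rep c d id y"
        using ext[OF tab d] t by blast
      have op: "open (P -` W)" by (rule open_vimage[OF W(1) contP])
      have "C_k_on k P (P -` W)" for k
      proof -
        have "C_k_on k (\<lambda>t. x + (t - x $ 1) *\<^sub>R axis 1 1) (P -` W)"
          using C_k_on_bounded_linear[OF bounded_linear_ident op]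
          by (intro C_k_on_add[OF op] C_k_on_scaleR[OF op] C_k_on_diff[OF op] C_k_on_const) auto
        then show ?thesis unfolding P_def[abs_def] .
      qed
      then have "C_k_on k (\<lambda>t. F (P t)) (P -` W)" for k
        by (intro C_k_on_compose[OF op W(1), of P k F]) (use W(3) in auto)
      moreover have "F (P s) = (snd d \<circ> \<gamma>) s" if "s \<in> P -` W \<inter> {t \<in> {a'..b'}. \<gamma> t \<in> fst d}" for s
      proof -
        have "s \<in> {a..b}" using that sub by blast
        then have "P s \<in> W \<inter> local_dom M c d id" using ldom that by auto
        then show ?thesis using W(4) rep by metis
      qed
      ultimately show "\<exists>W F. open W \<and> t \<in> W \<and> (\<forall>k. C_k_on k F W) \<and>
          (\<forall>s\<in>W \<inter> {t \<in> {a'..b'}. \<gamma> t \<in> fst d}. F s = (snd d \<circ> \<gamma>) s)"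
        using op W(2) by (intro exI[of _ "P -` W"] exI[of _ "\<lambda>t. F (P t)"]) auto
    qed
  qed (use that in auto)
  \<comment> \<open>\<open>curve_speed\<close> computes in an arbitrarily chosen chart
    \<open>e\<close>; the transition map and the transformation law of the metric bring the result
    back to \<open>c\<close>.\<close>
  have speed: "curve_speed \<A> g a' b' \<gamma> t = sqrt (g c (P t) $ 1 $ 1)"
    if g: "riemannian_metric M \<A> g" and t': "a \<le> a'" "a' < b'" "b' \<le> b" and t: "t \<in> {a'..b'}" for g a' b' t
  proof -
    have tab: "t \<in> {a..b}" using t t' by auto
    define e where "e = (SOME e. e \<in> \<A> \<and> \<gamma> t \<in> fst e)"
    have e: "e \<in> \<A>" "\<gamma> t \<in> fst e"
      unfolding e_def using someI[of "\<lambda>e. e \<in> \<A> \<and> \<gamma> t \<in> fst e" c] cA \<gamma>bd(2)[OF tab] by blast+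
    define T where "T = {s \<in> {a'..b'}. \<gamma> s \<in> fst e}"
    obtain W F where W: "open W" "P t \<in> W" "C_inf_on F W" "\<forall>y\<in>W \<inter> local_dom M c e id. F y = local_rep c e id y"
      using ext[OF tab e] by blast
    have Pt: "P t \<in> local_dom M c e id" using ldom[OF tab] e(2) by blast
    obtain \<epsilon> where \<epsilon>: "0 < \<epsilon>" "ball (P t) \<epsilon> \<inter> half_plane \<subseteq> local_dom M c e id"
      using openin_half_plane_ball[OF openin_local_dom[OF cA e(1) cid] Pt] .
    have dP: "dist (P s) (P t) = dist s t" for s
    proof -
      have "P s - P t = (s - t) *\<^sub>R axis 1 1" by (simp add: P_def algebra_simps)
      then show ?thesis by (simp add: dist_norm)
    qed
    have T: "s \<in> T" if "s \<in> {a'..b'}" "dist s t < \<epsilon>" for s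
    proof -
      have "P s \<in> ball (P t) \<epsilon> \<inter> half_plane" using that(2) dP[of s] P2(1) by (simp add: dist_commute half_plane_def)
      then have "P s \<in> local_dom M c e id" using \<epsilon>(2) by blast
      then show ?thesis using that(1) ldom[of s e] t' by (simp add: T_def)
    qed
    have "at t within T = at t within {a'..b'}"
      by (rule at_within_nhd[of t "ball t \<epsilon>"]) (use \<epsilon>(1) T in \<open>auto simp: T_def dist_commute\<close>)
    moreover have "at t within {a'..b'} \<noteq> bot"
      using islimpt_Icc[OF t'(2)] t by (simp add: trivial_limit_within)
    ultimately have nb: "at t within T \<noteq> bot" by simp
    have dF: "(F has_derivative frechet_derivative F (at (P t))) (at (P t))" using W(3,2) by (rule C_inf_on_has_derivative)
    have "(P has_derivative (\<lambda>h. h *\<^sub>R axis 1 1)) (at t)"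
      unfolding P_def[abs_def] by (auto intro!: derivative_eq_intros)
    from diff_chain_at[OF this dF]
    have "((\<lambda>s. F (P s)) has_vector_derivative frechet_derivative F (at (P t)) (axis 1 1)) (at t)"
      by (simp add: has_vector_derivative_def o_def linear_cmul[OF has_derivative_linear[OF dF]])
    then have vF: "((\<lambda>s. F (P s)) has_vector_derivative frechet_derivative F (at (P t)) (axis 1 1)) (at t within T)"
      by (rule has_vector_derivative_at_within)
    obtain \<delta> where \<delta>: "0 < \<delta>" "ball (P t) \<delta> \<subseteq> W" using openE[OF W(1,2)] .
    have tT: "t \<in> T" using t e(2) by (simp add: T_def)
    have "((snd e \<circ> \<gamma>) has_vector_derivative frechet_derivative F (at (P t)) (axis 1 1)) (at t within T)"
    proof (rule has_vector_derivative_transform_within[OF vF \<delta>(1) tT])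
      fix s assume s: "s \<in> T" "dist s t < \<delta>"
      then have "P s \<in> W" using \<delta>(2) dP[of s] by (auto simp: dist_commute subset_iff)
      moreover have "P s \<in> local_dom M c e id" using s(1) ldom[of s e] t' by (auto simp: T_def)
      ultimately show "F (P s) = (snd e \<circ> \<gamma>) s" using W(4) rep by (metis IntI)
    qed
    then have "vector_derivative (snd e \<circ> \<gamma>) (at t within T) = frechet_derivative F (at (P t)) (axis 1 1)"
      by (rule vector_derivative_within[OF nb])
    also have "\<dots> = local_jac M c e id (P t) *v axis 1 1"
      using local_jac_extension[OF cA e(1) cid Pt W(1-3)] W(4) by simp
    finally have v: "vector_derivative (snd e \<circ> \<gamma>) (at t within T) = local_jac M c e id (P t) *v axis 1 1" .
    have "curve_speed \<A> g a' b' \<gamma> t = sqrt ((local_jac M c e id (P t) *v axis 1 1) \<bullet>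
        (g e (local_rep c e id (P t)) *v (local_jac M c e id (P t) *v axis 1 1)))"
      unfolding curve_speed_def e_def[symmetric] Let_def T_def[symmetric] v rep by simp
    also have "\<dots> = sqrt (axis 1 1 \<bullet> (pullback M c e id g (P t) *v axis 1 1))"
      unfolding pullback_def inner_pullback ..
    also have "pullback M c e id g (P t) = g c (P t)"
      using g cA e(1) Pt unfolding riemannian_metric_def by metis
    also have "axis 1 1 \<bullet> (g c (P t) *v axis 1 1) = g c (P t) $ 1 $ 1"
      unfolding quadratic_form_2 by (simp add: axis_def)
    finally show ?thesis .
  qed
  define h where "h g t = sqrt (g c (P t) $ 1 $ 1)" for g :: "'a metric" and t
  have len: "curve_length \<A> g a b' \<gamma> = integral {a..b'} (h g)" if "riemannian_metric M \<A> g" "a < b'" "b' \<le> b" for g b'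
    unfolding curve_length_def h_def by (rule integral_cong) (rule speed[OF that(1) order_refl that(2,3)])
  have eq: "integral {a..u} (h g1) = integral {a..u} (h g2)" if "u \<in> {a..b}" for u
  \<comment> \<open>A curve has a parameter interval of positive length, so the trivial piece is
    treated apart.\<close>
  proof (cases "u = a")
    case False
    then have u: "a < u" "u \<le> b" using that by auto
    have "\<gamma> ` {a..u} \<subseteq> bd" using \<gamma>bd(1) u(2) by auto
    then have "curve_length \<A> g1 a u \<gamma> = curve_length \<A> g2 a u \<gamma>"
      using same curve[OF order_refl u] unfolding same_arc_length_def by blast
    then show ?thesis using len[OF g(1) u] len[OF g(2) u] by simp
  qed simp
  have conth: "continuous_on {a..b} (h g)" if "riemannian_metric M \<A> g" for g
  proof -
    have "continuous_on (cdom c) (g c)" using that cA smooth_on_continuous unfolding riemannian_metric_def by blast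
    then have "continuous_on {a..b} (\<lambda>t. g c (P t))"
      by (rule continuous_on_compose2[OF _ contP]) (use Pd in blast)
    then show ?thesis unfolding h_def by (intro continuous_intros)
  qed
  \<comment> \<open>The curve starts at \<open>x\<close>, so the one-sided derivative at
    \<open>a\<close> is enough.\<close>
  have deriv: "((\<lambda>u. integral {a..u} (h g)) has_vector_derivative h g a) (at a within {a..b})"
    if "riemannian_metric M \<A> g" for g
    using integral_has_vector_derivative[OF conth[OF that], of a] ab by auto
  have "((\<lambda>u. integral {a..u} (h g1)) has_vector_derivative h g2 a) (at a within {a..b})"
    by (rule has_vector_derivative_transform_within[OF deriv[OF g(2)] zero_less_one]) (use eq ab in auto)
  then have "h g1 a = h g2 a"
    using vector_derivative_unique_within_closed_interval[of a b a] deriv[OF g(1)] ab by (simp add: cbox_interval)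
  then show ?thesis by (simp add: h_def a_def P2)
qed

end

section \<open>The maximum principle on the surface, and rigidity\<close>

lemma symmetric_matrix_eqI:
  fixes A C :: "real^2^2"
  assumes "transpose A = A" "transpose C = C" "\<And>v. v \<bullet> (A *v v) = v \<bullet> (C *v v)"
  shows "A = C"
proof -
  have s: "A $ 2 $ 1 = A $ 1 $ 2" "C $ 2 $ 1 = C $ 1 $ 2"
    using arg_cong[OF assms(1), of "\<lambda>X. X $ 2 $ 1"] arg_cong[OF assms(2), of "\<lambda>X. X $ 2 $ 1"]
    by (auto simp: transpose_def)
  show ?thesis
    using assms(3)[of "axis 1 1"] assms(3)[of "axis 2 1"] assms(3)[of "vector [1, 1]"] s
    unfolding quadratic_form_2 vec_eq_iff forall_2 by (simp add: axis_def)
qed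

context bordered_surface
begin

text \<open>Writing \<sigma> near an interior point as the modulus of a holomorphic function, here
  \<open>deriv G\<close>, yields both its continuity and a local maximum principle.\<close>

lemma conf_factor_local:
  assumes cd: "conf_data g1 g2 \<psi> \<sigma>" and \<psi>: "\<psi> ` M \<subseteq> M" and z: "z \<in> M - bd"
  obtains N f D \<Omega> where "openin (top_of_set M) N" "z \<in> N" "N \<subseteq> M - bd" "continuous_on N f" "f ` N = \<Omega>"
    "open \<Omega>" "connected \<Omega>" "D holomorphic_on \<Omega>" "\<And>w. w \<in> N \<Longrightarrow> \<sigma> w = norm (D (f w))"
proof -
  have zM: "z \<in> M" "\<psi> z \<in> M" using z \<psi> by auto
  obtain c where cA: "c \<in> \<A>" "z \<in> fst c" using chart_at[OF zM(1)] .
  obtain d where dA: "d \<in> \<A>" "\<psi> z \<in> fst d" using chart_at[OF zM(2)] .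
  note c = is_chart_facts[OF chart[OF cA(1)]]
  define x0 where "x0 = snd c z"
  from conf_dataE[OF cd zM(1) cA(1) dA(1) cA(2) dA(2), folded x0_def]
  obtain \<phi> r G where 1: "flat_coord (g1 c) x0 r \<phi>" "ball x0 r \<inter> half_plane \<subseteq> cdom c"
    "G holomorphic_on \<phi> ` (ball x0 r \<inter> upper)"
    "\<And>x. x \<in> ball x0 r \<inter> upper \<Longrightarrow> norm (deriv G (\<phi> x)) = \<sigma> (inv_chart c x)"
    by metis
  note i = flat_coord_inverse[OF 1(1)]
  have r: "0 < r" using 1(1) unfolding flat_coord_def by blast
  define U where "U = ball x0 r \<inter> upper"
  have U: "open U" "connected U" "U \<subseteq> ball x0 r" "U \<subseteq> cdom c"
    using open_upper upper_subset 1(2) unfolding U_def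
    by (auto intro!: convex_connected convex_Int convex_upper)
  define N where "N = fst c \<inter> snd c -` U"
  have inv: "inv_chart c (snd c w) = w" if "w \<in> N" for w using c(8) that by (simp add: N_def)
  have opU: "open (\<phi> ` U)" using i(8)[OF U(1,3)] .
  show ?thesis
  proof (rule that[of N "\<lambda>w. \<phi> (snd c w)" "\<phi> ` U" "deriv G"])
    have "openin (top_of_set (fst c)) N" unfolding N_def
      by (rule continuous_openin_preimage_gen[OF c(6) U(1)])
    then show "openin (top_of_set M) N" using c(2) openin_trans by blast
    have "x0 \<in> cdom c" "inv_chart c x0 = z" using cA(2) c(8) by (auto simp: x0_def)
    then have "x0 \<in> upper" using upper_iff[OF cA(1)] z by metis
    then show "z \<in> N" using cA(2) r by (simp add: N_def U_def x0_def)
    show "N \<subseteq> M - bd"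
    proof
      fix w assume w: "w \<in> N"
      then have "snd c w \<in> cdom c" "snd c w \<in> upper" by (auto simp: N_def U_def)
      then show "w \<in> M - bd" using upper_iff[OF cA(1)] inv[OF w] by metis
    qed
    show "continuous_on N (\<lambda>w. \<phi> (snd c w))"
    proof (rule continuous_on_compose2[OF C_inf_on_continuous[OF i(7)]])
      show "continuous_on N (snd c)" using c(6) by (rule continuous_on_subset) (auto simp: N_def)
      show "snd c ` N \<subseteq> ball x0 r" using U(3) by (auto simp: N_def)
    qed
    have "snd c ` N = U" using U(4) by (auto simp: N_def)
    then show "(\<lambda>w. \<phi> (snd c w)) ` N = \<phi> ` U" by (metis image_image)
    show "connected (\<phi> ` U)"
      using C_inf_on_continuous[OF i(7)] U(2,3) by (intro connected_continuous_image) (auto intro: continuous_on_subset)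
    show "deriv G holomorphic_on \<phi> ` U" using 1(3) opU unfolding U_def by (rule holomorphic_deriv)
    show "\<sigma> w = norm (deriv G (\<phi> (snd c w)))" if "w \<in> N" for w
      using 1(4)[of "snd c w"] inv[OF that] that by (simp add: N_def U_def)
  qed (rule opU)
qed

text \<open>As \<sigma> has no boundary values, a maximum over \<open>M\<close> is not directly
  available. If \<sigma> exceeds a level \<open>m > 1\<close> somewhere, an open set around the
  boundary where it stays below \<open>m\<close> is discarded; on the compact rest the maximum is
  attained. The set of maximum points is then open and closed in \<open>M\<close> but misses the
  boundary.\<close>

lemma conf_factor_le_1:
  assumes M: "compact M" "connected M" "bd \<noteq> {}"
    and cd: "conf_data g1 g2 \<psi> \<sigma>" and \<psi>: "\<psi> ` M \<subseteq> M" and id: "\<forall>p\<in>bd. \<psi> p = p"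
    and speed: "\<And>c x. c \<in> \<A> \<Longrightarrow> x \<in> cdom c \<Longrightarrow> x $ 2 = 0 \<Longrightarrow> g1 c x $ 1 $ 1 = g2 c x $ 1 $ 1"
    and q: "q \<in> M - bd"
  shows "\<sigma> q \<le> 1"
proof (rule ccontr)
  assume "\<not> \<sigma> q \<le> 1"
  define m where "m = (1 + \<sigma> q) / 2"
  have m: "1 < m" "m < \<sigma> q" using \<open>\<not> \<sigma> q \<le> 1\<close> by (auto simp: m_def)
  \<comment> \<open>The union of all relatively open sets on which \<open>m\<close> is a bound;
    \<open>conf_data_boundary_limit\<close> puts every boundary point into it.\<close>
  define X where "X = \<Union>{N. openin (top_of_set M) N \<and> (\<forall>w\<in>N - bd. \<sigma> w \<le> m)}"
  have bM: "bd \<subseteq> M" by (auto simp: boundary_of_def)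
  have opX: "openin (top_of_set M) X" unfolding X_def by (rule openin_Union) blast
  have X: "\<sigma> w \<le> m" if "w \<in> X - bd" for w using that by (auto simp: X_def)
  have bX: "bd \<subseteq> X"
  proof
    fix p assume p: "p \<in> bd"
    obtain N where "openin (top_of_set M) N" "p \<in> N" "\<And>w. w \<in> N - bd \<Longrightarrow> \<sigma> w \<le> m"
      by (rule conf_data_boundary_limit[OF cd id speed p m(1)]) (assumption+, rule that, assumption+)
    then show "p \<in> X" unfolding X_def by blast
  qed
  define K where "K = M - X"
  have clK: "closedin (top_of_set M) K" unfolding K_def using opX by (simp add: closedin_diff)
  have K: "compact K" "K \<subseteq> M - bd" "q \<in> K"
  proof -
    show "compact K" using closedin_compact[OF M(1) clK] .
    show "K \<subseteq> M - bd" using bX by (auto simp: K_def)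
    show "q \<in> K" using q X[of q] m(2) by (auto simp: K_def)
  qed
  have cont: "continuous_on K \<sigma>"
    unfolding continuous_on_topological
  proof (intro ballI allI impI)
    fix z B assume z: "z \<in> K" "open B" "\<sigma> z \<in> B"
    then have "z \<in> M - bd" using K(2) by blast
    then obtain N f D \<Omega> where N: "openin (top_of_set M) N" "z \<in> N" "continuous_on N f" "f ` N = \<Omega>"
      "D holomorphic_on \<Omega>" "\<And>w. w \<in> N \<Longrightarrow> \<sigma> w = norm (D (f w))"
      using conf_factor_local[OF cd \<psi>] by metis
    have "continuous_on N (\<lambda>w. norm (D (f w)))"
      by (intro continuous_intros continuous_on_compose2[OF holomorphic_on_imp_continuous_on[OF N(5)] N(3)]) (use N(4) in blast)
    then have "continuous_on N \<sigma>" by (rule continuous_on_eq) (use N(6) in simp)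
    then obtain A where A: "open A" "z \<in> A" "\<forall>y\<in>N. y \<in> A \<longrightarrow> \<sigma> y \<in> B"
      using z N(2) unfolding continuous_on_topological by meson
    obtain T where T: "open T" "N = M \<inter> T" using N(1) by (auto simp: openin_open)
    show "\<exists>A. open A \<and> z \<in> A \<and> (\<forall>y\<in>K. y \<in> A \<longrightarrow> \<sigma> y \<in> B)"
      using A T N(2) K(2) by (intro exI[of _ "A \<inter> T"]) auto
  qed
  obtain z0 where z0: "z0 \<in> K" "\<And>w. w \<in> K \<Longrightarrow> \<sigma> w \<le> \<sigma> z0"
    using continuous_attains_sup[OF K(1) _ cont] K(3) by blast
  have z0m: "m < \<sigma> z0" using z0(2)[OF K(3)] m(2) by simp
  have max: "\<sigma> w \<le> \<sigma> z0" if "w \<in> M - bd" for w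
    using X[of w] z0(2)[of w] z0m that by (cases "w \<in> X") (auto simp: K_def)
  define Z where "Z = {w \<in> K. \<sigma> w = \<sigma> z0}"
  have "closedin (top_of_set K) Z" unfolding Z_def by (rule continuous_closedin_preimage_constant[OF cont])
  then have closed: "closedin (top_of_set M) Z" using clK closedin_trans by blast
  have "openin (top_of_set M) Z"
  proof (subst openin_subopen, rule ballI)
    fix z assume z: "z \<in> Z"
    then have "z \<in> M - bd" using K(2) by (auto simp: Z_def)
    then obtain N f D \<Omega> where N: "openin (top_of_set M) N" "z \<in> N" "N \<subseteq> M - bd" "f ` N = \<Omega>" "open \<Omega>" "connected \<Omega>"
      "D holomorphic_on \<Omega>" "\<And>w. w \<in> N \<Longrightarrow> \<sigma> w = norm (D (f w))"
      using conf_factor_local[OF cd \<psi>] by metis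
    have "D constant_on \<Omega>"
    proof (rule maximum_modulus_principle[OF N(7,5,6,5) order_refl])
      show "f z \<in> \<Omega>" using N(2,4) by blast
      fix y assume "y \<in> \<Omega>"
      then obtain w where "w \<in> N" "y = f w" using N(4) by blast
      then show "norm (D y) \<le> norm (D (f z))"
        using N(8)[of w] N(8)[OF N(2)] max[of w] N(3) z by (auto simp: Z_def)
    qed
    then have eq: "\<sigma> w = \<sigma> z0" if "w \<in> N" for w
      using N(8)[OF that] N(8)[OF N(2)] N(2,4) that z unfolding constant_on_def Z_def by auto
    have "N \<subseteq> Z"
    proof
      fix w assume w: "w \<in> N"
      \<comment> \<open>On \<open>X\<close> the factor is at most \<open>m\<close>, which is less
        than the maximum.\<close>
      then have "w \<notin> X" using X[of w] eq[OF w] z0m N(3) by fastforce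
      then show "w \<in> Z" using w eq[OF w] N(3) by (auto simp: Z_def K_def)
    qed
    then show "\<exists>T. openin (top_of_set M) T \<and> z \<in> T \<and> T \<subseteq> Z" using N(1,2) by blast
  qed
  then have "Z = {} \<or> Z = M" using M(2) closed unfolding connected_clopen by blast
  moreover have "z0 \<in> Z" using z0(1) by (simp add: Z_def)
  moreover have "Z \<inter> bd = {}" using K(2) by (auto simp: Z_def)
  ultimately show False using M(3) bM by auto
qed

text \<open>In flat coordinates a conformal map with constant factor 1 is a rigid motion \<open>w \<mapsto> a w + b\<close>, so it is smooth up
  to the boundary because the flat coordinates are.\<close>

lemma isometry_local:
  assumes cd: "conf_data g1 g2 \<psi> \<sigma>" and one: "\<And>q. q \<in> M - bd \<Longrightarrow> \<sigma> q = 1"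
    and \<psi>: "continuous_on M \<psi>" "\<psi> ` M \<subseteq> M"
    and A: "c \<in> \<A>" "d \<in> \<A>" and x0: "x0 \<in> local_dom M c d \<psi>"
  obtains W F where "open W" "x0 \<in> W" "C_inf_on F W" "\<And>y. y \<in> W \<inter> local_dom M c d \<psi> \<Longrightarrow> F y = local_rep c d \<psi> y"
    "\<And>v. frechet_derivative F (at x0) v \<bullet> (g2 d (local_rep c d \<psi> x0) *v frechet_derivative F (at x0) v) = v \<bullet> (g1 c x0 *v v)"
proof -
  note c = is_chart_facts[OF chart[OF A(1)]] and d = is_chart_facts[OF chart[OF A(2)]]
  have x0': "x0 \<in> cdom c" "\<psi> (inv_chart c x0) \<in> fst d" using x0 unfolding local_dom_eq[OF A(1)] by auto
  define p where "p = inv_chart c x0"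
  have p: "p \<in> M" "p \<in> fst c" "\<psi> p \<in> fst d" "snd c p = x0" using c(1,9,10) x0' by (auto simp: p_def)
  define L where "L = local_rep c d \<psi>"
  define y0 where "y0 = snd d (\<psi> p)"
  have y0: "L x0 = y0" by (simp add: L_def local_rep_def y0_def p_def)
  from conf_dataE[OF cd p(1) A p(2,3), unfolded p(4), folded y0_def L_def]
  obtain \<phi>1 \<phi>2 r1 r2 G where 1:
    "flat_coord (g1 c) x0 r1 \<phi>1" "ball x0 r1 \<inter> half_plane \<subseteq> cdom c"
    "flat_coord (g2 d) y0 r2 \<phi>2" "ball y0 r2 \<inter> half_plane \<subseteq> cdom d"
    "\<And>x. x \<in> ball x0 r1 \<inter> half_plane \<Longrightarrow> L x \<in> ball y0 r2"
    "\<And>x. x \<in> ball x0 r1 \<inter> half_plane \<Longrightarrow> G (\<phi>1 x) = \<phi>2 (L x)"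
    "continuous_on (\<phi>1 ` (ball x0 r1 \<inter> half_plane)) G"
    "G holomorphic_on \<phi>1 ` (ball x0 r1 \<inter> upper)"
    "\<And>x. x \<in> ball x0 r1 \<inter> upper \<Longrightarrow> norm (deriv G (\<phi>1 x)) = \<sigma> (inv_chart c x)"
    by metis
  note i1 = flat_coord_inverse[OF 1(1)] and i2 = flat_coord_inverse[OF 1(3)]
  have r: "0 < r1" "0 < r2" using 1(1,3) unfolding flat_coord_def by blast+
  define U where "U = ball x0 r1 \<inter> upper"
  have U: "open U" "connected U" "U \<subseteq> ball x0 r1" "U \<subseteq> cdom c"
    using open_upper upper_subset 1(2) unfolding U_def
    by (auto intro!: convex_connected convex_Int convex_upper)
  define \<Omega> where "\<Omega> = \<phi>1 ` U"
  have x0h: "x0 \<in> half_plane" using x0'(1) c(4) by blast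
  obtain u where u: "u \<in> U" using half_plane_approach[OF x0h r(1)] unfolding U_def by (metis IntI)
  have \<Omega>: "open \<Omega>" "connected \<Omega>" "\<phi>1 u \<in> \<Omega>" "\<Omega> \<noteq> {}"
    using i1(8)[OF U(1,3)] C_inf_on_continuous[OF i1(7)] U(2,3) u unfolding \<Omega>_def
    by (auto intro!: connected_continuous_image intro: continuous_on_subset)
  have hG: "G holomorphic_on \<Omega>" using 1(8) by (simp add: \<Omega>_def U_def)
  have n1: "norm (deriv G z) = 1" if z: "z \<in> \<Omega>" for z
  proof -
    obtain x where x: "x \<in> U" "z = \<phi>1 x" using z unfolding \<Omega>_def by blast
    then have "x \<in> cdom c" "x \<in> upper" using U(4) by (auto simp: U_def)
    then have "inv_chart c x \<in> M - bd" using upper_iff[OF A(1)] by blast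
    then show ?thesis using 1(9) x one by (simp add: U_def)
  qed
  \<comment> \<open>A holomorphic function of constant modulus attains its maximum modulus inside
    and is therefore constant.\<close>
  have "deriv G constant_on \<Omega>"
    by (rule maximum_modulus_principle[OF holomorphic_deriv[OF hG \<Omega>(1)] \<Omega>(1,2,1) order_refl \<Omega>(3)]) (simp add: n1 \<Omega>(3))
  then obtain a where a: "\<And>z. z \<in> \<Omega> \<Longrightarrow> deriv G z = a" unfolding constant_on_def by blast
  have na: "norm a = 1" using n1[OF \<Omega>(3)] a[OF \<Omega>(3)] by simp
  have "(\<lambda>z. G z - a * z) constant_on \<Omega>"
  proof -
    have "((\<lambda>z. G z - a * z) has_field_derivative 0) (at z)" if "z \<in> \<Omega>" for z
    proof -
      have "(G has_field_derivative a) (at z)"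
        using holomorphic_derivI[OF hG \<Omega>(1) that] a[OF that] by simp
      then show ?thesis by (auto intro!: derivative_eq_intros)
    qed
    then show ?thesis
      using DERIV_zero_connected_constant_on[OF \<Omega>(2,1), of "{}" "\<lambda>z. G z - a * z"]
      by (force intro!: continuous_intros holomorphic_on_imp_continuous_on[OF hG])
  qed
  then obtain b where b: "\<And>z. z \<in> \<Omega> \<Longrightarrow> G z - a * z = b" unfolding constant_on_def by blast
  have cont1: "continuous_on (ball x0 r1 \<inter> half_plane) \<phi>1"
    using C_inf_on_continuous[OF i1(7)] by (rule continuous_on_subset) blast
  \<comment> \<open>Continuity of \<open>G\<close> carries the formula from the interior to the
    edge.\<close>
  have rigid: "\<phi>2 (L y) = a * \<phi>1 y + b" if y: "y \<in> ball x0 r1 \<inter> half_plane" for y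
  proof -
    have "G (\<phi>1 y) = a * \<phi>1 y + b"
    proof (rule half_plane_continuous_eq[OF _ _ _ y])
      show "continuous_on (ball x0 r1 \<inter> half_plane) (\<lambda>y. G (\<phi>1 y))"
        by (rule continuous_on_compose2[OF 1(7) cont1]) blast
      show "continuous_on (ball x0 r1 \<inter> half_plane) (\<lambda>y. a * \<phi>1 y + b)"
        using cont1 by (intro continuous_intros)
      show "G (\<phi>1 y) = a * \<phi>1 y + b" if "y \<in> ball x0 r1 \<inter> upper" for y
      proof -
        have "\<phi>1 y \<in> \<Omega>" using that by (auto simp: \<Omega>_def U_def)
        from b[OF this] show ?thesis by (simp add: algebra_simps)
      qed
    qed
    then show ?thesis using 1(6)[OF y] by simp
  qed
  define \<gamma> where "\<gamma> = inv_into (ball y0 r2) \<phi>2"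
  define R where "R y = a * \<phi>1 y + b" for y
  \<comment> \<open>The formula makes sense on a full neighbourhood, beyond the edge where \<psi> is
    not defined: this is the smooth extension required by \<open>smooth_on\<close>.\<close>
  define F where "F y = \<gamma> (R y)" for y
  define W where "W = ball x0 r1 \<inter> R -` (\<phi>2 ` ball y0 r2)"
  have Rsm: "C_inf_on R (ball x0 r1)"
    unfolding R_def[abs_def] using i1(7)
    by (intro allI C_k_on_add[OF open_ball] C_k_on_mult[OF open_ball] C_k_on_const) blast
  have W: "open W" unfolding W_def
    by (rule continuous_open_preimage[OF C_inf_on_continuous[OF Rsm] open_ball i2(5)])
  have LW: "F y = L y" "y \<in> W" if y: "y \<in> ball x0 r1 \<inter> half_plane" for y
  proof -
    have "R y = \<phi>2 (L y)" "L y \<in> ball y0 r2" using rigid[OF y] 1(5)[OF y] by (auto simp: R_def)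
    then show "F y = L y" "y \<in> W" using i2(1)[of "L y"] y by (auto simp: F_def \<gamma>_def W_def)
  qed
  have x0r: "x0 \<in> ball x0 r1 \<inter> half_plane" using x0h r(1) by simp
  have x0W: "x0 \<in> W" by (rule LW(2)[OF x0r])
  have Fsm: "C_inf_on F W"
  proof
    fix k
    have RW: "C_k_on k R W" using Rsm C_k_on_subset[of k R "ball x0 r1" W] by (auto simp: W_def)
    have \<gamma>: "C_k_on k \<gamma> (\<phi>2 ` ball y0 r2)" using i2(4) unfolding \<gamma>_def by blast
    show "C_k_on k F W" unfolding F_def[abs_def]
      by (rule C_k_on_compose[OF W i2(5) _ RW \<gamma>]) (auto simp: W_def)
  qed
  show ?thesis
  proof (rule that[OF W x0W Fsm])
    fix y assume y: "y \<in> W \<inter> local_dom M c d \<psi>"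
    then have "y \<in> ball x0 r1 \<inter> half_plane" using c(4) unfolding local_dom_eq[OF A(1)] W_def by blast
    then show "F y = local_rep c d \<psi> y" using LW(1) by (simp add: L_def)
  next
    fix v
    have dF: "(F has_derivative frechet_derivative F (at x0)) (at x0)" using Fsm x0W by (rule C_inf_on_has_derivative)
    have Fx0: "F x0 = y0" using LW(1)[OF x0r] y0 by simp
    have d2: "(\<phi>2 has_derivative frechet_derivative \<phi>2 (at y0)) (at (F x0))"
      unfolding Fx0 using r(2) by (intro C_inf_on_has_derivative[OF i2(7)]) simp
    have d1: "(\<phi>1 has_derivative frechet_derivative \<phi>1 (at x0)) (at x0)"
      using r(1) by (intro C_inf_on_has_derivative[OF i1(7)]) simp
    have "((\<lambda>y. \<phi>2 (F y)) has_derivative (\<lambda>v. frechet_derivative \<phi>2 (at y0) (frechet_derivative F (at x0) v))) (at x0)"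
      using diff_chain_at[OF dF d2] by (simp add: o_def)
    moreover have "\<phi>2 (F y) = R y" if "y \<in> W" for y
      using i2(3)[of "R y"] that by (simp add: F_def \<gamma>_def W_def)
    ultimately have "(R has_derivative (\<lambda>v. frechet_derivative \<phi>2 (at y0) (frechet_derivative F (at x0) v))) (at x0)"
      by (rule has_derivative_transform_within_open[OF _ W x0W]) 
    moreover have "(R has_derivative (\<lambda>v. a * frechet_derivative \<phi>1 (at x0) v)) (at x0)"
      unfolding R_def[abs_def] using d1 by (auto intro!: derivative_eq_intros)
    ultimately have "frechet_derivative \<phi>2 (at y0) (frechet_derivative F (at x0) v) = a * frechet_derivative \<phi>1 (at x0) v"
      using has_derivative_unique by metis
    then have "(norm (frechet_derivative \<phi>2 (at y0) (frechet_derivative F (at x0) v)))\<^sup>2 = (norm (frechet_derivative \<phi>1 (at x0) v))\<^sup>2"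
      using na by (simp add: norm_mult)
    moreover have "y0 \<in> ball y0 r2 \<inter> half_plane" using r(2) p(3) d(4) by (auto simp: y0_def)
    ultimately show "frechet_derivative F (at x0) v \<bullet> (g2 d (local_rep c d \<psi> x0) *v frechet_derivative F (at x0) v) = v \<bullet> (g1 c x0 *v v)"
      using 1(1,3) x0r y0 unfolding flat_coord_def L_def by metis
  qed
qed

lemma smooth_map_if_conf_factor_1:
  assumes cd: "conf_data g1 g2 \<psi> \<sigma>" and one: "\<And>q. q \<in> M - bd \<Longrightarrow> \<sigma> q = 1"
    and \<psi>: "continuous_on M \<psi>" "\<psi> ` M \<subseteq> M"
  shows "smooth_map M \<A> M \<A> \<psi>"
  unfolding smooth_map_def smooth_on_def
proof (intro conjI ballI)
  fix c d x assume "c \<in> \<A>" "d \<in> \<A>" "x \<in> local_dom M c d \<psi>"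
  from isometry_local[OF cd one \<psi> this]
  show "\<exists>W F. open W \<and> x \<in> W \<and> (\<forall>k. C_k_on k F W) \<and> (\<forall>y\<in>W \<inter> local_dom M c d \<psi>. F y = local_rep c d \<psi> y)"
    by metis
qed (fact \<psi>)+

lemma pullback_if_conf_factor_1:
  assumes cd: "conf_data g1 g2 \<psi> \<sigma>" and one: "\<And>q. q \<in> M - bd \<Longrightarrow> \<sigma> q = 1"
    and \<psi>: "continuous_on M \<psi>" "\<psi> ` M \<subseteq> M" and g: "riemannian_metric M \<A> g1" "riemannian_metric M \<A> g2"
    and A: "c \<in> \<A>" "d \<in> \<A>" "x \<in> local_dom M c d \<psi>"
  shows "pullback M c d \<psi> g2 x = g1 c x"
proof -
  note d = is_chart_facts[OF chart[OF A(2)]]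
  have x: "x \<in> cdom c" "\<psi> (inv_chart c x) \<in> fst d" using A(3) unfolding local_dom_eq[OF A(1)] by auto
  have "local_rep c d \<psi> x \<in> cdom d" using x(2) by (simp add: local_rep_def)
  then have s2: "transpose (g2 d (local_rep c d \<psi> x)) = g2 d (local_rep c d \<psi> x)"
    using g(2) A(2) unfolding riemannian_metric_def by blast
  have s1: "transpose (g1 c x) = g1 c x" using g(1) A(1) x(1) unfolding riemannian_metric_def by blast
  obtain W F where W: "open W" "x \<in> W" "C_inf_on F W" "\<And>y. y \<in> W \<inter> local_dom M c d \<psi> \<Longrightarrow> F y = local_rep c d \<psi> y"
    and iso: "\<And>v. frechet_derivative F (at x) v \<bullet> (g2 d (local_rep c d \<psi> x) *v frechet_derivative F (at x) v) = v \<bullet> (g1 c x *v v)"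
    using isometry_local[OF cd one \<psi> A] by metis
  have J: "local_jac M c d \<psi> x *v v = frechet_derivative F (at x) v" for v
    by (rule local_jac_extension[OF A(1,2) \<psi> A(3) W])
  show ?thesis
  \<comment> \<open>Both matrices are symmetric, so it suffices to compare their quadratic
    forms.\<close>
  proof (rule symmetric_matrix_eqI[OF _ s1])
    show "transpose (pullback M c d \<psi> g2 x) = pullback M c d \<psi> g2 x"
      unfolding pullback_def by (simp add: matrix_transpose_mul s2 matrix_mul_assoc)
    show "v \<bullet> (pullback M c d \<psi> g2 x *v v) = v \<bullet> (g1 c x *v v)" for v
      unfolding pullback_def inner_pullback J iso ..
  qed
qed

end

theorem proposition4p1:
  fixes M :: "'a::{t2_space,second_countable_topology} set"
    and \<A> :: "'a chart set"
    and g\<^sub>1 g\<^sub>2 :: "'a metric"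
    and \<psi> :: "'a \<Rightarrow> 'a"
  assumes "oriented_surface M \<A>"
    and "compact M" and "connected M"
    and "boundary_of M \<A> \<noteq> {}"
    and "flat_metric M \<A> g\<^sub>1" and "flat_metric M \<A> g\<^sub>2"
    and "same_arc_length (boundary_of M \<A>) \<A> g\<^sub>1 g\<^sub>2"
    and "\<exists>\<psi>'. homeomorphism M M \<psi> \<psi>'"
    and "\<forall>p\<in>boundary_of M \<A>. \<psi> p = p"
    and "conformal_map (M - boundary_of M \<A>) \<A> g\<^sub>1 (M - boundary_of M \<A>) \<A> g\<^sub>2 \<psi>"
  shows "riemannian_isometry M \<A> g\<^sub>1 M \<A> g\<^sub>2 \<psi>"
proof -
  interpret bordered_surface M \<A>
    using assms(1) by unfold_locales (simp add: oriented_surface_def)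
  have g: "riemannian_metric M \<A> g\<^sub>1" "riemannian_metric M \<A> g\<^sub>2"
    using assms(5,6) by (auto simp: flat_metric_def)
  obtain \<psi>' where hom: "homeomorphism M M \<psi> \<psi>'" using assms(8) by blast
  note hom' = homeomorphism_symD[OF hom]
  have \<psi>: "continuous_on M \<psi>" "\<psi> ` M \<subseteq> M" using homeomorphism_cont1[OF hom] homeomorphism_image1[OF hom] by auto
  have \<psi>': "continuous_on M \<psi>'" "\<psi>' ` M \<subseteq> M" using homeomorphism_cont2[OF hom] homeomorphism_image2[OF hom] by auto
  note id' = homeomorphism_boundary(1)[OF hom assms(9)]
  note speed = boundary_speed[OF g assms(7)]
  obtain \<sigma> where \<sigma>: "\<And>q. q \<in> M - bd \<Longrightarrow> 0 < \<sigma> q" "conf_data g\<^sub>1 g\<^sub>2 \<psi> \<sigma>"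
    using conformal_conf_data[OF assms(5,6) \<psi> assms(10)] by blast
  note inverse = conf_data_inverse[OF \<sigma>(2) hom assms(9)]
  have interior: "\<psi> q \<in> M - bd" "\<psi>' q \<in> M - bd" if "q \<in> M - bd" for q
    using homeomorphism_boundary(2)[OF hom assms(9), of q] homeomorphism_boundary(2)[OF hom' id', of q] that \<psi>(2) \<psi>'(2)
    by auto
  have one: "\<sigma> q = 1" if q: "q \<in> M - bd" for q
  proof -
    have "\<sigma> q \<le> 1" by (rule conf_factor_le_1[OF assms(2-4) \<sigma>(2) \<psi>(2) assms(9) speed q])
    \<comment> \<open>The bound for the inverse homeomorphism, taken at \<open>\<psi> q\<close>,
      where its factor is the reciprocal of \<open>\<sigma> q\<close>.\<close>
    moreover have "1 / \<sigma> (\<psi>' (\<psi> q)) \<le> 1"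
      by (rule conf_factor_le_1[OF assms(2-4) inverse \<psi>'(2) id' speed[symmetric] interior(1)[OF q]])
    then have "1 / \<sigma> q \<le> 1" using homeomorphism_apply1[OF hom] q by simp
    then have "1 \<le> \<sigma> q" using \<sigma>(1)[OF q] by (simp add: divide_le_eq)
    ultimately show ?thesis by simp
  qed
  have "smooth_map M \<A> M \<A> \<psi>" by (rule smooth_map_if_conf_factor_1[OF \<sigma>(2) one \<psi>])
  moreover have "smooth_map M \<A> M \<A> \<psi>'"
    by (rule smooth_map_if_conf_factor_1[OF inverse _ \<psi>']) (simp add: one[OF interior(2)])
  ultimately have "diffeo M \<A> M \<A> \<psi>"
    unfolding diffeo_def using homeomorphism_apply1[OF hom] homeomorphism_apply2[OF hom] by blast
  then show ?thesis
    unfolding riemannian_isometry_def using pullback_if_conf_factor_1[OF \<sigma>(2) one \<psi> g] by blast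
qed

end
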